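(* Let $X$ be a compact Hausdorff space, $\mu$ a regular Borel probability measure on $X$, and $\varphi\colon X\to X$ a $\mu$-preserving map such that: (1) $\varphi$ is a local homeomorphism of $X$ such that each point of $X$ has exactly $N>1$ pre-images; (2) $\{U_i\}_{i=1}^N$ is a family of pairwise disjoint open subsets of $X$ such that $\varphi|_{U_i}$ is one-to-one for all $i$, $\varphi(U_i)=\varphi(U_j)$ for all $i,j$, $X=\bigcup_{i=1}^N(U_i\cup\partial U_i)$, and $X=\varphi(U_i)\cup\partial\varphi(U_i)$ for all $i$; and the boundaries $\partial U_i$ are $\mu$-null sets; (3) $\varphi$ is ergodic and preserves the null sets; (4) the sets $U_{\boldsymbol{i}}$, for $\boldsymbol{i}\in\mathbb{F}_N^+$, generate the $\sigma$-algebra of measurable sets up to sets of measure zero. Then there is a Cuntz family $\{S_i\}_{i=1}^N$ in $\mathcal{B}(L^2(X,\mu))$ such that the $*$-endomorphism $\alpha_S(T)=\sum_{i=1}^N S_iTS_i^*$ of $\mathcal{B}(L^2(X,\mu))$ extends $\alpha\colon M_f\mapsto M_{f\circ\varphi}$ $(f\in L^\infty(X,\mu))$ and $\alpha_S$ is ergodic. Furthermore, the associated representation of the Cuntz algebra $\mathcal{O}_N$ on $L^2(X,\mu)$, sending the $i$-th canonical generator to $S_i$, is irreducible.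
   Context: $\varphi$ is a local homeomorphism if every $x\in X$ has a neighborhood on which $\varphi$ restricts to a homeomorphism onto its image; local homeomorphisms are taken to be continuous and open. $\varphi$ preserves the null sets if $\mu(E)=0$ implies $\mu(\varphi(E))=0$. $\varphi$ is ergodic if every measurable $E$ with $\varphi^{-1}(E)=E$ up to a null set satisfies $\mu(E)\in\{0,1\}$. $\mathbb{F}_N^+$ is the set of finite words on the symbols $\{1,\dots,N\}$, and for a word $\boldsymbol{i}=i_1i_2\dots i_k$, $U_{i_1\dots i_k}=\{x\in X: x\in U_{i_1},\ \varphi(x)\in U_{i_2},\dots,\varphi^{k-1}(x)\in U_{i_k}\}$. $M_f$ is the operator of multiplication by $f$ on $L^2(X,\mu)$. A Cuntz family $\{S_i\}_{i=1}^N$ in $\mathcal{B}(H)$ satisfies $S_i^*S_j=\delta_{ij}I$ and $\sum_{i=1}^N S_iS_i^*=I$. The endomorphism $\alpha_S$ is ergodic if the von Neumann algebra $\{T\in\mathcal{B}(L^2(X,\mu)):\alpha_S(T)=T\}$ equals $\mathbb{C}I$. *)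

theory Defs
  imports "HOL-Probability.Probability_Measure" "HOL-Algebra.Module"
begin

section \<open>Maps on a measure space\<close>

definition local_homeo :: "('a::topological_space \<Rightarrow> 'b::topological_space) \<Rightarrow> bool" where
  "local_homeo \<phi> \<longleftrightarrow>
     continuous_on UNIV \<phi> \<and> (\<forall>V. open V \<longrightarrow> open (\<phi> ` V)) \<and>
     (\<forall>x. \<exists>V. open V \<and> x \<in> V \<and> (\<exists>\<psi>. homeomorphism V (\<phi> ` V) \<phi> \<psi>))"

definition regular_borel_measure :: "'a::topological_space measure \<Rightarrow> bool" where
  "regular_borel_measure M \<longleftrightarrow> sets M = sets borel \<and>
     (\<forall>E\<in>sets M.
        emeasure M E = (SUP K\<in>{K. K \<subseteq> E \<and> compact K \<and> K \<in> sets M}. emeasure M K) \<and>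
        emeasure M E = (INF V\<in>{V. E \<subseteq> V \<and> open V}. emeasure M V))"

definition preserves_measure :: "'a measure \<Rightarrow> ('a \<Rightarrow> 'a) \<Rightarrow> bool" where
  "preserves_measure M \<phi> \<longleftrightarrow> \<phi> \<in> measurable M M \<and> distr M M \<phi> = M"

definition preserves_null_sets :: "'a measure \<Rightarrow> ('a \<Rightarrow> 'a) \<Rightarrow> bool" where
  "preserves_null_sets M \<phi> \<longleftrightarrow> (\<forall>E\<in>null_sets M. \<phi> ` E \<in> null_sets M)"

definition ergodic_map :: "'a measure \<Rightarrow> ('a \<Rightarrow> 'a) \<Rightarrow> bool" where
  "ergodic_map M \<phi> \<longleftrightarrow>
     (\<forall>E\<in>sets M. sym_diff (\<phi> -` E \<inter> space M) E \<in> null_sets M \<longrightarrow> measure M E \<in> {0, 1})"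

definition word_set :: "('a \<Rightarrow> 'a) \<Rightarrow> (nat \<Rightarrow> 'a set) \<Rightarrow> nat list \<Rightarrow> 'a set" where
  "word_set \<phi> U w = {x. \<forall>k<length w. (\<phi> ^^ k) x \<in> U (w ! k)}"

definition generates_mod_null :: "'a measure \<Rightarrow> 'a set set \<Rightarrow> bool" where
  "generates_mod_null M \<G> \<longleftrightarrow>
     (\<forall>E\<in>sets M. \<exists>F\<in>sigma_sets (space M) \<G>. sym_diff E F \<in> null_sets M)"


section \<open>Unital complex *-algebras\<close>

record 'b star_algebra = "(complex, 'b) module" +
  star :: "'b \<Rightarrow> 'b"

definition star_hom ::
  "('b, 'm) star_algebra_scheme \<Rightarrow> ('c, 'n) star_algebra_scheme \<Rightarrow> ('b \<Rightarrow> 'c) set" where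
  "star_hom A B = {h \<in> ring_hom A B. \<forall>a\<in>carrier A.
     (\<forall>c. h (c \<odot>\<^bsub>A\<^esub> a) = c \<odot>\<^bsub>B\<^esub> h a) \<and> h (star A a) = star B (h a)}"

definition cuntz_family :: "('b, 'm) star_algebra_scheme \<Rightarrow> nat \<Rightarrow> (nat \<Rightarrow> 'b) \<Rightarrow> bool" where
  "cuntz_family A N S \<longleftrightarrow>
     (\<forall>i\<in>{1..N}. S i \<in> carrier A) \<and>
     (\<forall>i\<in>{1..N}. \<forall>j\<in>{1..N}. star A (S i) \<otimes>\<^bsub>A\<^esub> S j = (if i = j then \<one>\<^bsub>A\<^esub> else \<zero>\<^bsub>A\<^esub>)) \<and>
     (\<Oplus>\<^bsub>A\<^esub>i\<in>{1..N}. S i \<otimes>\<^bsub>A\<^esub> star A (S i)) = \<one>\<^bsub>A\<^esub>"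

definition cuntz_endo ::
  "('b, 'm) star_algebra_scheme \<Rightarrow> nat \<Rightarrow> (nat \<Rightarrow> 'b) \<Rightarrow> 'b \<Rightarrow> 'b" where
  "cuntz_endo A N S T = (\<Oplus>\<^bsub>A\<^esub>i\<in>{1..N}. S i \<otimes>\<^bsub>A\<^esub> T \<otimes>\<^bsub>A\<^esub> star A (S i))"

definition ergodic_endo :: "('b, 'm) star_algebra_scheme \<Rightarrow> ('b \<Rightarrow> 'b) \<Rightarrow> bool" where
  "ergodic_endo A \<alpha> \<longleftrightarrow> {T \<in> carrier A. \<alpha> T = T} = range (\<lambda>c. c \<odot>\<^bsub>A\<^esub> \<one>\<^bsub>A\<^esub>)"


section \<open>Bounded operators on a Hilbert space\<close>

record 'v hilbert =
  hcarrier :: "'v set"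
  hzero :: 'v
  hadd :: "'v \<Rightarrow> 'v \<Rightarrow> 'v"
  hscale :: "complex \<Rightarrow> 'v \<Rightarrow> 'v"
  hinner :: "'v \<Rightarrow> 'v \<Rightarrow> complex"

definition hnorm :: "'v hilbert \<Rightarrow> 'v \<Rightarrow> real" where
  "hnorm H \<xi> = sqrt (Re (hinner H \<xi> \<xi>))"

definition hdist :: "'v hilbert \<Rightarrow> 'v \<Rightarrow> 'v \<Rightarrow> real" where
  "hdist H \<xi> \<eta> = hnorm H (hadd H \<xi> (hscale H (- 1) \<eta>))"

text \<open>
  Operators are extensional functions on the carrier, so that equality in HOL is equality of
  operators.
\<close>

definition bounded_ops :: "'v hilbert \<Rightarrow> ('v \<Rightarrow> 'v) set" where
  "bounded_ops H = {T \<in> hcarrier H \<rightarrow>\<^sub>E hcarrier H.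
     (\<forall>\<xi>\<in>hcarrier H. \<forall>\<eta>\<in>hcarrier H. T (hadd H \<xi> \<eta>) = hadd H (T \<xi>) (T \<eta>)) \<and>
     (\<forall>c. \<forall>\<xi>\<in>hcarrier H. T (hscale H c \<xi>) = hscale H c (T \<xi>)) \<and>
     (\<exists>C. \<forall>\<xi>\<in>hcarrier H. hnorm H (T \<xi>) \<le> C * hnorm H \<xi>)}"

definition adjoint_op :: "'v hilbert \<Rightarrow> ('v \<Rightarrow> 'v) \<Rightarrow> 'v \<Rightarrow> 'v" where
  "adjoint_op H T = (THE S. S \<in> bounded_ops H \<and>
     (\<forall>\<xi>\<in>hcarrier H. \<forall>\<eta>\<in>hcarrier H. hinner H (T \<xi>) \<eta> = hinner H \<xi> (S \<eta>)))"

definition op_algebra :: "'v hilbert \<Rightarrow> ('v \<Rightarrow> 'v) star_algebra" where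
  "op_algebra H =
     \<lparr> carrier = bounded_ops H,
       mult = (\<lambda>S T. compose (hcarrier H) S T),
       one = (\<lambda>\<xi>\<in>hcarrier H. \<xi>),
       zero = (\<lambda>\<xi>\<in>hcarrier H. hzero H),
       add = (\<lambda>S T. \<lambda>\<xi>\<in>hcarrier H. hadd H (S \<xi>) (T \<xi>)),
       smult = (\<lambda>c T. \<lambda>\<xi>\<in>hcarrier H. hscale H c (T \<xi>)),
       star = adjoint_op H \<rparr>"

definition closed_subspace :: "'v hilbert \<Rightarrow> 'v set \<Rightarrow> bool" where
  "closed_subspace H K \<longleftrightarrow>
     K \<subseteq> hcarrier H \<and> hzero H \<in> K \<and>
     (\<forall>\<xi>\<in>K. \<forall>\<eta>\<in>K. hadd H \<xi> \<eta> \<in> K) \<and> (\<forall>c. \<forall>\<xi>\<in>K. hscale H c \<xi> \<in> K) \<and>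
     (\<forall>s. \<forall>\<xi>\<in>hcarrier H. (\<forall>n. s n \<in> K) \<and> (\<lambda>n. hdist H (s n) \<xi>) \<longlonglongrightarrow> 0 \<longrightarrow> \<xi> \<in> K)"

definition irreducible_rep ::
  "('b, 'm) star_algebra_scheme \<Rightarrow> 'v hilbert \<Rightarrow> ('b \<Rightarrow> 'v \<Rightarrow> 'v) \<Rightarrow> bool" where
  "irreducible_rep A H \<pi> \<longleftrightarrow> hcarrier H \<noteq> {hzero H} \<and>
     (\<forall>K. closed_subspace H K \<and> (\<forall>a\<in>carrier A. \<pi> a ` K \<subseteq> K) \<longrightarrow>
        K = {hzero H} \<or> K = hcarrier H)"


section \<open>The Hilbert space of square integrable functions\<close>

definition rep :: "'b set \<Rightarrow> 'b" where
  "rep \<xi> = (SOME f. f \<in> \<xi>)"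

definition L2_fun :: "'a measure \<Rightarrow> ('a \<Rightarrow> complex) set" where
  "L2_fun M = {f \<in> borel_measurable M. integrable M (\<lambda>x. (cmod (f x))\<^sup>2)}"

definition L2_class :: "'a measure \<Rightarrow> ('a \<Rightarrow> complex) \<Rightarrow> ('a \<Rightarrow> complex) set" where
  "L2_class M f = {g \<in> L2_fun M. AE x in M. g x = f x}"

definition L2 :: "'a measure \<Rightarrow> ('a \<Rightarrow> complex) set hilbert" where
  "L2 M =
     \<lparr> hcarrier = L2_class M ` L2_fun M,
       hzero = L2_class M (\<lambda>x. 0),
       hadd = (\<lambda>\<xi> \<eta>. L2_class M (\<lambda>x. rep \<xi> x + rep \<eta> x)),
       hscale = (\<lambda>c \<xi>. L2_class M (\<lambda>x. c * rep \<xi> x)),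
       hinner = (\<lambda>\<xi> \<eta>. \<integral>x. rep \<xi> x * cnj (rep \<eta> x) \<partial>M) \<rparr>"

definition L_infty_fun :: "'a measure \<Rightarrow> ('a \<Rightarrow> complex) set" where
  "L_infty_fun M = {f \<in> borel_measurable M. \<exists>C. AE x in M. cmod (f x) \<le> C}"

definition mult_op ::
  "'a measure \<Rightarrow> ('a \<Rightarrow> complex) \<Rightarrow> ('a \<Rightarrow> complex) set \<Rightarrow> ('a \<Rightarrow> complex) set" where
  "mult_op M f = (\<lambda>\<xi>\<in>hcarrier (L2 M). L2_class M (\<lambda>x. f x * rep \<xi> x))"


section \<open>The Cuntz algebra\<close>

text \<open>
  The Cuntz algebra is constructed as the universal C*-algebra on \<open>N\<close> generators subject to the
  Cuntz relations: the free unital *-algebra is completed in the largest C*-seminorm that vanishes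
  on the relations. That seminorm is finite, because a C*-seminorm \<open>p\<close> vanishing on the relations
  has \<open>p 1 \<le> 1\<close>, hence \<open>p s\<^sub>i \<le> 1\<close>.

  In the free algebra the letter \<open>(i, False)\<close> stands for the generator with index \<open>i\<close> and
  \<open>(i, True)\<close> for its adjoint. Elements are coefficient functions with finite support.
\<close>

definition free_star_algebra :: "nat \<Rightarrow> ((nat \<times> bool) list \<Rightarrow> complex) star_algebra" where
  "free_star_algebra N =
     \<lparr> carrier = {a. finite {w. a w \<noteq> 0} \<and> {w. a w \<noteq> 0} \<subseteq> lists ({1..N} \<times> UNIV)},
       mult = (\<lambda>a b w. \<Sum>k\<le>length w. a (take k w) * b (drop k w)),
       one = (\<lambda>w. if w = [] then 1 else 0),
       zero = (\<lambda>w. 0),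
       add = (\<lambda>a b w. a w + b w),
       smult = (\<lambda>c a w. c * a w),
       star = (\<lambda>a w. cnj (a (rev (map (\<lambda>(i, e). (i, \<not> e)) w)))) \<rparr>"

definition free_gen :: "nat \<Rightarrow> (nat \<times> bool) list \<Rightarrow> complex" where
  "free_gen i = (\<lambda>w. if w = [(i, False)] then 1 else 0)"

definition cuntz_relations :: "nat \<Rightarrow> ((nat \<times> bool) list \<Rightarrow> complex) set" where
  "cuntz_relations N = (let F = free_star_algebra N in
     {star F (free_gen i) \<otimes>\<^bsub>F\<^esub> free_gen j \<ominus>\<^bsub>F\<^esub> (if i = j then \<one>\<^bsub>F\<^esub> else \<zero>\<^bsub>F\<^esub>) | i j.
        i \<in> {1..N} \<and> j \<in> {1..N}} \<union>
     {(\<Oplus>\<^bsub>F\<^esub>i\<in>{1..N}. free_gen i \<otimes>\<^bsub>F\<^esub> star F (free_gen i)) \<ominus>\<^bsub>F\<^esub> \<one>\<^bsub>F\<^esub>})"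

definition cstar_seminorm :: "('b, 'm) star_algebra_scheme \<Rightarrow> ('b \<Rightarrow> real) \<Rightarrow> bool" where
  "cstar_seminorm A p \<longleftrightarrow> (\<forall>a\<in>carrier A. 0 \<le> p a \<and>
     (\<forall>c. p (c \<odot>\<^bsub>A\<^esub> a) = cmod c * p a) \<and> p (star A a \<otimes>\<^bsub>A\<^esub> a) = (p a)\<^sup>2 \<and>
     (\<forall>b\<in>carrier A. p (a \<oplus>\<^bsub>A\<^esub> b) \<le> p a + p b \<and> p (a \<otimes>\<^bsub>A\<^esub> b) \<le> p a * p b))"

definition universal_seminorm :: "('b, 'm) star_algebra_scheme \<Rightarrow> 'b set \<Rightarrow> 'b \<Rightarrow> real" where
  "universal_seminorm A R a = (SUP p\<in>{p. cstar_seminorm A p \<and> (\<forall>r\<in>R. p r = 0)}. p a)"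

definition cauchy_seqs ::
  "('b, 'm) star_algebra_scheme \<Rightarrow> ('b \<Rightarrow> real) \<Rightarrow> (nat \<Rightarrow> 'b) set" where
  "cauchy_seqs A p = {a. (\<forall>n. a n \<in> carrier A) \<and>
     (\<forall>e>0. \<exists>n0. \<forall>m\<ge>n0. \<forall>n\<ge>n0. p (a m \<ominus>\<^bsub>A\<^esub> a n) < e)}"

definition completion_class ::
  "('b, 'm) star_algebra_scheme \<Rightarrow> ('b \<Rightarrow> real) \<Rightarrow> (nat \<Rightarrow> 'b) \<Rightarrow> (nat \<Rightarrow> 'b) set" where
  "completion_class A p a = {b \<in> cauchy_seqs A p. (\<lambda>n. p (b n \<ominus>\<^bsub>A\<^esub> a n)) \<longlonglongrightarrow> 0}"

text \<open>
  Elements of seminorm \<open>0\<close> are identified with \<open>0\<close> here, so the result is the Hausdorff completion.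
\<close>

definition completion ::
  "('b, 'm) star_algebra_scheme \<Rightarrow> ('b \<Rightarrow> real) \<Rightarrow> (nat \<Rightarrow> 'b) set star_algebra" where
  "completion A p = (let cl = completion_class A p in
     \<lparr> carrier = cl ` cauchy_seqs A p,
       mult = (\<lambda>x y. cl (\<lambda>n. rep x n \<otimes>\<^bsub>A\<^esub> rep y n)),
       one = cl (\<lambda>n. \<one>\<^bsub>A\<^esub>),
       zero = cl (\<lambda>n. \<zero>\<^bsub>A\<^esub>),
       add = (\<lambda>x y. cl (\<lambda>n. rep x n \<oplus>\<^bsub>A\<^esub> rep y n)),
       smult = (\<lambda>c x. cl (\<lambda>n. c \<odot>\<^bsub>A\<^esub> rep x n)),
       star = (\<lambda>x. cl (\<lambda>n. star A (rep x n))) \<rparr>)"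

definition cuntz_seminorm :: "nat \<Rightarrow> ((nat \<times> bool) list \<Rightarrow> complex) \<Rightarrow> real" where
  "cuntz_seminorm N = universal_seminorm (free_star_algebra N) (cuntz_relations N)"

definition cuntz_algebra :: "nat \<Rightarrow> (nat \<Rightarrow> (nat \<times> bool) list \<Rightarrow> complex) set star_algebra" where
  "cuntz_algebra N = completion (free_star_algebra N) (cuntz_seminorm N)"

definition cuntz_gen :: "nat \<Rightarrow> nat \<Rightarrow> (nat \<Rightarrow> (nat \<times> bool) list \<Rightarrow> complex) set" where
  "cuntz_gen N i = completion_class (free_star_algebra N) (cuntz_seminorm N) (\<lambda>n. free_gen i)"

definition cuntz_rep ::
  "nat \<Rightarrow> 'v hilbert \<Rightarrow> (nat \<Rightarrow> 'v \<Rightarrow> 'v) \<Rightarrow>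
   ((nat \<Rightarrow> (nat \<times> bool) list \<Rightarrow> complex) set \<Rightarrow> 'v \<Rightarrow> 'v) \<Rightarrow> bool" where
  "cuntz_rep N H S \<pi> \<longleftrightarrow>
     \<pi> \<in> star_hom (cuntz_algebra N) (op_algebra H) \<and> (\<forall>i\<in>{1..N}. \<pi> (cuntz_gen N i) = S i)"

end

theory Submission
  imports Defs
begin

text \<open>
  Write \<open>\<mu>\<close> for the measure. For each branch \<open>U\<^sub>i\<close> the measure \<open>E \<mapsto> \<mu> (U\<^sub>i \<inter> \<phi>\<^sup>-\<^sup>1 E)\<close> is dominated by \<open>\<mu>\<close>,
  because \<open>\<phi>\<close> preserves \<open>\<mu>\<close>, and it has the same null sets as \<open>\<mu>\<close>, because \<open>\<phi>\<close> maps null sets to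
  null sets and \<open>\<phi> (U\<^sub>i)\<close> has full measure (by compactness its complement lies in the image of the
  boundary of \<open>U\<^sub>i\<close>). It therefore has a strictly positive density \<open>J\<^sub>i\<close>, and

    \<open>S\<^sub>i f = 1\<^bsub>U\<^sub>i\<^esub> (f \<circ> \<phi>) / \<surd> (J\<^sub>i \<circ> \<phi>)\<close>

  is an isometry of \<open>L\<^sup>2\<close> onto the functions supported in \<open>U\<^sub>i\<close>, with adjoint
  \<open>g \<mapsto> \<surd> J\<^sub>i (g \<circ> \<psi>\<^sub>i)\<close>, where \<open>\<psi>\<^sub>i\<close> inverts \<open>\<phi>\<close> on \<open>U\<^sub>i\<close>. The \<open>U\<^sub>i\<close> are disjoint and cover almost
  everything, so the \<open>S\<^sub>i\<close> form a Cuntz family (\<open>branch_op_family\<close>), and \<open>S\<^sub>i M\<^sub>f = M\<^bsub>f \<circ> \<phi>\<^esub> S\<^sub>i\<close>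
  gives \<open>\<alpha>\<^sub>S (M\<^sub>f) = M\<^bsub>f \<circ> \<phi>\<^esub>\<close> (\<open>endo_mult_op\<close>).

  Ergodicity (\<open>endo_ergodic\<close>). An operator \<open>T\<close> fixed by \<open>\<alpha>\<^sub>S\<close> commutes with all \<open>S\<^sub>i\<close> and \<open>S\<^sub>i\<^sup>*\<close>. As
  multiplication by the indicator of \<open>U\<^sub>i \<inter> \<phi>\<^sup>-\<^sup>1 E\<close> is \<open>S\<^sub>i M\<^sub>E S\<^sub>i\<^sup>*\<close>, the operator \<open>T\<close> commutes with the
  indicators of all word sets, and hence, the word sets being generating, with those of all
  measurable sets. So \<open>T\<close> is multiplication by \<open>g = T 1\<close>; commutation with \<open>S\<^sub>i\<close> gives
  \<open>g \<circ> \<phi> = g\<close>, and \<open>g\<close> is constant because \<open>\<phi>\<close> is ergodic.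

  Irreducibility (\<open>cuntz_rep_irreducible\<close>). The projection onto an invariant subspace of a
  representation of the Cuntz algebra commutes with all \<open>S\<^sub>i\<close> and \<open>S\<^sub>i\<^sup>*\<close>, so it is fixed by \<open>\<alpha>\<^sub>S\<close> and
  is a scalar, \<open>0\<close> or \<open>1\<close>.

  The existence of the representation (\<open>cuntz_rep_exists\<close>) holds for a Cuntz family on any Hilbert
  space: substituting the \<open>S\<^sub>i\<close> into noncommutative polynomials yields a C*-seminorm vanishing on the
  Cuntz relations, so the substitution is contractive for the universal seminorm and extends to the
  completion. The Hilbert space theory on which all this rests (adjoints, projections, operator
  limits) comes from the Riesz representation theorem and the completeness of \<open>L\<^sup>2\<close>.
\<close>

section \<open>Hilbert spaces as records\<close>

text \<open>
  Nondegeneracy is assumed in the form that vectors with the same inner products are equal. Every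
  vector identity then reduces to an identity between complex numbers, and the vector space laws
  follow from sesquilinearity.
\<close>

locale hilbert_space =
  fixes H :: "'v hilbert"
  assumes zero_closed [simp]: "hzero H \<in> hcarrier H"
    and add_closed [simp]: "x \<in> hcarrier H \<Longrightarrow> y \<in> hcarrier H \<Longrightarrow> hadd H x y \<in> hcarrier H"
    and scale_closed [simp]: "x \<in> hcarrier H \<Longrightarrow> hscale H c x \<in> hcarrier H"
    and inner_zero_left [simp]: "x \<in> hcarrier H \<Longrightarrow> hinner H (hzero H) x = 0"
    and inner_add_left [simp]:
      "x \<in> hcarrier H \<Longrightarrow> y \<in> hcarrier H \<Longrightarrow> z \<in> hcarrier H \<Longrightarrow>
        hinner H (hadd H x y) z = hinner H x z + hinner H y z"
    and inner_scale_left [simp]: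
      "x \<in> hcarrier H \<Longrightarrow> y \<in> hcarrier H \<Longrightarrow> hinner H (hscale H c x) y = c * hinner H x y"
    and inner_commute: "x \<in> hcarrier H \<Longrightarrow> y \<in> hcarrier H \<Longrightarrow> hinner H x y = cnj (hinner H y x)"
    and inner_nonneg: "x \<in> hcarrier H \<Longrightarrow> 0 \<le> Re (hinner H x x)"
    and inner_ext:
      "x \<in> hcarrier H \<Longrightarrow> y \<in> hcarrier H \<Longrightarrow>
        (\<And>z. z \<in> hcarrier H \<Longrightarrow> hinner H x z = hinner H y z) \<Longrightarrow> x = y"
    and complete:
      "(\<And>n. s n \<in> hcarrier H) \<Longrightarrow> (\<forall>e>0. \<exists>n0. \<forall>m\<ge>n0. \<forall>n\<ge>n0. hdist H (s m) (s n) < e) \<Longrightarrow>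
        \<exists>x\<in>hcarrier H. (\<lambda>n. hdist H (s n) x) \<longlonglongrightarrow> 0"
begin

abbreviation "V \<equiv> hcarrier H"
abbreviation "ip \<equiv> hinner H"
abbreviation "nrm \<equiv> hnorm H"
abbreviation vplus (infixl "\<boxplus>" 65) where "vplus \<equiv> hadd H"
abbreviation vscale (infixr "\<boxdot>" 70) where "vscale \<equiv> hscale H"
abbreviation vminus (infixl "\<boxminus>" 65) where "x \<boxminus> y \<equiv> x \<boxplus> (-1) \<boxdot> y"

lemma inner_zero_right [simp]: "x \<in> V \<Longrightarrow> ip x (hzero H) = 0"
  by (subst inner_commute) auto

lemma inner_add_right [simp]:
  "x \<in> V \<Longrightarrow> y \<in> V \<Longrightarrow> z \<in> V \<Longrightarrow> ip z (x \<boxplus> y) = ip z x + ip z y"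
  by (subst (1 2 3) inner_commute) auto

lemma inner_scale_right [simp]:
  "x \<in> V \<Longrightarrow> y \<in> V \<Longrightarrow> ip y (c \<boxdot> x) = cnj c * ip y x"
  by (subst (1 2) inner_commute) auto

lemma inner_ext_right:
  assumes "x \<in> V" "y \<in> V" "\<And>z. z \<in> V \<Longrightarrow> ip z x = ip z y"
  shows "x = y"
proof (rule inner_ext)
  fix z assume "z \<in> V"
  then show "ip x z = ip y z"
    using assms inner_commute[of x z] inner_commute[of y z] by simp
qed (use assms in auto)

lemma inner_same: "x \<in> V \<Longrightarrow> ip x x = of_real ((nrm x)\<^sup>2)"
  using inner_commute[of x x] inner_nonneg[of x]
  by (auto simp: hnorm_def complex_eq_iff)

lemma norm_sq: "x \<in> V \<Longrightarrow> (nrm x)\<^sup>2 = Re (ip x x)"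
  by (simp add: inner_same)

lemma norm_nonneg [simp]: "0 \<le> nrm x" if "x \<in> V"
  using inner_nonneg[OF that] by (simp add: hnorm_def)

lemma norm_zero [simp]: "nrm (hzero H) = 0"
  by (simp add: hnorm_def)

lemma norm_scale: "x \<in> V \<Longrightarrow> nrm (c \<boxdot> x) = cmod c * nrm x"
proof (rule power2_eq_imp_eq)
  assume x: "x \<in> V"
  have "ip (c \<boxdot> x) (c \<boxdot> x) = (c * cnj c) * ip x x" using x by simp
  also have "\<dots> = of_real ((cmod c * nrm x)\<^sup>2)"
    by (simp add: inner_same[OF x] complex_norm_square[symmetric] power_mult_distrib)
  finally show "(nrm (c \<boxdot> x))\<^sup>2 = (cmod c * nrm x)\<^sup>2" using x by (simp add: norm_sq)
qed auto

lemma norm_sq_add: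
  "x \<in> V \<Longrightarrow> y \<in> V \<Longrightarrow> (nrm (x \<boxplus> y))\<^sup>2 = (nrm x)\<^sup>2 + (nrm y)\<^sup>2 + 2 * Re (ip x y)"
  using inner_commute[of x y] by (simp add: norm_sq)

lemma Cauchy_Schwarz:
  assumes x: "x \<in> V" and y: "y \<in> V"
  shows "cmod (ip x y) \<le> nrm x * nrm y"
proof -
  (* a quadratic polynomial in t that is nonnegative; for y of norm 0 it is linear in t *)
  define a where "a = (cmod (ip x y))\<^sup>2"
  have pos: "0 \<le> (nrm x)\<^sup>2 - 2 * t * a + t\<^sup>2 * a * (nrm y)\<^sup>2" for t :: real
  proof -
    have "0 \<le> (nrm (x \<boxplus> (- of_real t * ip x y) \<boxdot> y))\<^sup>2" by simp
    also have "\<dots> = (nrm x)\<^sup>2 - 2 * t * a + t\<^sup>2 * a * (nrm y)\<^sup>2"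
    proof -
      have "ip x y * cnj (ip x y) = of_real a"
        by (simp add: a_def complex_norm_square[symmetric])
      then have "Re (ip x ((- of_real t * ip x y) \<boxdot> y)) = - t * a"
        using x y by (simp add: mult.commute mult.left_commute)
      moreover have "(nrm ((- of_real t * ip x y) \<boxdot> y))\<^sup>2 = t\<^sup>2 * a * (nrm y)\<^sup>2"
        using y by (simp add: norm_scale norm_mult power_mult_distrib a_def)
      ultimately show ?thesis
        using x y by (subst norm_sq_add) (auto simp: algebra_simps)
    qed
    finally show ?thesis .
  qed
  have "a \<le> (nrm x)\<^sup>2 * (nrm y)\<^sup>2"
  proof (cases "nrm y = 0")
    case True
    have "a = 0"
    proof (rule ccontr)
      assume "a \<noteq> 0"
      then show False
        using pos[of "((nrm x)\<^sup>2 + 1) / (2 * a)"] True by (simp add: field_simps)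
    qed
    then show ?thesis by simp
  next
    case False
    then show ?thesis
    proof -
      have "0 \<le> ((nrm x)\<^sup>2 - a / (nrm y)\<^sup>2) * (nrm y)\<^sup>2"
        using pos[of "1 / (nrm y)\<^sup>2"] False by (intro mult_nonneg_nonneg) (simp_all add: power2_eq_square)
      then show ?thesis using False by (simp add: left_diff_distrib)
    qed
  qed
  then show ?thesis
    using x y by - (rule power2_le_imp_le, auto simp: a_def power_mult_distrib)
qed

lemma norm_triangle:
  assumes "x \<in> V" "y \<in> V"
  shows "nrm (x \<boxplus> y) \<le> nrm x + nrm y"
proof (rule power2_le_imp_le)
  have "Re (ip x y) \<le> nrm x * nrm y"
    using Cauchy_Schwarz[OF assms] complex_Re_le_cmod[of "ip x y"] by linarith
  then show "(nrm (x \<boxplus> y))\<^sup>2 \<le> (nrm x + nrm y)\<^sup>2"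
    using assms by (simp add: norm_sq_add power2_sum)
qed (use assms in auto)

lemma norm_eq_zeroD:
  assumes "x \<in> V" "nrm x = 0"
  shows "x = hzero H"
  by (rule inner_ext) (use Cauchy_Schwarz[of x] assms in auto)

lemma dist_alt: "hdist H x y = nrm (x \<boxminus> y)"
  by (simp add: hdist_def)

lemma dist_nonneg [simp]: "x \<in> V \<Longrightarrow> y \<in> V \<Longrightarrow> 0 \<le> hdist H x y"
  by (simp add: dist_alt)

lemma dist_triangle:
  assumes "x \<in> V" "y \<in> V" "z \<in> V"
  shows "hdist H x z \<le> hdist H x y + hdist H y z"
proof -
  have "x \<boxminus> z = (x \<boxminus> y) \<boxplus> (y \<boxminus> z)"
    by (rule inner_ext) (use assms in auto)
  then show ?thesis
    using norm_triangle[of "x \<boxminus> y" "y \<boxminus> z"] assms by (simp add: dist_alt)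
qed

lemma dist_commute: 
  assumes "x \<in> V" "y \<in> V"
  shows "hdist H x y = hdist H y x"
proof -
  have "x \<boxminus> y = (-1) \<boxdot> (y \<boxminus> x)"
    by (rule inner_ext) (use assms in auto)
  then show ?thesis
    using assms by (simp add: dist_alt norm_scale)
qed

lemma dist_eq_zeroD:
  assumes "x \<in> V" "y \<in> V" "hdist H x y = 0"
  shows "x = y"
proof (rule inner_ext)
  fix z assume "z \<in> V"
  have "x \<boxminus> y = hzero H"
    using assms by (intro norm_eq_zeroD) (auto simp: dist_alt)
  then have "ip (x \<boxminus> y) z = 0" using \<open>z \<in> V\<close> by simp
  then show "ip x z = ip y z" using assms \<open>z \<in> V\<close> by simp
qed (use assms in auto)

lemma inner_dist_bound:
  assumes "x \<in> V" "y \<in> V" "z \<in> V"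
  shows "cmod (ip x z - ip y z) \<le> hdist H x y * nrm z"
  using Cauchy_Schwarz[of "x \<boxminus> y" z] assms by (simp add: dist_alt)

lemma inner_tendsto:
  assumes "x \<in> V" "z \<in> V" "\<And>n. s n \<in> V" "(\<lambda>n. hdist H (s n) x) \<longlonglongrightarrow> 0"
  shows "(\<lambda>n. ip (s n) z) \<longlonglongrightarrow> ip x z"
proof (rule LIM_zero_cancel, rule Lim_null_comparison)
  show "\<forall>\<^sub>F n in sequentially. norm (ip (s n) z - ip x z) \<le> hdist H (s n) x * nrm z"
    using inner_dist_bound assms(1-3) by simp
  show "(\<lambda>n. hdist H (s n) x * nrm z) \<longlonglongrightarrow> 0"
    using tendsto_mult_right[OF assms(4), of "nrm z"] by simp
qed

lemma norm_dist_bound: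
  assumes "x \<in> V" "y \<in> V"
  shows "\<bar>nrm x - nrm y\<bar> \<le> hdist H x y"
proof -
  have "hdist H u (hzero H) = nrm u" if "u \<in> V" for u
  proof -
    have "u \<boxminus> hzero H = u" by (rule inner_ext) (use that in auto)
    then show ?thesis by (simp add: dist_alt)
  qed
  then show ?thesis
    using dist_triangle[OF assms zero_closed] dist_triangle[OF assms(2,1) zero_closed]
      dist_commute[OF assms] assms by auto
qed

lemma norm_tendsto:
  assumes "x \<in> V" "\<And>n. s n \<in> V" "(\<lambda>n. hdist H (s n) x) \<longlonglongrightarrow> 0"
  shows "(\<lambda>n. nrm (s n)) \<longlonglongrightarrow> nrm x"
  by (rule LIM_zero_cancel, rule Lim_null_comparison[OF _ assms(3)])
     (use norm_dist_bound assms in auto)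

section \<open>The Riesz representation theorem and orthogonal projections\<close>

lemma linear_coeff_zero:
  fixes a b :: real
  assumes "\<And>t. 0 \<le> t\<^sup>2 * a + 2 * t * b"
  shows "b = 0"
proof (rule ccontr)
  assume b: "b \<noteq> 0"
  define t where "t = - b / (\<bar>a\<bar> + 1)"
  define d where "d = \<bar>a\<bar> + 1"
  have d: "d > 0" "a < 2 * d" by (auto simp: d_def)
  have "t\<^sup>2 * a + 2 * t * b = (b\<^sup>2 / d) * (a / d - 2)"
    using d(1) unfolding t_def d_def[symmetric] by (simp add: power2_eq_square field_simps)
  also have "\<dots> < 0"
    using b d by (intro mult_pos_neg) (auto simp: field_simps)
  finally show False using assms[of t] by simp
qed

text \<open>
  The functional is represented by the vector at which the strictly convex function
  \<open>k \<mapsto> \<parallel>k\<parallel>\<^sup>2 - 2 Re (F k)\<close> is minimal. The parallelogram law makes every minimising sequence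
  Cauchy, and the vanishing of the first variation at the minimum is the representation formula.
\<close>

theorem Riesz_representation:
  assumes add: "\<And>x y. x \<in> V \<Longrightarrow> y \<in> V \<Longrightarrow> F (x \<boxplus> y) = F x + F y"
    and scale: "\<And>c x. x \<in> V \<Longrightarrow> F (c \<boxdot> x) = c * F x"
    and bound: "\<And>x. x \<in> V \<Longrightarrow> cmod (F x) \<le> C * nrm x"
  shows "\<exists>p\<in>V. \<forall>x\<in>V. F x = ip x p"
proof -
  define J where "J = (\<lambda>k. (nrm k)\<^sup>2 - 2 * Re (F k))"
  define I where "I = Inf (J ` V)"
  have low: "- C\<^sup>2 \<le> J x" if "x \<in> V" for x
  proof -
    have "Re (F x) \<le> C * nrm x"
      using bound[OF that] complex_Re_le_cmod[of "F x"] by linarith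
    moreover have "0 \<le> (nrm x - C)\<^sup>2" by simp
    ultimately show ?thesis by (simp add: J_def power2_diff algebra_simps)
  qed
  have bdd: "bdd_below (J ` V)" using low by (intro bdd_belowI2)
  have I_le: "I \<le> J x" if "x \<in> V" for x
    unfolding I_def using bdd that by (intro cInf_lower) auto
  have "\<exists>x\<in>V. J x < I + 1 / (real n + 1)" for n
  proof -
    have "Inf (J ` V) < I + 1 / (real n + 1)" by (simp add: I_def)
    then show ?thesis
      using cInf_less_iff[OF _ bdd] zero_closed by blast
  qed
  then obtain s where s: "\<And>n. s n \<in> V" and sJ: "\<And>n. J (s n) < I + 1 / (real n + 1)"
    by metis
  have par: "(hdist H a b)\<^sup>2 \<le> 2 * (J a - I) + 2 * (J b - I)" if "a \<in> V" "b \<in> V" for a b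
  proof -
    have "I \<le> J ((1/2) \<boxdot> (a \<boxplus> b))" using that by (intro I_le) auto
    moreover have "(hdist H a b)\<^sup>2 = 2 * J a + 2 * J b - 4 * J ((1/2) \<boxdot> (a \<boxplus> b))"
      using that inner_commute[of a b]
      by (simp add: J_def dist_alt norm_sq add scale algebra_simps)
    ultimately show ?thesis by simp
  qed
  have "\<exists>p\<in>V. (\<lambda>n. hdist H (s n) p) \<longlonglongrightarrow> 0"
  proof (rule complete[OF s], intro allI impI)
    fix e :: real assume e: "e > 0"
    obtain n0 where n0: "4 / e\<^sup>2 < real n0" using reals_Archimedean2 by blast
    show "\<exists>n0. \<forall>m\<ge>n0. \<forall>n\<ge>n0. hdist H (s m) (s n) < e"
    proof (intro exI allI impI)
      fix m n assume mn: "n0 \<le> m" "n0 \<le> n"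
      have "0 < 4 / e\<^sup>2" using e by simp
      then have n0': "n0 > 0" using n0 by (cases n0) auto
      have "1 / (real m + 1) \<le> 1 / real n0" "1 / (real n + 1) \<le> 1 / real n0"
        using mn n0' by (auto simp: frac_le)
      then have "(hdist H (s m) (s n))\<^sup>2 \<le> 4 * (1 / real n0)"
        using par[OF s s, of m n] sJ[of m] sJ[of n] by argo
      also have "\<dots> < e\<^sup>2" using n0 n0' e by (simp add: field_simps)
      finally show "hdist H (s m) (s n) < e"
        using e by (simp add: power2_less_imp_less)
    qed
  qed
  then obtain p where p: "p \<in> V" and lim: "(\<lambda>n. hdist H (s n) p) \<longlonglongrightarrow> 0" by blast
  have F_diff: "cmod (F (s n) - F p) \<le> C * hdist H (s n) p" for n
    using bound[of "s n \<boxminus> p"] s[of n] p by (simp add: add scale dist_alt)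
  have "(\<lambda>n. F (s n)) \<longlonglongrightarrow> F p"
  proof (rule LIM_zero_cancel, rule Lim_null_comparison)
    show "(\<lambda>n. C * hdist H (s n) p) \<longlonglongrightarrow> 0"
      using tendsto_mult_left[OF lim, of C] by simp
  qed (use F_diff in simp)
  then have "(\<lambda>n. J (s n)) \<longlonglongrightarrow> J p"
    unfolding J_def using norm_tendsto[OF p s lim] by (intro tendsto_intros)
  moreover have "(\<lambda>n. I + 1 / (real n + 1)) \<longlonglongrightarrow> I + 0"
    using LIMSEQ_inverse_real_of_nat
    by (intro tendsto_intros) (simp add: inverse_eq_divide add.commute)
  ultimately have JpI: "J p \<le> I"
    using sJ by (intro LIMSEQ_le[where X = "\<lambda>n. J (s n)" and Y = "\<lambda>n. I + 1 / (real n + 1)"])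
      (auto simp: less_imp_le)
  have Re_eq: "Re (F x) = Re (ip x p)" if x: "x \<in> V" for x
  proof -
    have "0 \<le> t\<^sup>2 * (nrm x)\<^sup>2 + 2 * t * (Re (ip x p) - Re (F x))" for t
    proof -
      have "J p \<le> J (p \<boxplus> (of_real t) \<boxdot> x)"
        using JpI I_le[of "p \<boxplus> (of_real t) \<boxdot> x"] p x by simp
      then show ?thesis
        using p x inner_commute[of p x]
        by (simp add: J_def norm_sq_add norm_scale add scale power_mult_distrib algebra_simps)
    qed
    then have "Re (ip x p) - Re (F x) = 0" by (rule linear_coeff_zero)
    then show ?thesis by simp
  qed
  have "F x = ip x p" if x: "x \<in> V" for x
    using Re_eq[OF x] Re_eq[of "\<i> \<boxdot> x"] x p by (simp add: scale complex_eq_iff)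
  then show ?thesis using p by blast
qed

text \<open>A closed subspace is a Hilbert space, so the projection of \<open>x\<close> is the vector representing
  the functional \<open>k \<mapsto> \<langle>k, x\<rangle>\<close> on it.\<close>

lemma closed_subspace_limit:
  assumes K: "closed_subspace H K" and s: "\<And>n. s n \<in> K"
    and x: "x \<in> V" "(\<lambda>n. hdist H (s n) x) \<longlonglongrightarrow> 0"
  shows "x \<in> K"
proof -
  have "\<forall>s. \<forall>\<xi>\<in>V. (\<forall>n. s n \<in> K) \<and> (\<lambda>n. hdist H (s n) \<xi>) \<longlonglongrightarrow> 0 \<longrightarrow> \<xi> \<in> K"
    using K by (simp add: closed_subspace_def)
  from this[rule_format, of x s] show ?thesis using s x by simp
qed

lemma hilbert_subspace:
  assumes K: "closed_subspace H K"
  shows "hilbert_space (H\<lparr>hcarrier := K\<rparr>)"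
proof -
  have sub: "\<And>x. x \<in> K \<Longrightarrow> x \<in> V" using K by (auto simp: closed_subspace_def)
  have dist: "hdist (H\<lparr>hcarrier := K\<rparr>) = hdist H"
    by (intro ext) (simp add: hdist_def hnorm_def)
  show ?thesis
  proof
    fix x y assume x: "x \<in> hcarrier (H\<lparr>hcarrier := K\<rparr>)" and y: "y \<in> hcarrier (H\<lparr>hcarrier := K\<rparr>)"
      and eq: "\<And>z. z \<in> hcarrier (H\<lparr>hcarrier := K\<rparr>) \<Longrightarrow>
        hinner (H\<lparr>hcarrier := K\<rparr>) x z = hinner (H\<lparr>hcarrier := K\<rparr>) y z"
    have xy: "x \<boxminus> y \<in> K" using K x y by (auto simp: closed_subspace_def)
    show "x = y"
      using eq[of "x \<boxminus> y"] xy sub[of x] sub[of y] x y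
      by (intro dist_eq_zeroD) (auto simp: dist_alt hnorm_def complex_eq_iff)
  next
    fix s :: "nat \<Rightarrow> 'v"
    assume s: "\<And>n. s n \<in> hcarrier (H\<lparr>hcarrier := K\<rparr>)"
      and c: "\<forall>e>0. \<exists>n0. \<forall>m\<ge>n0. \<forall>n\<ge>n0. hdist (H\<lparr>hcarrier := K\<rparr>) (s m) (s n) < e"
    have "\<exists>x\<in>V. (\<lambda>n. hdist H (s n) x) \<longlonglongrightarrow> 0"
      by (rule complete) (use s sub c in \<open>simp_all add: dist\<close>)
    then obtain x where x: "x \<in> V" "(\<lambda>n. hdist H (s n) x) \<longlonglongrightarrow> 0" by blast
    have "x \<in> K"
      by (rule closed_subspace_limit[OF K _ x]) (use s in simp)
    then show "\<exists>x\<in>hcarrier (H\<lparr>hcarrier := K\<rparr>). (\<lambda>n. hdist (H\<lparr>hcarrier := K\<rparr>) (s n) x) \<longlonglongrightarrow> 0"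
      using x(2) by (intro bexI[of _ x]) (simp_all add: dist)
  next
    fix x y assume "x \<in> hcarrier (H\<lparr>hcarrier := K\<rparr>)" "y \<in> hcarrier (H\<lparr>hcarrier := K\<rparr>)"
    then show "hinner (H\<lparr>hcarrier := K\<rparr>) x y = cnj (hinner (H\<lparr>hcarrier := K\<rparr>) y x)"
      using inner_commute[of x y] sub by simp
  qed (use K sub inner_nonneg in \<open>auto simp: closed_subspace_def\<close>)
qed

lemma projection_exists:
  assumes K: "closed_subspace H K" and x: "x \<in> V"
  shows "\<exists>p\<in>K. \<forall>k\<in>K. ip k x = ip k p"
proof -
  interpret K: hilbert_space "H\<lparr>hcarrier := K\<rparr>" by (rule hilbert_subspace[OF K])
  have sub: "\<And>k. k \<in> K \<Longrightarrow> k \<in> V" using K by (auto simp: closed_subspace_def)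
  have nrm: "hnorm (H\<lparr>hcarrier := K\<rparr>) = nrm"
    by (intro ext) (simp add: hnorm_def)
  have "\<exists>p\<in>hcarrier (H\<lparr>hcarrier := K\<rparr>). \<forall>k\<in>hcarrier (H\<lparr>hcarrier := K\<rparr>).
      ip k x = hinner (H\<lparr>hcarrier := K\<rparr>) k p"
  proof (rule K.Riesz_representation[where C = "nrm x"])
    fix k assume "k \<in> hcarrier (H\<lparr>hcarrier := K\<rparr>)"
    then show "cmod (ip k x) \<le> nrm x * hnorm (H\<lparr>hcarrier := K\<rparr>) k"
      using Cauchy_Schwarz[of k x] sub x by (simp add: nrm mult.commute)
  qed (use sub x in auto)
  then show ?thesis by simp
qed

section \<open>The algebra of bounded operators\<close>

abbreviation "B \<equiv> bounded_ops H"
abbreviation "A \<equiv> op_algebra H"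

lemma op_closed [simp]: "T \<in> B \<Longrightarrow> x \<in> V \<Longrightarrow> T x \<in> V"
  unfolding bounded_ops_def by (simp add: PiE_iff)

lemma op_add [simp]: "T \<in> B \<Longrightarrow> x \<in> V \<Longrightarrow> y \<in> V \<Longrightarrow> T (x \<boxplus> y) = T x \<boxplus> T y"
  unfolding bounded_ops_def by (simp add: PiE_iff)

lemma op_scale [simp]: "T \<in> B \<Longrightarrow> x \<in> V \<Longrightarrow> T (c \<boxdot> x) = c \<boxdot> T x"
  unfolding bounded_ops_def by (simp add: PiE_iff)

lemma op_bound:
  assumes "T \<in> B"
  obtains C where "C \<ge> 0" "\<And>x. x \<in> V \<Longrightarrow> nrm (T x) \<le> C * nrm x"
proof -
  obtain C where C: "\<And>x. x \<in> V \<Longrightarrow> nrm (T x) \<le> C * nrm x"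
    using assms unfolding bounded_ops_def by blast
  show ?thesis
  proof (rule that[of "\<bar>C\<bar>"])
    fix x assume x: "x \<in> V"
    have "C * nrm x \<le> \<bar>C\<bar> * nrm x" using x by (intro mult_right_mono) auto
    then show "nrm (T x) \<le> \<bar>C\<bar> * nrm x" using C[OF x] by linarith
  qed simp
qed

lemma op_extensional: "T \<in> B \<Longrightarrow> T \<in> extensional V"
  unfolding bounded_ops_def PiE_def by simp

text \<open>Linearity of an operator given by a limit or by a representation theorem is known for its
  matrix coefficients first.\<close>

lemma op_weakI:
  assumes cl: "\<And>x. x \<in> V \<Longrightarrow> T x \<in> V"
    and add: "\<And>x y z. x \<in> V \<Longrightarrow> y \<in> V \<Longrightarrow> z \<in> V \<Longrightarrow> ip (T (x \<boxplus> y)) z = ip (T x) z + ip (T y) z"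
    and scale: "\<And>c x z. x \<in> V \<Longrightarrow> z \<in> V \<Longrightarrow> ip (T (c \<boxdot> x)) z = c * ip (T x) z"
    and bound: "\<And>x. x \<in> V \<Longrightarrow> nrm (T x) \<le> C * nrm x"
    and ext: "\<And>x. x \<notin> V \<Longrightarrow> T x = undefined"
  shows "T \<in> B"
proof -
  have "T \<in> V \<rightarrow>\<^sub>E V" using cl ext by (intro PiE_I) auto
  moreover have "T (x \<boxplus> y) = T x \<boxplus> T y" if "x \<in> V" "y \<in> V" for x y
    by (rule inner_ext) (use that cl in \<open>auto simp: add\<close>)
  moreover have "T (c \<boxdot> x) = c \<boxdot> T x" if "x \<in> V" for c x
    by (rule inner_ext) (use that cl in \<open>auto simp: scale\<close>)
  ultimately show ?thesis
    using bound unfolding bounded_ops_def by (intro CollectI conjI ballI allI exI[of _ C]) simp_all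
qed

lemma op_eqI:
  assumes "S \<in> B" "T \<in> B" "\<And>x y. x \<in> V \<Longrightarrow> y \<in> V \<Longrightarrow> ip (S x) y = ip (T x) y"
  shows "S = T"
proof (rule extensionalityI[of _ V])
  fix x assume x: "x \<in> V"
  show "S x = T x" by (rule inner_ext) (use x assms in auto)
qed (use assms op_extensional in auto)

lemma op_tendsto:
  assumes T: "T \<in> B" and x: "x \<in> V" and s: "\<And>n. s n \<in> V" "(\<lambda>n. hdist H (s n) x) \<longlonglongrightarrow> 0"
  shows "(\<lambda>n. hdist H (T (s n)) (T x)) \<longlonglongrightarrow> 0"
proof -
  obtain C where C: "C \<ge> 0" "\<And>x. x \<in> V \<Longrightarrow> nrm (T x) \<le> C * nrm x" using op_bound[OF T] by blast
  have "hdist H (T (s n)) (T x) \<le> C * hdist H (s n) x" for n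
    using C(2)[of "s n \<boxminus> x"] T x s(1)[of n] by (simp add: dist_alt)
  moreover have "(\<lambda>n. C * hdist H (s n) x) \<longlonglongrightarrow> 0"
    using tendsto_mult_left[OF s(2), of C] by simp
  ultimately show ?thesis
    using T x s(1) by - (rule real_tendsto_sandwich[OF _ _ tendsto_const], simp_all)
qed

text \<open>The adjoint is obtained pointwise: \<open>S y\<close> represents the bounded functional \<open>x \<mapsto> \<langle>T x, y\<rangle>\<close>.\<close>

lemma adjoint_exists:
  assumes T: "T \<in> B"
  shows "\<exists>S\<in>B. \<forall>x\<in>V. \<forall>y\<in>V. ip (T x) y = ip x (S y)"
proof -
  obtain C where C: "C \<ge> 0" "\<And>x. x \<in> V \<Longrightarrow> nrm (T x) \<le> C * nrm x" using op_bound[OF T] by blast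
  have "\<exists>p\<in>V. \<forall>x\<in>V. ip (T x) y = ip x p" if y: "y \<in> V" for y
  proof (rule Riesz_representation[of _ "C * nrm y"])
    fix x assume x: "x \<in> V"
    have "cmod (ip (T x) y) \<le> nrm (T x) * nrm y"
      using Cauchy_Schwarz T x y by simp
    also have "\<dots> \<le> (C * nrm x) * nrm y"
      using C x y by (intro mult_right_mono) auto
    finally show "cmod (ip (T x) y) \<le> C * nrm y * nrm x" by (simp add: mult_ac)
  qed (use T y in auto)
  then obtain R where R: "\<And>y. y \<in> V \<Longrightarrow> R y \<in> V"
      and Rip: "\<And>x y. x \<in> V \<Longrightarrow> y \<in> V \<Longrightarrow> ip (T x) y = ip x (R y)"
    by metis
  have Rip': "ip (R y) x = ip y (T x)" if "x \<in> V" "y \<in> V" for x y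
    using Rip[OF that] inner_commute[of "R y" x] inner_commute[of y "T x"] R T that by simp
  have "restrict R V \<in> B"
  proof (rule op_weakI[where C = C])
    fix y assume y: "y \<in> V"
    have "(nrm (R y))\<^sup>2 = Re (ip (T (R y)) y)"
      using y by (simp add: norm_sq Rip R)
    also have "\<dots> \<le> cmod (ip (T (R y)) y)" by (rule complex_Re_le_cmod)
    also have "\<dots> \<le> nrm (T (R y)) * nrm y" using y T R by (intro Cauchy_Schwarz) auto
    also have "\<dots> \<le> C * nrm (R y) * nrm y"
      using y R C by (intro mult_right_mono) auto
    finally have "nrm (R y) * nrm (R y) \<le> (C * nrm y) * nrm (R y)"
      by (simp add: power2_eq_square mult_ac)
    then show "nrm (restrict R V y) \<le> C * nrm y"
      using norm_nonneg[OF R[OF y]] norm_nonneg[OF y] C(1) y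
      by (cases "nrm (R y) = 0") (auto simp: mult_le_cancel_right)
  qed (use T R in \<open>auto simp: Rip'\<close>)
  then show ?thesis using Rip by (intro bexI[of _ "restrict R V"]) auto
qed

lemma adjoint_eqI:
  assumes "T \<in> B" "S \<in> B" "\<And>x y. x \<in> V \<Longrightarrow> y \<in> V \<Longrightarrow> ip (T x) y = ip x (S y)"
  shows "adjoint_op H T = S"
  unfolding adjoint_op_def
proof (rule the_equality)
  fix R assume R: "R \<in> B \<and> (\<forall>\<xi>\<in>V. \<forall>\<eta>\<in>V. ip (T \<xi>) \<eta> = ip \<xi> (R \<eta>))"
  show "R = S"
  proof (rule extensionalityI[of _ V])
    fix y assume y: "y \<in> V"
    show "R y = S y"
      by (rule inner_ext_right) (use R y assms in auto)
  qed (use R assms op_extensional in auto)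
qed (use assms in auto)

lemma adjoint_closed [simp]: "T \<in> B \<Longrightarrow> adjoint_op H T \<in> B"
  and adjoint_inner: "T \<in> B \<Longrightarrow> x \<in> V \<Longrightarrow> y \<in> V \<Longrightarrow> ip x (adjoint_op H T y) = ip (T x) y"
proof -
  assume T: "T \<in> B"
  obtain S where S: "S \<in> B" "\<And>x y. x \<in> V \<Longrightarrow> y \<in> V \<Longrightarrow> ip (T x) y = ip x (S y)"
    using adjoint_exists[OF T] by blast
  have "adjoint_op H T = S" using adjoint_eqI[OF T S] .
  then show "adjoint_op H T \<in> B"
    and "x \<in> V \<Longrightarrow> y \<in> V \<Longrightarrow> ip x (adjoint_op H T y) = ip (T x) y"
    using S by auto
qed

lemma adjoint_inner_left:
  "T \<in> B \<Longrightarrow> x \<in> V \<Longrightarrow> y \<in> V \<Longrightarrow> ip (adjoint_op H T y) x = ip y (T x)"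
  using adjoint_inner[of T x y] inner_commute by (metis adjoint_closed op_closed)

lemma op_algebra_sel [simp]:
  "carrier A = B"
  "S \<otimes>\<^bsub>A\<^esub> T = compose V S T"
  "\<one>\<^bsub>A\<^esub> = (\<lambda>x\<in>V. x)"
  "\<zero>\<^bsub>A\<^esub> = (\<lambda>x\<in>V. hzero H)"
  "S \<oplus>\<^bsub>A\<^esub> T = (\<lambda>x\<in>V. S x \<boxplus> T x)"
  "c \<odot>\<^bsub>A\<^esub> T = (\<lambda>x\<in>V. c \<boxdot> T x)"
  "star A = adjoint_op H"
  by (simp_all add: op_algebra_def)

lemma one_op [simp]: "(\<lambda>x\<in>V. x) \<in> B"
  by (rule op_weakI[where C = 1]) auto

lemma zero_op [simp]: "(\<lambda>x\<in>V. hzero H) \<in> B"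
  by (rule op_weakI[where C = 0]) auto

lemma compose_op [simp]:
  assumes "S \<in> B" "T \<in> B" shows "compose V S T \<in> B"
proof -
  obtain C where C: "C \<ge> 0" "\<And>x. x \<in> V \<Longrightarrow> nrm (S x) \<le> C * nrm x" using op_bound[OF assms(1)] by blast
  obtain D where D: "D \<ge> 0" "\<And>x. x \<in> V \<Longrightarrow> nrm (T x) \<le> D * nrm x" using op_bound[OF assms(2)] by blast
  show ?thesis
  proof (rule op_weakI[where C = "C * D"])
    fix x assume x: "x \<in> V"
    have "nrm (S (T x)) \<le> C * nrm (T x)" using assms x by (intro C) auto
    also have "\<dots> \<le> C * (D * nrm x)" using x C D by (intro mult_left_mono) auto
    finally show "nrm (compose V S T x) \<le> C * D * nrm x"
      using x by (simp add: compose_def mult_ac)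
  qed (use assms in \<open>auto simp: compose_def\<close>)
qed

lemma add_op [simp]:
  assumes "S \<in> B" "T \<in> B" shows "(\<lambda>x\<in>V. S x \<boxplus> T x) \<in> B"
proof -
  obtain C where C: "C \<ge> 0" "\<And>x. x \<in> V \<Longrightarrow> nrm (S x) \<le> C * nrm x" using op_bound[OF assms(1)] by blast
  obtain D where D: "D \<ge> 0" "\<And>x. x \<in> V \<Longrightarrow> nrm (T x) \<le> D * nrm x" using op_bound[OF assms(2)] by blast
  show ?thesis
  proof (rule op_weakI[where C = "C + D"])
    fix x assume x: "x \<in> V"
    have "nrm (S x \<boxplus> T x) \<le> nrm (S x) + nrm (T x)" using assms x by (intro norm_triangle) auto
    then show "nrm ((\<lambda>x\<in>V. S x \<boxplus> T x) x) \<le> (C + D) * nrm x"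
      using x C(2)[OF x] D(2)[OF x] by (simp add: algebra_simps)
  qed (use assms in \<open>auto simp: algebra_simps\<close>)
qed

lemma scale_op [simp]:
  assumes "T \<in> B" shows "(\<lambda>x\<in>V. c \<boxdot> T x) \<in> B"
proof -
  obtain D where D: "D \<ge> 0" "\<And>x. x \<in> V \<Longrightarrow> nrm (T x) \<le> D * nrm x" using op_bound[OF assms] by blast
  show ?thesis
  proof (rule op_weakI[where C = "cmod c * D"])
    fix x assume x: "x \<in> V"
    have "cmod c * nrm (T x) \<le> cmod c * (D * nrm x)" using D x by (intro mult_left_mono) auto
    then show "nrm ((\<lambda>x\<in>V. c \<boxdot> T x) x) \<le> cmod c * D * nrm x"
      using x assms by (simp add: norm_scale mult_ac)
  qed (use assms in \<open>auto simp: algebra_simps\<close>)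
qed

lemma op_algebra_ring: "ring A"
proof (rule ringI)
  show "abelian_group A"
  proof (rule abelian_groupI)
    fix R S T assume "R \<in> carrier A" "S \<in> carrier A" "T \<in> carrier A"
    then have *: "R \<in> B" "S \<in> B" "T \<in> B" by simp_all
    show "R \<oplus>\<^bsub>A\<^esub> S \<oplus>\<^bsub>A\<^esub> T = R \<oplus>\<^bsub>A\<^esub> (S \<oplus>\<^bsub>A\<^esub> T)"
      unfolding op_algebra_sel
      by (rule op_eqI[OF add_op[OF add_op] add_op[OF _ add_op]]) (use * in auto)
    show "R \<oplus>\<^bsub>A\<^esub> S = S \<oplus>\<^bsub>A\<^esub> R"
      unfolding op_algebra_sel by (rule op_eqI[OF add_op add_op]) (use * in auto)
    show "\<zero>\<^bsub>A\<^esub> \<oplus>\<^bsub>A\<^esub> T = T"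
      unfolding op_algebra_sel by (rule op_eqI[OF add_op[OF zero_op]]) (use * in auto)
    show "\<exists>S\<in>carrier A. S \<oplus>\<^bsub>A\<^esub> T = \<zero>\<^bsub>A\<^esub>"
    proof (rule bexI[of _ "\<lambda>x\<in>V. (-1) \<boxdot> T x"])
      show "(\<lambda>x\<in>V. (-1) \<boxdot> T x) \<oplus>\<^bsub>A\<^esub> T = \<zero>\<^bsub>A\<^esub>"
        unfolding op_algebra_sel
        by (rule op_eqI[OF add_op[OF scale_op] zero_op]) (use * in auto)
    qed (use * in simp)
  qed simp_all
  show "Group.monoid A"
  proof (rule monoidI)
    fix R S T assume "R \<in> carrier A" "S \<in> carrier A" "T \<in> carrier A"
    then show "R \<otimes>\<^bsub>A\<^esub> S \<otimes>\<^bsub>A\<^esub> T = R \<otimes>\<^bsub>A\<^esub> (S \<otimes>\<^bsub>A\<^esub> T)"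
      by (intro op_eqI) (simp_all add: compose_eq)
  qed (auto intro!: op_eqI simp: compose_eq)
next
  fix R S T assume "R \<in> carrier A" "S \<in> carrier A" "T \<in> carrier A"
  then have *: "R \<in> B" "S \<in> B" "T \<in> B" by simp_all
  show "(R \<oplus>\<^bsub>A\<^esub> S) \<otimes>\<^bsub>A\<^esub> T = R \<otimes>\<^bsub>A\<^esub> T \<oplus>\<^bsub>A\<^esub> S \<otimes>\<^bsub>A\<^esub> T"
    unfolding op_algebra_sel
    by (rule op_eqI[OF compose_op[OF add_op] add_op[OF compose_op compose_op]])
       (use * in \<open>auto simp: compose_eq\<close>)
  show "T \<otimes>\<^bsub>A\<^esub> (R \<oplus>\<^bsub>A\<^esub> S) = T \<otimes>\<^bsub>A\<^esub> R \<oplus>\<^bsub>A\<^esub> T \<otimes>\<^bsub>A\<^esub> S"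
    unfolding op_algebra_sel
    by (rule op_eqI[OF compose_op[OF _ add_op] add_op[OF compose_op compose_op]])
       (use * in \<open>auto simp: compose_eq\<close>)
qed

lemma finsum_op:
  assumes "finite I" "\<And>i. i \<in> I \<Longrightarrow> T i \<in> B"
  shows "finsum A T I \<in> B"
proof -
  interpret A: ring A by (rule op_algebra_ring)
  show ?thesis using A.finsum_closed[of T I] assms by auto
qed

text \<open>Sums of operators are evaluated through their matrix coefficients only; together with
  \<open>op_eqI\<close> this reduces every identity between such sums to one between complex sums.\<close>

lemma finsum_inner:
  assumes "finite I" "\<And>i. i \<in> I \<Longrightarrow> T i \<in> B" "x \<in> V" "y \<in> V"
  shows "ip (finsum A T I x) y = (\<Sum>i\<in>I. ip (T i x) y)"
proof -
  interpret A: ring A by (rule op_algebra_ring)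
  show ?thesis using assms(1,2)
  proof (induction I)
    case (insert i I)
    have "finsum A T (insert i I) = T i \<oplus>\<^bsub>A\<^esub> finsum A T I"
      using insert by (intro A.finsum_insert) auto
    moreover have "finsum A T I \<in> B" using insert by (intro finsum_op) auto
    ultimately show ?case using insert assms(3,4) by auto
  qed (use assms in auto)
qed

end

section \<open>Cuntz families and their endomorphisms\<close>

text \<open>The ranges of the \<open>S\<^sub>i\<close> are orthogonal, so in an expansion \<open>x = \<Sum>\<^sub>i S\<^sub>i y\<^sub>i\<close> the coefficient \<open>y\<^sub>i\<close> can
  only be \<open>S\<^sub>i\<^sup>* x\<close>; the existence of expansions is thus the relation \<open>\<Sum>\<^sub>i S\<^sub>i S\<^sub>i\<^sup>* = 1\<close>.\<close>

lemma (in hilbert_space) cuntz_familyI: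
  assumes S: "\<And>i. i \<in> {1..N} \<Longrightarrow> S i \<in> B"
    and ortho: "\<And>i j x y. i \<in> {1..N} \<Longrightarrow> j \<in> {1..N} \<Longrightarrow> x \<in> V \<Longrightarrow> y \<in> V \<Longrightarrow>
      ip (S i x) (S j y) = (if i = j then ip x y else 0)"
    and span: "\<And>x. x \<in> V \<Longrightarrow> \<exists>y. (\<forall>i. y i \<in> V) \<and> (\<forall>z\<in>V. ip x z = (\<Sum>i\<in>{1..N}. ip (S i (y i)) z))"
  shows "cuntz_family A N S"
proof -
  have RS: "adjoint_op H (S i) (S j x) = (if i = j then x else hzero H)"
    if "i \<in> {1..N}" "j \<in> {1..N}" "x \<in> V" for i j x
    by (rule inner_ext_right) (use that S ortho in \<open>auto simp: adjoint_inner\<close>)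
  have rel: "star A (S i) \<otimes>\<^bsub>A\<^esub> S j = (if i = j then \<one>\<^bsub>A\<^esub> else \<zero>\<^bsub>A\<^esub>)"
    if "i \<in> {1..N}" "j \<in> {1..N}" for i j
    by (rule op_eqI) (use that S RS in \<open>auto simp: compose_eq\<close>)
  have "(\<Oplus>\<^bsub>A\<^esub>i\<in>{1..N}. S i \<otimes>\<^bsub>A\<^esub> star A (S i)) = \<one>\<^bsub>A\<^esub>"
  proof (rule op_eqI)
    fix x z assume x: "x \<in> V" and z: "z \<in> V"
    obtain y where y: "\<And>i. y i \<in> V" and xy: "\<And>z. z \<in> V \<Longrightarrow> ip x z = (\<Sum>i\<in>{1..N}. ip (S i (y i)) z)"
      using span[OF x] by blast
    have "adjoint_op H (S i) x = y i" if i: "i \<in> {1..N}" for i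
    proof (rule inner_ext)
      fix u assume u: "u \<in> V"
      have "ip (adjoint_op H (S i) x) u = ip x (S i u)"
        using i u x S by (simp add: adjoint_inner_left)
      also have "\<dots> = (\<Sum>j\<in>{1..N}. if j = i then ip (y i) u else 0)"
        using i u y S by (subst xy) (auto simp: ortho intro!: sum.cong)
      finally show "ip (adjoint_op H (S i) x) u = ip (y i) u"
        using i by simp
    qed (use i x y S in auto)
    then have "(\<Sum>i\<in>{1..N}. ip ((S i \<otimes>\<^bsub>A\<^esub> star A (S i)) x) z) = ip x z"
      using x z xy S by (auto simp: compose_eq intro!: sum.cong)
    then show "ip ((\<Oplus>\<^bsub>A\<^esub>i\<in>{1..N}. S i \<otimes>\<^bsub>A\<^esub> star A (S i)) x) z = ip (\<one>\<^bsub>A\<^esub> x) z"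
      using S x z by (subst finsum_inner) auto
  qed (use S in \<open>auto intro!: finsum_op\<close>)
  then show ?thesis
    unfolding cuntz_family_def using S rel by simp
qed

locale cuntz = hilbert_space +
  fixes N :: nat and S :: "nat \<Rightarrow> 'a \<Rightarrow> 'a"
  assumes family: "cuntz_family (op_algebra H) N S"
begin

abbreviation "R i \<equiv> adjoint_op H (S i)"
abbreviation "\<alpha> \<equiv> cuntz_endo A N S"

lemma S_op [simp]: "i \<in> {1..N} \<Longrightarrow> S i \<in> B"
  using family by (simp add: cuntz_family_def)

lemma R_inner: "i \<in> {1..N} \<Longrightarrow> x \<in> V \<Longrightarrow> y \<in> V \<Longrightarrow> ip x (R i y) = ip (S i x) y"
  and R_inner_left: "i \<in> {1..N} \<Longrightarrow> x \<in> V \<Longrightarrow> y \<in> V \<Longrightarrow> ip (R i y) x = ip y (S i x)"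
  by (simp_all add: adjoint_inner adjoint_inner_left)

lemma R_S:
  assumes "i \<in> {1..N}" "j \<in> {1..N}" "x \<in> V"
  shows "R i (S j x) = (if i = j then x else hzero H)"
proof -
  have "compose V (R i) (S j) x = (if i = j then \<one>\<^bsub>A\<^esub> else \<zero>\<^bsub>A\<^esub>) x"
    using assms family unfolding cuntz_family_def op_algebra_sel by simp
  then show ?thesis using assms by (cases "i = j") (simp_all add: compose_eq)
qed

lemma sum_R_inner:
  assumes "x \<in> V" "y \<in> V"
  shows "(\<Sum>i\<in>{1..N}. ip (R i x) (R i y)) = ip x y"
proof -
  have "(\<Oplus>\<^bsub>A\<^esub>i\<in>{1..N}. S i \<otimes>\<^bsub>A\<^esub> star A (S i)) = \<one>\<^bsub>A\<^esub>"
    using family by (simp add: cuntz_family_def)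
  then have "ip ((\<Oplus>\<^bsub>A\<^esub>i\<in>{1..N}. S i \<otimes>\<^bsub>A\<^esub> star A (S i)) x) y = ip x y"
    using assms by simp
  then show ?thesis
    using assms by (subst (asm) finsum_inner) (auto simp: compose_eq R_inner)
qed

lemma endo_closed [simp]: "T \<in> B \<Longrightarrow> \<alpha> T \<in> B"
  unfolding cuntz_endo_def by (rule finsum_op) auto

lemma endo_inner:
  assumes "T \<in> B" "x \<in> V" "y \<in> V"
  shows "ip (\<alpha> T x) y = (\<Sum>i\<in>{1..N}. ip (T (R i x)) (R i y))"
  unfolding cuntz_endo_def using assms
  by (subst finsum_inner) (auto simp: compose_eq R_inner)

text \<open>The relations \<open>S\<^sub>j\<^sup>* S\<^sub>i = \<delta>\<^sub>i\<^sub>j\<close> pick out one summand of \<open>\<alpha> T\<close>. With the companion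
  formula \<open>\<alpha> T S\<^sub>i = S\<^sub>i T\<close> this shows that the fixed points of \<open>\<alpha>\<close> commute with every \<open>S\<^sub>i\<close> and \<open>S\<^sub>i\<^sup>*\<close>.\<close>

lemma R_endo:
  assumes "i \<in> {1..N}" "T \<in> B" "x \<in> V"
  shows "R i (\<alpha> T x) = T (R i x)"
proof (rule inner_ext)
  fix y assume y: "y \<in> V"
  have "ip (R i (\<alpha> T x)) y = (\<Sum>j\<in>{1..N}. ip (T (R j x)) (R j (S i y)))"
    using assms y by (simp add: R_inner_left endo_inner)
  also have "\<dots> = (\<Sum>j\<in>{1..N}. if j = i then ip (T (R i x)) y else 0)"
    using assms y by (intro sum.cong) (auto simp: R_S)
  finally show "ip (R i (\<alpha> T x)) y = ip (T (R i x)) y" using assms(1) by simp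
qed (use assms in auto)

lemma endo_S:
  assumes "i \<in> {1..N}" "T \<in> B" "x \<in> V"
  shows "\<alpha> T (S i x) = S i (T x)"
proof (rule inner_ext)
  fix y assume y: "y \<in> V"
  have "ip (\<alpha> T (S i x)) y = (\<Sum>j\<in>{1..N}. ip (T (R j (S i x))) (R j y))"
    using assms y by (simp add: endo_inner)
  also have "\<dots> = (\<Sum>j\<in>{1..N}. if j = i then ip (T x) (R i y) else 0)"
  proof (intro sum.cong refl)
    have "T (hzero H) = hzero H"
      using op_scale[OF assms(2) zero_closed, of 0] assms(2)
      by (metis inner_ext inner_scale_left inner_zero_left mult_zero_left op_closed scale_closed zero_closed)
    then show "ip (T (R j (S i x))) (R j y) = (if j = i then ip (T x) (R i y) else 0)"
      if "j \<in> {1..N}" for j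
      using assms y that by (simp add: R_S)
  qed
  finally show "ip (\<alpha> T (S i x)) y = ip (S i (T x)) y"
    using assms y by (simp add: R_inner)
qed (use assms in auto)

lemma endo_star_hom: "\<alpha> \<in> star_hom A A"
  unfolding star_hom_def
proof (intro CollectI conjI ballI allI)
  show "\<alpha> \<in> ring_hom A A"
  proof (rule ring_hom_memI)
    fix T T' assume "T \<in> carrier A" "T' \<in> carrier A"
    then have *: "T \<in> B" "T' \<in> B" by simp_all
    show "\<alpha> (T \<otimes>\<^bsub>A\<^esub> T') = \<alpha> T \<otimes>\<^bsub>A\<^esub> \<alpha> T'"
      by (rule op_eqI) (use * in \<open>auto simp: endo_inner R_endo compose_eq\<close>)
    show "\<alpha> (T \<oplus>\<^bsub>A\<^esub> T') = \<alpha> T \<oplus>\<^bsub>A\<^esub> \<alpha> T'"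
      unfolding op_algebra_sel
      by (rule op_eqI[OF endo_closed[OF add_op] add_op]) 
         (use * in \<open>auto simp: endo_inner[OF add_op] endo_inner sum.distrib\<close>)
  next
    show "\<alpha> \<one>\<^bsub>A\<^esub> = \<one>\<^bsub>A\<^esub>"
      by (rule op_eqI) (auto simp: endo_inner sum_R_inner simp del: One_nat_def)
  qed auto
next
  fix T c assume T: "T \<in> carrier A"
  then show "\<alpha> (c \<odot>\<^bsub>A\<^esub> T) = c \<odot>\<^bsub>A\<^esub> \<alpha> T"
    unfolding op_algebra_sel
    by (intro op_eqI[OF endo_closed[OF scale_op] scale_op])
       (auto simp: endo_inner[OF scale_op] endo_inner sum_distrib_left)
  show "\<alpha> (star A T) = star A (\<alpha> T)"
    unfolding op_algebra_sel
  proof (rule adjoint_eqI[symmetric])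
    fix x y assume x: "x \<in> V" and y: "y \<in> V"
    have "ip (\<alpha> T x) y = (\<Sum>i\<in>{1..N}. ip (T (R i x)) (R i y))"
      using T x y by (simp add: endo_inner)
    also have "\<dots> = (\<Sum>i\<in>{1..N}. cnj (ip (adjoint_op H T (R i y)) (R i x)))"
    proof (intro sum.cong refl)
      fix i assume i: "i \<in> {1..N}"
      have "ip (adjoint_op H T (R i y)) (R i x) = ip (R i y) (T (R i x))"
        by (rule adjoint_inner_left) (use T x y i in auto)
      then show "ip (T (R i x)) (R i y) = cnj (ip (adjoint_op H T (R i y)) (R i x))"
        using inner_commute[of "T (R i x)" "R i y"] T x y i by simp
    qed
    also have "\<dots> = cnj (ip (\<alpha> (adjoint_op H T) y) x)"
      using T x y by (simp add: endo_inner)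
    also have "\<dots> = ip x (\<alpha> (adjoint_op H T) y)"
      using T x y by (intro inner_commute[symmetric]) simp_all
    finally show "ip (\<alpha> T x) y = ip x (\<alpha> (adjoint_op H T) y)" .
  qed (use T in auto)
qed

lemma endo_fixedI:
  assumes T: "T \<in> B" and comm: "\<And>i x. i \<in> {1..N} \<Longrightarrow> x \<in> V \<Longrightarrow> T (R i x) = R i (T x)"
  shows "\<alpha> T = T"
  by (rule op_eqI) (use T in \<open>auto simp: endo_inner comm sum_R_inner simp del: One_nat_def\<close>)

lemma scalars_fixed: "\<alpha> (c \<odot>\<^bsub>A\<^esub> \<one>\<^bsub>A\<^esub>) = c \<odot>\<^bsub>A\<^esub> \<one>\<^bsub>A\<^esub>"
proof (rule endo_fixedI)
  show "c \<odot>\<^bsub>A\<^esub> \<one>\<^bsub>A\<^esub> \<in> B" using scale_op[OF one_op] by simp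
qed simp

text \<open>
  The projection onto a subspace that is invariant under every \<open>S\<^sub>i\<close> and every
  \<open>S\<^sub>i\<^sup>*\<close> commutes with these operators, hence is fixed by the endomorphism. If all fixed
  operators are scalars, the projection is \<open>0\<close> or \<open>1\<close>.
\<close>

lemma ergodic_imp_irreducible:
  assumes erg: "ergodic_endo A \<alpha>" and K: "closed_subspace H K"
    and SK: "\<And>i x. i \<in> {1..N} \<Longrightarrow> x \<in> K \<Longrightarrow> S i x \<in> K"
    and RK: "\<And>i x. i \<in> {1..N} \<Longrightarrow> x \<in> K \<Longrightarrow> R i x \<in> K"
  shows "K = {hzero H} \<or> K = V"
proof -
  interpret K: hilbert_space "H\<lparr>hcarrier := K\<rparr>" by (rule hilbert_subspace[OF K])
  have sub: "x \<in> V" if "x \<in> K" for x using K that by (auto simp: closed_subspace_def)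
  have uniq: "p = q" if "p \<in> K" "q \<in> K" "\<And>k. k \<in> K \<Longrightarrow> ip k p = ip k q" for p q
    using K.inner_ext_right[of p q] that by simp
  obtain P' where P'K: "\<And>x. x \<in> V \<Longrightarrow> P' x \<in> K" 
    and P': "\<And>x k. x \<in> V \<Longrightarrow> k \<in> K \<Longrightarrow> ip k (P' x) = ip k x"
    using projection_exists[OF K] by metis
  have P'_left: "ip (P' x) k = ip x k" if "x \<in> V" "k \<in> K" for x k
    using P'[OF that] that inner_commute[of "P' x" k] inner_commute[of x k] sub P'K by simp
  define P where "P = restrict P' V"
  have PB: "P \<in> B"
  proof (rule op_weakI[where C = 1])
    fix x y z assume x: "x \<in> V" and y: "y \<in> V" and z: "z \<in> V"
    have "ip (P' u) z = ip u (P' z)" if "u \<in> V" for u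
      using P'[OF z P'K[OF that]] P'_left[OF that P'K[OF z]] by simp
    then show "ip (P (x \<boxplus> y)) z = ip (P x) z + ip (P y) z"
      and "ip (P (c \<boxdot> x)) z = c * ip (P x) z" for c
      using x y z sub P'K by (simp_all add: P_def)
  next
    fix x assume x: "x \<in> V"
    have "nrm (P' x) * nrm (P' x) = Re (ip (P' x) x)"
      using P'[OF x P'K[OF x]] norm_sq[of "P' x"] sub P'K x by (simp add: power2_eq_square)
    also have "\<dots> \<le> nrm (P' x) * nrm x"
      using Cauchy_Schwarz[of "P' x" x] complex_Re_le_cmod[of "ip (P' x) x"] sub P'K x by force
    finally have "nrm (P' x) \<le> nrm x"
      using norm_nonneg[OF sub[OF P'K[OF x]]] norm_nonneg[OF x]
      by (cases "nrm (P' x) = 0") (auto simp: mult_le_cancel_left)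
    then show "nrm (P x) \<le> 1 * nrm x" using x by (simp add: P_def)
  qed (use sub P'K in \<open>auto simp: P_def\<close>)
  have "\<alpha> P = P"
  proof (rule endo_fixedI[OF PB])
    fix i x assume i: "i \<in> {1..N}" and x: "x \<in> V"
    have "P' (R i x) = R i (P' x)"
    proof (rule uniq)
      fix k assume k: "k \<in> K"
      have "ip k (P' (R i x)) = ip (S i k) x"
        using i x k sub by (simp add: P' R_inner)
      also have "\<dots> = ip k (R i (P' x))"
        using i x k sub P'K P'[OF x SK[OF i k]] by (simp add: R_inner)
      finally show "ip k (P' (R i x)) = ip k (R i (P' x))" .
    qed (use i x P'K RK in auto)
    then show "P (R i x) = R i (P x)" using i x by (simp add: P_def)
  qed
  then have "P \<in> range (\<lambda>c. c \<odot>\<^bsub>A\<^esub> \<one>\<^bsub>A\<^esub>)"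
    using erg PB unfolding ergodic_endo_def op_algebra_sel by blast
  then obtain c where "P = c \<odot>\<^bsub>A\<^esub> \<one>\<^bsub>A\<^esub>" by blast
  then have Pc: "P' x = c \<boxdot> x" if "x \<in> V" for x
  proof -
    have "P x = (c \<odot>\<^bsub>A\<^esub> \<one>\<^bsub>A\<^esub>) x" by (simp only: \<open>P = c \<odot>\<^bsub>A\<^esub> \<one>\<^bsub>A\<^esub>\<close>)
    then show ?thesis using that by (simp add: P_def)
  qed
  show ?thesis
  proof (cases "K \<subseteq> {hzero H}")
    case True
    then show ?thesis using K by (auto simp: closed_subspace_def)
  next
    case False
    then obtain k where k: "k \<in> K" "k \<noteq> hzero H" by blast
    have "P' k = k" by (rule uniq) (use k sub P' P'K in auto)
    then have "c * ip k k = ip k k"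
      using Pc[of k] k sub inner_scale_left[of k k c] by simp
    moreover have "ip k k \<noteq> 0"
      using norm_eq_zeroD[of k] k sub by (auto simp: inner_same)
    ultimately have "c = 1" by simp
    have "x \<in> K" if "x \<in> V" for x
    proof -
      have "P' x = x" by (rule inner_ext) (use that Pc sub P'K \<open>c = 1\<close> in auto)
      then show ?thesis using P'K[OF that] by simp
    qed
    then show ?thesis using sub by blast
  qed
qed

end

section \<open>The free *-algebra\<close>

text \<open>The adjoint of a monomial is the monomial of the flipped word.\<close>

definition flip_word :: "(nat \<times> bool) list \<Rightarrow> (nat \<times> bool) list" where
  "flip_word w = rev (map (\<lambda>(i, e). (i, \<not> e)) w)"

definition supp :: "('w \<Rightarrow> complex) \<Rightarrow> 'w set" where
  "supp a = {w. a w \<noteq> 0}"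

definition monomial :: "'w \<Rightarrow> 'w \<Rightarrow> complex" where
  "monomial w = (\<lambda>v. if v = w then 1 else 0)"

lemma flip_word_simps [simp]:
  "flip_word [] = []"
  "flip_word (x # w) = flip_word w @ [(fst x, \<not> snd x)]"
  "flip_word (u @ v) = flip_word v @ flip_word u"
  by (auto simp: flip_word_def split: prod.splits)

lemma flip_flip [simp]: "flip_word (flip_word w) = w"
  by (induction w) auto

lemma flip_word_eq_iff: "flip_word v = w \<longleftrightarrow> v = flip_word w"
  by (metis flip_flip)

lemma flip_word_lists [simp]: "flip_word w \<in> lists (I \<times> UNIV) \<longleftrightarrow> w \<in> lists (I \<times> UNIV)"
  by (induction w) auto

context
  fixes N :: nat
begin

abbreviation "\<F> \<equiv> free_star_algebra N"
abbreviation "words \<equiv> lists ({1..N} \<times> (UNIV :: bool set))"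

lemma free_sel:
  "carrier \<F> = {a. finite (supp a) \<and> supp a \<subseteq> words}"
  "a \<otimes>\<^bsub>\<F>\<^esub> b = (\<lambda>w. \<Sum>k\<le>length w. a (take k w) * b (drop k w))"
  "\<one>\<^bsub>\<F>\<^esub> = monomial []"
  "\<zero>\<^bsub>\<F>\<^esub> = (\<lambda>w. 0)"
  "a \<oplus>\<^bsub>\<F>\<^esub> b = (\<lambda>w. a w + b w)"
  "c \<odot>\<^bsub>\<F>\<^esub> a = (\<lambda>w. c * a w)"
  "star \<F> a = (\<lambda>w. cnj (a (flip_word w)))"
  "free_gen i = monomial [(i, False)]"
  by (auto simp: free_star_algebra_def supp_def flip_word_def monomial_def free_gen_def)

lemma supp_free:
  "supp (a \<oplus>\<^bsub>\<F>\<^esub> b) \<subseteq> supp a \<union> supp b"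
  "supp (c \<odot>\<^bsub>\<F>\<^esub> a) \<subseteq> supp a"
  "supp (star \<F> a) = flip_word ` supp a"
  "supp (a \<otimes>\<^bsub>\<F>\<^esub> b) \<subseteq> (\<lambda>(u, v). u @ v) ` (supp a \<times> supp b)"
proof -
  show "supp (star \<F> a) = flip_word ` supp a"
    by (force simp: supp_def free_sel image_iff flip_word_eq_iff)
  show "supp (a \<otimes>\<^bsub>\<F>\<^esub> b) \<subseteq> (\<lambda>(u, v). u @ v) ` (supp a \<times> supp b)"
  proof
    fix w assume "w \<in> supp (a \<otimes>\<^bsub>\<F>\<^esub> b)"
    then have "(\<Sum>k\<le>length w. a (take k w) * b (drop k w)) \<noteq> 0"
      by (simp add: supp_def free_sel(2))
    then obtain k where "a (take k w) * b (drop k w) \<noteq> 0"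
      by (rule sum.not_neutral_contains_not_neutral)
    then have "(take k w, drop k w) \<in> supp a \<times> supp b" by (auto simp: supp_def)
    then show "w \<in> (\<lambda>(u, v). u @ v) ` (supp a \<times> supp b)"
      by (intro image_eqI[where x = "(take k w, drop k w)"]) simp_all
  qed
qed (auto simp: supp_def free_sel)

lemma free_closed:
  assumes "a \<in> carrier \<F>" "b \<in> carrier \<F>"
  shows "a \<oplus>\<^bsub>\<F>\<^esub> b \<in> carrier \<F>" "c \<odot>\<^bsub>\<F>\<^esub> a \<in> carrier \<F>" "star \<F> a \<in> carrier \<F>" "a \<otimes>\<^bsub>\<F>\<^esub> b \<in> carrier \<F>"
proof -
  have fin: "finite (supp a)" "finite (supp b)" and wd: "supp a \<subseteq> words" "supp b \<subseteq> words"
    using assms by (auto simp: free_sel(1))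
  note in_F = free_sel(1) mem_Collect_eq
  show "a \<oplus>\<^bsub>\<F>\<^esub> b \<in> carrier \<F>"
    unfolding in_F using supp_free(1)[of a b] fin wd by (meson Un_least finite_UnI finite_subset order_trans)
  show "c \<odot>\<^bsub>\<F>\<^esub> a \<in> carrier \<F>"
    unfolding in_F using supp_free(2)[of c a] fin wd by (meson finite_subset order_trans)
  show "star \<F> a \<in> carrier \<F>"
    unfolding in_F supp_free(3) using fin wd(1)
    by (intro conjI finite_imageI image_subsetI iffD2[OF flip_word_lists]) (rule fin, rule subsetD)
  show "a \<otimes>\<^bsub>\<F>\<^esub> b \<in> carrier \<F>"
  proof -
    have "(\<lambda>(u, v). u @ v) ` (supp a \<times> supp b) \<subseteq> words"
      using wd by force
    then show ?thesis
      unfolding in_F using supp_free(4)[of a b] fin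
      by (meson finite_SigmaI finite_imageI finite_subset order_trans)
  qed
qed

lemmas free_closed_simps [simp] = free_closed(1,4)

lemma free_closed_unary [simp]:
  "a \<in> carrier \<F> \<Longrightarrow> c \<odot>\<^bsub>\<F>\<^esub> a \<in> carrier \<F>" "a \<in> carrier \<F> \<Longrightarrow> star \<F> a \<in> carrier \<F>"
  by (rule free_closed; assumption)+

lemma monomial_closed [simp]: "w \<in> words \<Longrightarrow> monomial w \<in> carrier \<F>"
  by (auto simp: free_sel(1) supp_def monomial_def)

lemma one_free_closed [simp]: "\<one>\<^bsub>\<F>\<^esub> \<in> carrier \<F>" 
  by (simp add: free_sel(3))

lemma zero_free_closed [simp]: "\<zero>\<^bsub>\<F>\<^esub> \<in> carrier \<F>"
  by (simp add: free_sel(1,4) supp_def)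

lemma free_gen_closed [simp]: "i \<in> {1..N} \<Longrightarrow> free_gen i \<in> carrier \<F>"
  by (simp add: free_sel(8))

lemma monomial_mult: "monomial u \<otimes>\<^bsub>\<F>\<^esub> monomial v = monomial (u @ v)"
proof
  fix w
  have "(monomial u \<otimes>\<^bsub>\<F>\<^esub> monomial v) w =
      (\<Sum>k\<le>length w. if k = length u then (if w = u @ v then 1 else 0) else (0 :: complex))"
    unfolding free_sel
  proof (intro sum.cong refl)
    fix k assume "k \<in> {..length w}"
    then show "monomial u (take k w) * monomial v (drop k w) =
        (if k = length u then (if w = u @ v then 1 else 0) else (0 :: complex))"
    proof -
      have "take k w = u \<and> drop k w = v \<longleftrightarrow> k = length u \<and> w = u @ v"
          using \<open>k \<in> {..length w}\<close> append_take_drop_id[of k w] by (auto simp del: append_take_drop_id)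
      moreover have "monomial u (take k w) * monomial v (drop k w) =
          (if take k w = u \<and> drop k w = v then 1 else 0)"
        by (simp add: monomial_def)
      ultimately show ?thesis by presburger
    qed
  qed
  also have "\<dots> = monomial (u @ v) w"
    by (auto simp: monomial_def)
  finally show "(monomial u \<otimes>\<^bsub>\<F>\<^esub> monomial v) w = monomial (u @ v) w" .
qed

lemma monomial_star: "star \<F> (monomial w) = monomial (flip_word w)"
  by (auto simp: free_sel monomial_def flip_word_eq_iff)

lemma free_abelian_group: "abelian_group \<F>"
proof (rule abelian_groupI)
  fix a assume a: "a \<in> carrier \<F>"
  show "\<exists>b\<in>carrier \<F>. b \<oplus>\<^bsub>\<F>\<^esub> a = \<zero>\<^bsub>\<F>\<^esub>"
    by (rule bexI[OF _ free_closed(2)[OF a a, of "-1"]]) (simp add: free_sel(4-6))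
qed (use free_closed(1) zero_free_closed in \<open>simp_all add: free_sel(4,5) add_ac\<close>)

lemma free_minus:
  assumes "a \<in> carrier \<F>" "b \<in> carrier \<F>"
  shows "a \<ominus>\<^bsub>\<F>\<^esub> b = (\<lambda>w. a w - b w)"
proof -
  interpret F: abelian_group \<F> by (rule free_abelian_group)
  have "\<ominus>\<^bsub>\<F>\<^esub> b = (-1) \<odot>\<^bsub>\<F>\<^esub> b"
    by (rule F.minus_equality[OF _ assms(2) free_closed(2)[OF assms(2) assms(2)]])
       (simp add: free_sel(4-6))
  then show ?thesis by (simp add: a_minus_def free_sel(5,6))
qed

lemma free_minus_closed [simp]: "a \<in> carrier \<F> \<Longrightarrow> b \<in> carrier \<F> \<Longrightarrow> a \<ominus>\<^bsub>\<F>\<^esub> b \<in> carrier \<F>"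
  by (rule abelian_group.minus_closed[OF free_abelian_group])

lemma free_finsum:
  assumes "finite I" "\<And>i. i \<in> I \<Longrightarrow> f i \<in> carrier \<F>"
  shows "finsum \<F> f I \<in> carrier \<F> \<and> finsum \<F> f I = (\<lambda>w. \<Sum>i\<in>I. f i w)"
proof -
  interpret F: abelian_group \<F> by (rule free_abelian_group)
  show ?thesis using assms
  proof (induction I)
    case (insert i I)
    then have "finsum \<F> f (insert i I) = f i \<oplus>\<^bsub>\<F>\<^esub> finsum \<F> f I"
      by (intro F.finsum_insert) auto
    moreover have "f i \<oplus>\<^bsub>\<F>\<^esub> finsum \<F> f I \<in> carrier \<F>"
    proof (rule free_closed(1))
      show "finsum \<F> f I \<in> carrier \<F>" using insert by blast
    qed (use insert in simp)
    moreover have "f i \<oplus>\<^bsub>\<F>\<^esub> finsum \<F> f I = (\<lambda>w. \<Sum>j\<in>insert i I. f j w)"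
      using insert by (simp add: free_sel(5))
    ultimately show ?case by simp
  qed (use zero_free_closed in \<open>simp add: free_sel(4)\<close>)
qed

section \<open>The universal seminorm\<close>

definition cuntz_seminorms :: "(((nat \<times> bool) list \<Rightarrow> complex) \<Rightarrow> real) set" where
  "cuntz_seminorms = {p. cstar_seminorm \<F> p \<and> (\<forall>r\<in>cuntz_relations N. p r = 0)}"

lemma cstar_seminormD:
  assumes "cstar_seminorm \<F> p" "a \<in> carrier \<F>"
  shows "0 \<le> p a" "p (c \<odot>\<^bsub>\<F>\<^esub> a) = cmod c * p a" "p (star \<F> a \<otimes>\<^bsub>\<F>\<^esub> a) = (p a)\<^sup>2"
    "b \<in> carrier \<F> \<Longrightarrow> p (a \<oplus>\<^bsub>\<F>\<^esub> b) \<le> p a + p b"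
    "b \<in> carrier \<F> \<Longrightarrow> p (a \<otimes>\<^bsub>\<F>\<^esub> b) \<le> p a * p b"
  using assms unfolding cstar_seminorm_def by blast+

text \<open>From \<open>p (a\<^sup>* a) = (p a)\<^sup>2\<close> and submultiplicativity, \<open>p a \<le> p a\<^sup>*\<close>; the involution gives the converse.\<close>

lemma seminorm_star:
  assumes p: "cstar_seminorm \<F> p" and a: "a \<in> carrier \<F>"
  shows "p (star \<F> a) = p a"
proof -
  have le: "p b \<le> p (star \<F> b)" if b: "b \<in> carrier \<F>" for b
  proof (cases "p b = 0")
    case False
    have "p b * p b \<le> p (star \<F> b) * p b"
      using cstar_seminormD(3,5)[OF p] b by (metis free_closed(3) power2_eq_square)
    then show ?thesis
      using False cstar_seminormD(1)[OF p b] by (simp add: mult_le_cancel_right)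
  qed (use cstar_seminormD(1)[OF p] b in simp)
  have "star \<F> (star \<F> a) = a" by (simp add: free_sel(7))
  then show ?thesis using le[OF a] le[of "star \<F> a"] a by simp
qed

text \<open>
  The relation \<open>s\<^sub>i\<^sup>* s\<^sub>i = 1\<close> and the C*-identity bound every monomial by \<open>1\<close>, uniformly in the
  seminorm, so the supremum over all admissible seminorms is finite.
\<close>

lemma seminorm_monomial:
  assumes p: "p \<in> cuntz_seminorms" and w: "w \<in> words"
  shows "p (monomial w) \<le> 1"
proof -
  have cs: "cstar_seminorm \<F> p" and rel: "\<And>r. r \<in> cuntz_relations N \<Longrightarrow> p r = 0"
    using p by (auto simp: cuntz_seminorms_def)
  have one: "p (monomial []) \<le> 1"
  proof -
    have "(p (monomial []))\<^sup>2 = p (monomial [])"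
      using cstar_seminormD(3)[OF cs monomial_closed[of "[]"]] by (simp add: monomial_star monomial_mult)
    then have "p (monomial []) = 0 \<or> p (monomial []) = 1" by (simp add: power2_eq_square)
    then show ?thesis by fastforce
  qed
  have gen: "p (free_gen i) \<le> 1" if i: "i \<in> {1..N}" for i
  proof -
    let ?g = "free_gen i" and ?s = "star \<F> (free_gen i) \<otimes>\<^bsub>\<F>\<^esub> free_gen i"
    have s: "?s \<in> carrier \<F>" using i by simp
    have "?s \<ominus>\<^bsub>\<F>\<^esub> \<one>\<^bsub>\<F>\<^esub> \<in> cuntz_relations N"
      unfolding cuntz_relations_def Let_def using i by force
    then have "p (?s \<ominus>\<^bsub>\<F>\<^esub> \<one>\<^bsub>\<F>\<^esub>) = 0" by (rule rel)
    moreover have "?s = (?s \<ominus>\<^bsub>\<F>\<^esub> \<one>\<^bsub>\<F>\<^esub>) \<oplus>\<^bsub>\<F>\<^esub> \<one>\<^bsub>\<F>\<^esub>"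
      using s by (simp add: free_minus free_sel(5))
    ultimately have "p ?s \<le> 0 + p \<one>\<^bsub>\<F>\<^esub>"
      using cstar_seminormD(4)[OF cs, of "?s \<ominus>\<^bsub>\<F>\<^esub> \<one>\<^bsub>\<F>\<^esub>" "\<one>\<^bsub>\<F>\<^esub>"] s by simp
    then have "(p ?g)\<^sup>2 \<le> 1"
      using one cstar_seminormD(3)[OF cs, of ?g] i by (simp add: free_sel(3))
    then show ?thesis by (simp add: abs_square_le_1 abs_le_iff)
  qed
  have letter: "p (monomial [x]) \<le> 1" if "x \<in> {1..N} \<times> UNIV" for x
  proof -
    obtain i e where x: "x = (i, e)" by fastforce
    have i: "i \<in> {1..N}" using that x by simp
    show ?thesis
    proof (cases e)
      case True
      then have "monomial [x] = star \<F> (free_gen i)"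
        by (simp add: x free_sel(8) monomial_star)
      then show ?thesis using gen[OF i] seminorm_star[OF cs] i by simp
    qed (use gen[OF i] in \<open>simp add: x free_sel(8)\<close>)
  qed
  show ?thesis using w
  proof (induction w)
    case (Cons x w)
    have "p (monomial (x # w)) = p (monomial [x] \<otimes>\<^bsub>\<F>\<^esub> monomial w)"
      by (simp add: monomial_mult)
    also have "\<dots> \<le> p (monomial [x]) * p (monomial w)"
      using Cons by (intro cstar_seminormD(5)[OF cs]) auto
    also have "\<dots> \<le> 1 * 1"
      using Cons letter cstar_seminormD(1)[OF cs, of "monomial w"] by (intro mult_mono) auto
    finally show ?case by simp
  qed (use one in simp)
qed

lemma seminorm_bound:
  assumes p: "p \<in> cuntz_seminorms" and a: "a \<in> carrier \<F>"
  shows "p a \<le> (\<Sum>w\<in>supp a. cmod (a w))"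
proof -
  have cs: "cstar_seminorm \<F> p" using p by (auto simp: cuntz_seminorms_def)
  have "p (\<lambda>w. if w \<in> D then a w else 0) \<le> (\<Sum>w\<in>D. cmod (a w)) \<and> (\<lambda>w. if w \<in> D then a w else 0) \<in> carrier \<F>"
    if "finite D" "D \<subseteq> words" for D
    using that
  proof (induction D)
    case empty
    have "p (0 \<odot>\<^bsub>\<F>\<^esub> \<zero>\<^bsub>\<F>\<^esub>) = 0" by (subst cstar_seminormD(2)[OF cs]) auto
    then show ?case using zero_free_closed by (simp add: free_sel(4,6) del: zero_free_closed)
  next
    case (insert v D)
    let ?b = "\<lambda>w. if w \<in> D then a w else 0"
    have eq: "(\<lambda>w. if w \<in> insert v D then a w else 0) = (a v \<odot>\<^bsub>\<F>\<^esub> monomial v) \<oplus>\<^bsub>\<F>\<^esub> ?b"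
      using insert by (auto simp: free_sel(5,6) monomial_def)
    have mem: "a v \<odot>\<^bsub>\<F>\<^esub> monomial v \<in> carrier \<F>" "?b \<in> carrier \<F>"
      using insert free_closed(2)[OF monomial_closed monomial_closed] by auto
    have "p (a v \<odot>\<^bsub>\<F>\<^esub> monomial v) \<le> cmod (a v) * 1"
    proof -
      have "p (monomial v) \<le> 1" using insert by (intro seminorm_monomial[OF p]) auto
      then show ?thesis
        using insert by (subst cstar_seminormD(2)[OF cs]) (auto intro!: mult_left_le)
    qed
    moreover have "p ((a v \<odot>\<^bsub>\<F>\<^esub> monomial v) \<oplus>\<^bsub>\<F>\<^esub> ?b) \<le> p (a v \<odot>\<^bsub>\<F>\<^esub> monomial v) + p ?b"
      using cstar_seminormD(4)[OF cs mem] .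
    ultimately show ?case
      unfolding eq using insert mem by auto
  qed
  note * = this[of "supp a"]
  show ?thesis
  proof -
    have "(\<lambda>w. if w \<in> supp a then a w else 0) = a" by (auto simp: supp_def)
    then show ?thesis using * a by (simp add: free_sel(1))
  qed
qed

text \<open>The supremum defining the universal seminorm ranges over a nonempty set.\<close>

lemma zero_seminorm: "(\<lambda>a. 0) \<in> cuntz_seminorms"
  by (simp add: cuntz_seminorms_def cstar_seminorm_def)

abbreviation "qnorm \<equiv> cuntz_seminorm N"

lemma qnorm_eq: "qnorm a = (SUP p\<in>cuntz_seminorms. p a)"
  by (simp add: cuntz_seminorm_def universal_seminorm_def cuntz_seminorms_def)

lemma seminorm_le_qnorm: "p \<in> cuntz_seminorms \<Longrightarrow> a \<in> carrier \<F> \<Longrightarrow> p a \<le> qnorm a"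
  unfolding qnorm_eq using seminorm_bound by (intro cSUP_upper bdd_aboveI2) auto

lemma qnorm_leI: "(\<And>p. p \<in> cuntz_seminorms \<Longrightarrow> p a \<le> C) \<Longrightarrow> qnorm a \<le> C"
  unfolding qnorm_eq using zero_seminorm by (intro cSUP_least) auto

lemma qnorm_nonneg [simp]: "a \<in> carrier \<F> \<Longrightarrow> 0 \<le> qnorm a"
  using seminorm_le_qnorm[OF zero_seminorm] by simp

lemma
  assumes a: "a \<in> carrier \<F>"
  shows qnorm_scale: "qnorm (c \<odot>\<^bsub>\<F>\<^esub> a) \<le> cmod c * qnorm a"
    and qnorm_star: "qnorm (star \<F> a) \<le> qnorm a"
    and qnorm_add: "b \<in> carrier \<F> \<Longrightarrow> qnorm (a \<oplus>\<^bsub>\<F>\<^esub> b) \<le> qnorm a + qnorm b"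
    and qnorm_mult: "b \<in> carrier \<F> \<Longrightarrow> qnorm (a \<otimes>\<^bsub>\<F>\<^esub> b) \<le> qnorm a * qnorm b"
proof -
  have cs: "cstar_seminorm \<F> p" if "p \<in> cuntz_seminorms" for p
    using that by (simp add: cuntz_seminorms_def)
  show "qnorm (c \<odot>\<^bsub>\<F>\<^esub> a) \<le> cmod c * qnorm a"
    using a seminorm_le_qnorm by (intro qnorm_leI) (auto simp: cstar_seminormD(2)[OF cs] intro: mult_left_mono)
  show "qnorm (star \<F> a) \<le> qnorm a"
    using a seminorm_le_qnorm by (intro qnorm_leI) (auto simp: seminorm_star[OF cs])
  assume b: "b \<in> carrier \<F>"
  show "qnorm (a \<oplus>\<^bsub>\<F>\<^esub> b) \<le> qnorm a + qnorm b"
    using seminorm_le_qnorm[OF _ a] seminorm_le_qnorm[OF _ b] cstar_seminormD(4)[OF cs a b]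
    by (intro qnorm_leI) (meson add_mono order_trans)
  show "qnorm (a \<otimes>\<^bsub>\<F>\<^esub> b) \<le> qnorm a * qnorm b"
  proof (rule qnorm_leI)
    fix p assume p: "p \<in> cuntz_seminorms"
    have "p (a \<otimes>\<^bsub>\<F>\<^esub> b) \<le> p a * p b" by (rule cstar_seminormD(5)[OF cs[OF p] a b])
    also have "\<dots> \<le> qnorm a * qnorm b"
      using p a b seminorm_le_qnorm cstar_seminormD(1)[OF cs[OF p]] by (intro mult_mono) auto
    finally show "p (a \<otimes>\<^bsub>\<F>\<^esub> b) \<le> qnorm a * qnorm b" .
  qed
qed

lemma qnorm_zero: "qnorm (\<lambda>w. 0) = 0"
  using qnorm_scale[OF zero_free_closed, of 0] qnorm_nonneg[OF zero_free_closed] by (simp add: free_sel(4,6))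

section \<open>Cauchy sequences and the completion\<close>

abbreviation "cauchy \<equiv> cauchy_seqs \<F> qnorm"
abbreviation "cl \<equiv> completion_class \<F> qnorm"
abbreviation "\<O> \<equiv> cuntz_algebra N"

lemma cauchy_closed [simp]: "a \<in> cauchy \<Longrightarrow> a n \<in> carrier \<F>"
  by (simp add: cauchy_seqs_def)

lemma cauchyD:
  assumes a: "a \<in> cauchy" and e: "e > 0"
  shows "\<exists>n0. \<forall>m\<ge>n0. \<forall>n\<ge>n0. qnorm (a m \<ominus>\<^bsub>\<F>\<^esub> a n) < e"
  using a[unfolded cauchy_seqs_def, THEN CollectD, THEN conjunct2, rule_format, OF e] .

lemma cauchy_bounded:
  assumes a: "a \<in> cauchy"
  obtains C where "C > 0" "\<And>n. qnorm (a n) \<le> C"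
proof -
  obtain n0 where n0: "\<And>m n. m \<ge> n0 \<Longrightarrow> n \<ge> n0 \<Longrightarrow> qnorm (a m \<ominus>\<^bsub>\<F>\<^esub> a n) < 1"
    using cauchyD[OF a, of 1] by auto
  define C where "C = (\<Sum>n\<le>n0. qnorm (a n)) + 1"
  have le: "qnorm (a n) \<le> (\<Sum>n\<le>n0. qnorm (a n))" if "n \<le> n0" for n
    using a that by (intro member_le_sum) auto
  have "qnorm (a n) \<le> C" for n
  proof (cases "n \<le> n0")
    case False
    have "a n = (a n \<ominus>\<^bsub>\<F>\<^esub> a n0) \<oplus>\<^bsub>\<F>\<^esub> a n0" using a by (simp add: free_minus free_sel(5))
    then have "qnorm (a n) \<le> qnorm (a n \<ominus>\<^bsub>\<F>\<^esub> a n0) + qnorm (a n0)"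
      using qnorm_add[of "a n \<ominus>\<^bsub>\<F>\<^esub> a n0" "a n0"] a by simp
    then show ?thesis using n0[of n n0] le[of n0] False by (simp add: C_def)
  qed (use le[of n] in \<open>simp add: C_def\<close>)
  moreover have "C > 0"
    using a by (auto simp: C_def intro!: add_nonneg_pos sum_nonneg)
  ultimately show ?thesis using that by blast
qed

lemma cauchy_const [simp]: "a \<in> carrier \<F> \<Longrightarrow> (\<lambda>n. a) \<in> cauchy"
  by (simp add: cauchy_seqs_def free_minus qnorm_zero del: cauchy_closed)

text \<open>The algebraic operations are Lipschitz in each argument on bounded sets, which gives exactly
  an estimate of this form.\<close>

lemma cauchy_dominated:
  assumes a: "a \<in> cauchy" and b: "b \<in> cauchy" and c: "\<And>n. c n \<in> carrier \<F>" and C: "C > 0" "D > 0"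
    and le: "\<And>m n. qnorm (c m \<ominus>\<^bsub>\<F>\<^esub> c n) \<le> C * qnorm (a m \<ominus>\<^bsub>\<F>\<^esub> a n) + D * qnorm (b m \<ominus>\<^bsub>\<F>\<^esub> b n)"
  shows "c \<in> cauchy"
  unfolding cauchy_seqs_def
proof (intro CollectI conjI allI impI)
  fix e :: real assume e: "e > 0"
  obtain n1 where n1: "\<And>m n. m \<ge> n1 \<Longrightarrow> n \<ge> n1 \<Longrightarrow> qnorm (a m \<ominus>\<^bsub>\<F>\<^esub> a n) < e / (2 * C)"
    using cauchyD[OF a, of "e / (2 * C)"] e C by auto
  obtain n2 where n2: "\<And>m n. m \<ge> n2 \<Longrightarrow> n \<ge> n2 \<Longrightarrow> qnorm (b m \<ominus>\<^bsub>\<F>\<^esub> b n) < e / (2 * D)"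
    using cauchyD[OF b, of "e / (2 * D)"] e C by auto
  show "\<exists>n0. \<forall>m\<ge>n0. \<forall>n\<ge>n0. qnorm (c m \<ominus>\<^bsub>\<F>\<^esub> c n) < e"
  proof (intro exI allI impI)
    fix m n assume mn: "m \<ge> max n1 n2" "n \<ge> max n1 n2"
    have "C * qnorm (a m \<ominus>\<^bsub>\<F>\<^esub> a n) < e / 2" using n1[of m n] mn C by (simp add: field_simps)
    moreover have "D * qnorm (b m \<ominus>\<^bsub>\<F>\<^esub> b n) < e / 2" using n2[of m n] mn C by (simp add: field_simps)
    ultimately show "qnorm (c m \<ominus>\<^bsub>\<F>\<^esub> c n) < e" using le[of m n] by simp
  qed
qed (use c in simp)

lemma cauchy_add:
  assumes a: "a \<in> cauchy" and b: "b \<in> cauchy"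
  shows "(\<lambda>n. a n \<oplus>\<^bsub>\<F>\<^esub> b n) \<in> cauchy"
proof (rule cauchy_dominated[OF a b, where C = 1 and D = 1])
  fix m n
  have "(a m \<oplus>\<^bsub>\<F>\<^esub> b m) \<ominus>\<^bsub>\<F>\<^esub> (a n \<oplus>\<^bsub>\<F>\<^esub> b n) = (a m \<ominus>\<^bsub>\<F>\<^esub> a n) \<oplus>\<^bsub>\<F>\<^esub> (b m \<ominus>\<^bsub>\<F>\<^esub> b n)"
    using a b free_closed(1)[of "a m" "b m"] free_closed(1)[of "a n" "b n"]
    by (simp add: free_minus) (simp add: free_sel(5) algebra_simps)
  then show "qnorm ((a m \<oplus>\<^bsub>\<F>\<^esub> b m) \<ominus>\<^bsub>\<F>\<^esub> (a n \<oplus>\<^bsub>\<F>\<^esub> b n)) \<le>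
      1 * qnorm (a m \<ominus>\<^bsub>\<F>\<^esub> a n) + 1 * qnorm (b m \<ominus>\<^bsub>\<F>\<^esub> b n)"
    using qnorm_add[of "a m \<ominus>\<^bsub>\<F>\<^esub> a n" "b m \<ominus>\<^bsub>\<F>\<^esub> b n"] a b by simp
qed (use a b in auto)

lemma cauchy_scale:
  assumes a: "a \<in> cauchy"
  shows "(\<lambda>n. c \<odot>\<^bsub>\<F>\<^esub> a n) \<in> cauchy"
proof (rule cauchy_dominated[OF a a, where C = "cmod c + 1" and D = 1])
  fix m n
  have "(c \<odot>\<^bsub>\<F>\<^esub> a m) \<ominus>\<^bsub>\<F>\<^esub> (c \<odot>\<^bsub>\<F>\<^esub> a n) = c \<odot>\<^bsub>\<F>\<^esub> (a m \<ominus>\<^bsub>\<F>\<^esub> a n)"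
    using a free_closed(2)[of "a m" "a m"] free_closed(2)[of "a n" "a n"]
    by (simp add: free_minus) (simp add: free_sel(6) algebra_simps)
  then have "qnorm ((c \<odot>\<^bsub>\<F>\<^esub> a m) \<ominus>\<^bsub>\<F>\<^esub> (c \<odot>\<^bsub>\<F>\<^esub> a n)) \<le> cmod c * qnorm (a m \<ominus>\<^bsub>\<F>\<^esub> a n)"
    using qnorm_scale[of "a m \<ominus>\<^bsub>\<F>\<^esub> a n" c] a by simp
  then show "qnorm ((c \<odot>\<^bsub>\<F>\<^esub> a m) \<ominus>\<^bsub>\<F>\<^esub> (c \<odot>\<^bsub>\<F>\<^esub> a n)) \<le>
      (cmod c + 1) * qnorm (a m \<ominus>\<^bsub>\<F>\<^esub> a n) + 1 * qnorm (a m \<ominus>\<^bsub>\<F>\<^esub> a n)"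
    using qnorm_nonneg[OF free_minus_closed, OF cauchy_closed cauchy_closed, OF a a, of m n]
    by (simp add: algebra_simps)
qed (use a in \<open>auto intro: add_nonneg_pos\<close>)

lemma cauchy_star:
  assumes a: "a \<in> cauchy"
  shows "(\<lambda>n. star \<F> (a n)) \<in> cauchy"
proof (rule cauchy_dominated[OF a a, where C = 1 and D = 1])
  fix m n
  have "star \<F> (a m) \<ominus>\<^bsub>\<F>\<^esub> star \<F> (a n) = star \<F> (a m \<ominus>\<^bsub>\<F>\<^esub> a n)"
    using a free_closed(3)[of "a m" "a m"] free_closed(3)[of "a n" "a n"]
    by (simp add: free_minus) (simp add: free_sel(7))
  then show "qnorm (star \<F> (a m) \<ominus>\<^bsub>\<F>\<^esub> star \<F> (a n)) \<le> 1 * qnorm (a m \<ominus>\<^bsub>\<F>\<^esub> a n) + 1 * qnorm (a m \<ominus>\<^bsub>\<F>\<^esub> a n)"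
    using qnorm_star[OF free_minus_closed, OF cauchy_closed cauchy_closed, OF a a, of m n]
      qnorm_nonneg[OF free_minus_closed, OF cauchy_closed cauchy_closed, OF a a, of m n] by simp
qed (use a in auto)

text \<open>Both factors are bounded, and
  \<open>a\<^sub>m b\<^sub>m - a\<^sub>n b\<^sub>n = (a\<^sub>m - a\<^sub>n) b\<^sub>n + a\<^sub>m (b\<^sub>m - b\<^sub>n)\<close>.\<close>

lemma cauchy_mult:
  assumes a: "a \<in> cauchy" and b: "b \<in> cauchy"
  shows "(\<lambda>n. a n \<otimes>\<^bsub>\<F>\<^esub> b n) \<in> cauchy"
proof -
  obtain C where C: "C > 0" "\<And>n. qnorm (a n) \<le> C" using cauchy_bounded[OF a] by blast
  obtain D where D: "D > 0" "\<And>n. qnorm (b n) \<le> D" using cauchy_bounded[OF b] by blast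
  show ?thesis
  proof (rule cauchy_dominated[OF a b _ D(1) C(1)])
    fix m n
    let ?a = "a m \<ominus>\<^bsub>\<F>\<^esub> a n" and ?b = "b m \<ominus>\<^bsub>\<F>\<^esub> b n"
    have mem: "?a \<in> carrier \<F>" "?b \<in> carrier \<F>" using a b by simp_all
    have "(a m \<otimes>\<^bsub>\<F>\<^esub> b m) \<ominus>\<^bsub>\<F>\<^esub> (a n \<otimes>\<^bsub>\<F>\<^esub> b n) = (?a \<otimes>\<^bsub>\<F>\<^esub> b n) \<oplus>\<^bsub>\<F>\<^esub> (a m \<otimes>\<^bsub>\<F>\<^esub> ?b)"
      using a b free_closed(4)[of "a m" "b m"] free_closed(4)[of "a n" "b n"]
      by (simp add: free_minus)
         (simp add: free_sel(2,5) fun_eq_iff sum.distrib[symmetric] sum_subtractf[symmetric] algebra_simps)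
    then have "qnorm ((a m \<otimes>\<^bsub>\<F>\<^esub> b m) \<ominus>\<^bsub>\<F>\<^esub> (a n \<otimes>\<^bsub>\<F>\<^esub> b n)) \<le> qnorm (?a \<otimes>\<^bsub>\<F>\<^esub> b n) + qnorm (a m \<otimes>\<^bsub>\<F>\<^esub> ?b)"
      using qnorm_add[of "?a \<otimes>\<^bsub>\<F>\<^esub> b n" "a m \<otimes>\<^bsub>\<F>\<^esub> ?b"] a b mem by simp
    also have "\<dots> \<le> qnorm ?a * qnorm (b n) + qnorm (a m) * qnorm ?b"
      using a b mem by (intro add_mono qnorm_mult) auto
    also have "\<dots> \<le> qnorm ?a * D + C * qnorm ?b"
      using C D mem by (intro add_mono mult_left_mono mult_right_mono) auto
    finally show "qnorm ((a m \<otimes>\<^bsub>\<F>\<^esub> b m) \<ominus>\<^bsub>\<F>\<^esub> (a n \<otimes>\<^bsub>\<F>\<^esub> b n)) \<le> D * qnorm ?a + C * qnorm ?b"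
      by (simp add: mult.commute)
  qed (use a b in auto)
qed

text \<open>The operations of the completion act on chosen representatives, which differ from the given
  ones by null sequences.\<close>

lemma rep_class:
  assumes "a \<in> cauchy"
  shows "rep (cl a) \<in> cauchy" "(\<lambda>n. qnorm (rep (cl a) n \<ominus>\<^bsub>\<F>\<^esub> a n)) \<longlonglongrightarrow> 0"
proof -
  have "a \<in> cl a" using assms by (simp add: completion_class_def free_minus qnorm_zero)
  then have "rep (cl a) \<in> cl a" unfolding rep_def by (rule someI[where P = "\<lambda>f. f \<in> cl a"])
  then show "rep (cl a) \<in> cauchy" "(\<lambda>n. qnorm (rep (cl a) n \<ominus>\<^bsub>\<F>\<^esub> a n)) \<longlonglongrightarrow> 0"
    by (auto simp: completion_class_def)
qed

lemma cuntz_algebra_sel: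
  "carrier \<O> = cl ` cauchy"
  "x \<otimes>\<^bsub>\<O>\<^esub> y = cl (\<lambda>n. rep x n \<otimes>\<^bsub>\<F>\<^esub> rep y n)"
  "\<one>\<^bsub>\<O>\<^esub> = cl (\<lambda>n. \<one>\<^bsub>\<F>\<^esub>)"
  "x \<oplus>\<^bsub>\<O>\<^esub> y = cl (\<lambda>n. rep x n \<oplus>\<^bsub>\<F>\<^esub> rep y n)"
  "c \<odot>\<^bsub>\<O>\<^esub> x = cl (\<lambda>n. c \<odot>\<^bsub>\<F>\<^esub> rep x n)"
  "star \<O> x = cl (\<lambda>n. star \<F> (rep x n))"
  by (simp_all add: cuntz_algebra_def completion_def Let_def)

lemma rep_cauchy: "x \<in> carrier \<O> \<Longrightarrow> rep x \<in> cauchy"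
  using rep_class by (auto simp: cuntz_algebra_sel)

lemma cuntz_gen_closed: "i \<in> {1..N} \<Longrightarrow> cuntz_gen N i \<in> carrier \<O>"
  by (simp add: cuntz_gen_def cuntz_algebra_sel)

lemma cuntz_star_closed: "x \<in> carrier \<O> \<Longrightarrow> star \<O> x \<in> carrier \<O>"
  using cauchy_star[OF rep_cauchy] by (simp add: cuntz_algebra_sel)

end

section \<open>Operator norm and strong limits\<close>

context hilbert_space
begin

definition opnorm :: "('v \<Rightarrow> 'v) \<Rightarrow> real" where
  "opnorm T = (SUP x\<in>{x \<in> V. nrm x \<le> 1}. nrm (T x))"

lemma opnorm_least:
  assumes "C \<ge> 0" "\<And>x. x \<in> V \<Longrightarrow> nrm (T x) \<le> C * nrm x"
  shows "opnorm T \<le> C"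
  unfolding opnorm_def
proof (rule cSUP_least)
  have "hzero H \<in> {x \<in> V. nrm x \<le> 1}" by simp
  then show "{x \<in> V. nrm x \<le> 1} \<noteq> {}" by blast
  fix x assume x: "x \<in> {x \<in> V. nrm x \<le> 1}"
  then have "C * nrm x \<le> C * 1" using assms(1) by (intro mult_left_mono) auto
  then show "nrm (T x) \<le> C" using assms(2)[of x] x by auto
qed

lemma opnorm_bdd:
  assumes T: "T \<in> B"
  shows "bdd_above ((\<lambda>x. nrm (T x)) ` {x \<in> V. nrm x \<le> 1})"
proof -
  obtain C where C: "C \<ge> 0" "\<And>x. x \<in> V \<Longrightarrow> nrm (T x) \<le> C * nrm x" using op_bound[OF T] by blast
  show ?thesis
  proof (rule bdd_aboveI2)
    fix x assume x: "x \<in> {x \<in> V. nrm x \<le> 1}"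
    then have "C * nrm x \<le> C * 1" using C(1) by (intro mult_left_mono) auto
    then show "nrm (T x) \<le> C" using C(2)[of x] x by auto
  qed
qed

lemma opnorm_bound:
  assumes T: "T \<in> B" and x: "x \<in> V"
  shows "nrm (T x) \<le> opnorm T * nrm x"
proof (cases "nrm x = 0")
  case True
  obtain C where C: "C \<ge> 0" "\<And>x. x \<in> V \<Longrightarrow> nrm (T x) \<le> C * nrm x" using op_bound[OF T] by blast
  show ?thesis using C(2)[OF x] True by simp
next
  case False
  have pos: "nrm x > 0" using False norm_nonneg[OF x] by linarith
  define u where "u = (of_real (1 / nrm x)) \<boxdot> x"
  have u: "u \<in> V" "nrm u = 1"
    using x pos by (simp_all add: u_def norm_scale norm_divide)
  have "nrm (T u) \<le> opnorm T"
    unfolding opnorm_def using u by (intro cSUP_upper[OF _ opnorm_bdd[OF T]]) simp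
  moreover have "nrm (T u) = nrm (T x) / nrm x"
    using x T pos by (simp add: u_def norm_scale norm_divide)
  ultimately show ?thesis using pos by (simp add: field_simps)
qed

lemma opnorm_nonneg:
  assumes "T \<in> B" shows "0 \<le> opnorm T"
proof -
  have "nrm (T (hzero H)) \<le> opnorm T"
    unfolding opnorm_def using opnorm_bdd[OF assms] by (intro cSUP_upper) simp_all
  then show ?thesis using norm_nonneg[OF op_closed[OF assms zero_closed]] by linarith
qed

lemma opnorm_add:
  assumes "S \<in> B" "T \<in> B"
  shows "opnorm (S \<oplus>\<^bsub>A\<^esub> T) \<le> opnorm S + opnorm T"
proof (rule opnorm_least)
  fix x assume x: "x \<in> V"
  have "nrm (S x \<boxplus> T x) \<le> nrm (S x) + nrm (T x)" using assms x by (intro norm_triangle) auto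
  then show "nrm ((S \<oplus>\<^bsub>A\<^esub> T) x) \<le> (opnorm S + opnorm T) * nrm x"
    using opnorm_bound[OF assms(1) x] opnorm_bound[OF assms(2) x] x by (simp add: distrib_right)
qed (use assms opnorm_nonneg in auto)

lemma opnorm_mult:
  assumes "S \<in> B" "T \<in> B"
  shows "opnorm (S \<otimes>\<^bsub>A\<^esub> T) \<le> opnorm S * opnorm T"
proof (rule opnorm_least)
  fix x assume x: "x \<in> V"
  have "nrm (S (T x)) \<le> opnorm S * nrm (T x)" using assms x by (intro opnorm_bound) auto
  also have "\<dots> \<le> opnorm S * (opnorm T * nrm x)"
    using assms x by (intro mult_left_mono opnorm_bound opnorm_nonneg)
  finally show "nrm ((S \<otimes>\<^bsub>A\<^esub> T) x) \<le> opnorm S * opnorm T * nrm x"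
    using x by (simp add: compose_eq mult_ac)
qed (use assms opnorm_nonneg in auto)

lemma opnorm_scale_le:
  assumes "T \<in> B"
  shows "opnorm (c \<odot>\<^bsub>A\<^esub> T) \<le> cmod c * opnorm T"
proof (rule opnorm_least)
  fix x assume x: "x \<in> V"
  then show "nrm ((c \<odot>\<^bsub>A\<^esub> T) x) \<le> cmod c * opnorm T * nrm x"
    using assms mult_left_mono[OF opnorm_bound[OF assms x], of "cmod c"]
    by (simp add: norm_scale mult_ac)
qed (use assms opnorm_nonneg in auto)

lemma opnorm_scale:
  assumes T: "T \<in> B"
  shows "opnorm (c \<odot>\<^bsub>A\<^esub> T) = cmod c * opnorm T"
proof (cases "c = 0")
  case True
  have "0 \<le> opnorm (c \<odot>\<^bsub>A\<^esub> T)"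
    using scale_op[OF T, of c] by (intro opnorm_nonneg) (simp only: op_algebra_sel)
  then show ?thesis using opnorm_scale_le[OF T, of c] True by (simp del: op_algebra_sel)
next
  case False
  have cT: "c \<odot>\<^bsub>A\<^esub> T \<in> B" using T by simp
  have "inverse c \<odot>\<^bsub>A\<^esub> (c \<odot>\<^bsub>A\<^esub> T) = T"
    unfolding op_algebra_sel by (rule op_eqI[OF scale_op[OF scale_op]]) (use T False in auto)
  then have "opnorm T \<le> cmod (inverse c) * opnorm (c \<odot>\<^bsub>A\<^esub> T)"
    using opnorm_scale_le[OF cT, of "inverse c"] by (simp only:)
  moreover define X where "X = opnorm (c \<odot>\<^bsub>A\<^esub> T)"
  moreover have "cmod (inverse c) = 1 / cmod c" by (simp add: norm_divide inverse_eq_divide)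
  moreover have "cmod c > 0" using False by simp
  ultimately have "cmod c * opnorm T \<le> X" by (simp add: field_simps)
  then have "cmod c * opnorm T \<le> opnorm (c \<odot>\<^bsub>A\<^esub> T)" by (simp only: X_def)
  then show ?thesis using opnorm_scale_le[OF T, of c] by linarith
qed

lemma opnorm_adjoint_le:
  assumes T: "T \<in> B"
  shows "opnorm (adjoint_op H T) \<le> opnorm T"
proof (rule opnorm_least)
  fix x assume x: "x \<in> V"
  let ?y = "adjoint_op H T x"
  have y: "?y \<in> V" using T x by simp
  have "nrm ?y * nrm ?y = Re (ip (T ?y) x)"
    using T x y norm_sq[OF y] by (simp add: adjoint_inner power2_eq_square)
  also have "\<dots> \<le> nrm (T ?y) * nrm x"
    using Cauchy_Schwarz[of "T ?y" x] complex_Re_le_cmod[of "ip (T ?y) x"] T x y by force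
  also have "\<dots> \<le> (opnorm T * nrm ?y) * nrm x"
    using opnorm_bound[OF T y] x by (intro mult_right_mono) auto
  finally have "nrm ?y * nrm ?y \<le> (opnorm T * nrm x) * nrm ?y" by (simp only: mult_ac)
  then show "nrm ?y \<le> opnorm T * nrm x"
    using norm_nonneg[OF y] norm_nonneg[OF x] opnorm_nonneg[OF T]
    by (cases "nrm ?y = 0") (simp_all add: mult_le_cancel_right)
qed (use T opnorm_nonneg in auto)

text \<open>The lower bound is the estimate \<open>\<parallel>T x\<parallel>\<^sup>2 = \<langle>T\<^sup>* T x, x\<rangle> \<le> \<parallel>T\<^sup>* T\<parallel> \<parallel>x\<parallel>\<^sup>2\<close>.\<close>

lemma opnorm_cstar:
  assumes T: "T \<in> B"
  shows "opnorm (star A T \<otimes>\<^bsub>A\<^esub> T) = (opnorm T)\<^sup>2"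
proof (rule antisym)
  have "opnorm (star A T \<otimes>\<^bsub>A\<^esub> T) \<le> opnorm (star A T) * opnorm T"
    using T by (intro opnorm_mult) auto
  also have "\<dots> \<le> opnorm T * opnorm T"
    using opnorm_adjoint_le[OF T] opnorm_nonneg[OF T] by (intro mult_right_mono) auto
  finally show "opnorm (star A T \<otimes>\<^bsub>A\<^esub> T) \<le> (opnorm T)\<^sup>2" by (simp only: power2_eq_square)
next
  have ST: "star A T \<otimes>\<^bsub>A\<^esub> T \<in> B" using T by simp
  have "opnorm T \<le> sqrt (opnorm (star A T \<otimes>\<^bsub>A\<^esub> T))"
  proof (rule opnorm_least)
    fix x assume x: "x \<in> V"
    have "(nrm (T x))\<^sup>2 = Re (ip ((star A T \<otimes>\<^bsub>A\<^esub> T) x) x)"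
      using T x by (simp add: norm_sq compose_eq adjoint_inner_left)
    also have "\<dots> \<le> nrm ((star A T \<otimes>\<^bsub>A\<^esub> T) x) * nrm x"
      using Cauchy_Schwarz[of "(star A T \<otimes>\<^bsub>A\<^esub> T) x" x] complex_Re_le_cmod[of "ip ((star A T \<otimes>\<^bsub>A\<^esub> T) x) x"]
        op_closed[OF ST x] x by linarith
    also have "\<dots> \<le> (opnorm (star A T \<otimes>\<^bsub>A\<^esub> T) * nrm x) * nrm x"
      using opnorm_bound[OF ST x] x by (intro mult_right_mono) auto
    also have "\<dots> = (sqrt (opnorm (star A T \<otimes>\<^bsub>A\<^esub> T)) * nrm x)\<^sup>2"
      using opnorm_nonneg[OF ST] by (simp add: power_mult_distrib power2_eq_square)
    finally show "nrm (T x) \<le> sqrt (opnorm (star A T \<otimes>\<^bsub>A\<^esub> T)) * nrm x"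
      using x opnorm_nonneg[OF ST] by (rule_tac power2_le_imp_le) auto
  qed (use opnorm_nonneg[OF ST] in simp)
  then have "(opnorm T)\<^sup>2 \<le> (sqrt (opnorm (star A T \<otimes>\<^bsub>A\<^esub> T)))\<^sup>2"
    using opnorm_nonneg[OF T] by (intro power_mono) auto
  then show "(opnorm T)\<^sup>2 \<le> opnorm (star A T \<otimes>\<^bsub>A\<^esub> T)"
    using opnorm_nonneg[OF ST] by (simp only: real_sqrt_pow2)
qed

definition strongly_converges :: "(nat \<Rightarrow> 'v \<Rightarrow> 'v) \<Rightarrow> ('v \<Rightarrow> 'v) \<Rightarrow> bool" where
  "strongly_converges s T \<longleftrightarrow> T \<in> B \<and> (\<forall>n. s n \<in> B) \<and>
     (\<forall>x\<in>V. (\<lambda>n. hdist H (s n x) (T x)) \<longlonglongrightarrow> 0)"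

lemma strongly_convergesD:
  assumes "strongly_converges s T"
  shows "T \<in> B" "s n \<in> B" "x \<in> V \<Longrightarrow> (\<lambda>n. hdist H (s n x) (T x)) \<longlonglongrightarrow> 0"
  using assms unfolding strongly_converges_def by blast+

lemma strong_imp_weak:
  assumes "strongly_converges s T" "x \<in> V" "y \<in> V"
  shows "(\<lambda>n. ip (s n x) y) \<longlonglongrightarrow> ip (T x) y"
  by (rule inner_tendsto) (use strongly_convergesD[OF assms(1)] assms(2,3) in auto)

text \<open>Limits of products and adjoints are identified through their matrix coefficients.\<close>

lemma weak_limit_eq:
  assumes "strongly_converges s T" "T' \<in> B"
    and "\<And>x y. x \<in> V \<Longrightarrow> y \<in> V \<Longrightarrow> (\<lambda>n. ip (s n x) y) \<longlonglongrightarrow> ip (T' x) y"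
  shows "T' = T"
  by (rule op_eqI)
     (use assms strongly_convergesD(1) strong_imp_weak[OF assms(1)] LIMSEQ_unique in blast)+

text \<open>A sequence that is Cauchy in operator norm converges pointwise. If all later members are
  within distance \<open>1\<close> of \<open>s n0\<close>, a bound for \<open>s n0\<close> increased by \<open>1\<close> bounds the limit.\<close>

lemma strong_limit_exists:
  assumes s: "\<And>n. s n \<in> B"
    and cauchy: "\<And>e. e > 0 \<Longrightarrow> \<exists>n0. \<forall>m\<ge>n0. \<forall>n\<ge>n0. \<forall>x\<in>V. hdist H (s m x) (s n x) \<le> e * nrm x"
  shows "\<exists>T. strongly_converges s T"
proof -
  have "\<exists>z\<in>V. (\<lambda>n. hdist H (s n x) z) \<longlonglongrightarrow> 0" if x: "x \<in> V" for x
  proof (rule complete, use s x in simp, intro allI impI)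
    fix e :: real assume e: "e > 0"
    have "e / (nrm x + 1) > 0" using e norm_nonneg[OF x] by simp
    from cauchy[OF this] obtain n0 where
      n0: "\<And>m n. m \<ge> n0 \<Longrightarrow> n \<ge> n0 \<Longrightarrow> hdist H (s m x) (s n x) \<le> e / (nrm x + 1) * nrm x"
      using x by blast
    have "e / (nrm x + 1) * nrm x < e"
      using e norm_nonneg[OF x] by (simp add: field_simps)
    then show "\<exists>n0. \<forall>m\<ge>n0. \<forall>n\<ge>n0. hdist H (s m x) (s n x) < e"
      using n0 by (intro exI[of _ n0]) force
  qed
  then obtain T where T: "\<And>x. x \<in> V \<Longrightarrow> T x \<in> V" 
    and lim: "\<And>x. x \<in> V \<Longrightarrow> (\<lambda>n. hdist H (s n x) (T x)) \<longlonglongrightarrow> 0"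
    by metis
  have weak: "(\<lambda>n. ip (s n x) y) \<longlonglongrightarrow> ip (T x) y" if "x \<in> V" "y \<in> V" for x y
    by (rule inner_tendsto) (use that T s lim in auto)
  obtain n0 where n0: "\<And>n x. n \<ge> n0 \<Longrightarrow> x \<in> V \<Longrightarrow> hdist H (s n x) (s n0 x) \<le> 1 * nrm x"
    using cauchy[of 1] by auto
  obtain C where C: "C \<ge> 0" "\<And>x. x \<in> V \<Longrightarrow> nrm (s n0 x) \<le> C * nrm x" using op_bound[OF s] by blast
  have "restrict T V \<in> B"
  proof (rule op_weakI[where C = "C + 1"])
    fix x y z assume x: "x \<in> V" and y: "y \<in> V" and z: "z \<in> V"
    have "(\<lambda>n. ip (s n x) z + ip (s n y) z) \<longlonglongrightarrow> ip (T x) z + ip (T y) z"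
      by (intro tendsto_add weak x y z)
    moreover have "(\<lambda>n. ip (s n x) z + ip (s n y) z) \<longlonglongrightarrow> ip (T (x \<boxplus> y)) z"
      using weak[of "x \<boxplus> y" z] s x y z by simp
    ultimately show "ip (restrict T V (x \<boxplus> y)) z = ip (restrict T V x) z + ip (restrict T V y) z"
      using LIMSEQ_unique x y by auto
  next
    fix c x z assume x: "x \<in> V" and z: "z \<in> V"
    have "(\<lambda>n. c * ip (s n x) z) \<longlonglongrightarrow> c * ip (T x) z"
      by (intro tendsto_mult_left weak x z)
    moreover have "(\<lambda>n. c * ip (s n x) z) \<longlonglongrightarrow> ip (T (c \<boxdot> x)) z"
      using weak[of "c \<boxdot> x" z] s x z by simp
    ultimately show "ip (restrict T V (c \<boxdot> x)) z = c * ip (restrict T V x) z"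
      using LIMSEQ_unique x by auto
  next
    fix x assume x: "x \<in> V"
    have "nrm (s n x) \<le> (C + 1) * nrm x" if "n \<ge> n0" for n
      using norm_dist_bound[of "s n x" "s n0 x"] n0[OF that x] C(2)[OF x] s x
      by (simp add: algebra_simps)
    moreover have "(\<lambda>n. nrm (s n x)) \<longlonglongrightarrow> nrm (T x)"
      by (rule norm_tendsto) (use T s x lim in auto)
    ultimately have "nrm (T x) \<le> (C + 1) * nrm x"
      by (intro LIMSEQ_le_const2) auto
    then show "nrm (restrict T V x) \<le> (C + 1) * nrm x" using x by simp
  qed (use T in auto)
  then have "strongly_converges s (restrict T V)"
    unfolding strongly_converges_def using s lim by simp
  then show ?thesis by blast
qed

lemma strong_limit_compose:
  assumes s: "strongly_converges s S" and t: "strongly_converges t T"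
    and C: "C \<ge> 0" "\<And>n x. x \<in> V \<Longrightarrow> nrm (s n x) \<le> C * nrm x"
  shows "strongly_converges (\<lambda>n. compose V (s n) (t n)) (compose V S T)"
  unfolding strongly_converges_def
proof (intro conjI allI ballI)
  note [simp] = strongly_convergesD(1,2)[OF s] strongly_convergesD(1,2)[OF t]
  show "compose V S T \<in> B" "compose V (s n) (t n) \<in> B" for n by simp_all
  fix x assume x: "x \<in> V"
  have le: "hdist H (s n (t n x)) (S (T x)) \<le> C * hdist H (t n x) (T x) + hdist H (s n (T x)) (S (T x))" for n
  proof -
    have "hdist H (s n (t n x)) (s n (T x)) \<le> C * hdist H (t n x) (T x)"
      using C(2)[of "t n x \<boxminus> T x" n] x by (simp add: dist_alt)
    then show ?thesis
      using dist_triangle[of "s n (t n x)" "s n (T x)" "S (T x)"] x by simp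
  qed
  have "(\<lambda>n. C * hdist H (t n x) (T x) + hdist H (s n (T x)) (S (T x))) \<longlonglongrightarrow> C * 0 + 0"
    using x by (intro tendsto_intros strongly_convergesD(3)[OF s] strongly_convergesD(3)[OF t]) simp_all
  then have "(\<lambda>n. hdist H (s n (t n x)) (S (T x))) \<longlonglongrightarrow> 0"
    by (rule_tac real_tendsto_sandwich[OF _ _ tendsto_const]) (use le x in simp_all)
  then show "(\<lambda>n. hdist H (compose V (s n) (t n) x) (compose V S T x)) \<longlonglongrightarrow> 0"
    using x by (simp add: compose_eq)
qed

end

section \<open>The representation of the Cuntz algebra\<close>

context cuntz
begin

primrec word_op :: "(nat \<times> bool) list \<Rightarrow> 'a \<Rightarrow> 'a" where
  "word_op [] = (\<lambda>x\<in>V. x)"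
| "word_op (l # w) = compose V (if snd l then R (fst l) else S (fst l)) (word_op w)"

definition free_rep :: "((nat \<times> bool) list \<Rightarrow> complex) \<Rightarrow> 'a \<Rightarrow> 'a" where
  "free_rep a = finsum A (\<lambda>w. a w \<odot>\<^bsub>A\<^esub> word_op w) (supp a)"

lemma word_op_closed [simp]: "w \<in> words N \<Longrightarrow> word_op w \<in> B"
  by (induction w) auto

lemma word_op_append: 
  "u \<in> words N \<Longrightarrow> v \<in> words N \<Longrightarrow> x \<in> V \<Longrightarrow> word_op (u @ v) x = word_op u (word_op v x)"
  by (induction u) (auto simp: compose_eq)

lemma word_op_flip:
  assumes "w \<in> words N" "x \<in> V" "y \<in> V"
  shows "ip (word_op w x) y = ip x (word_op (flip_word w) y)"
  using assms
proof (induction w arbitrary: x y rule: list.induct)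
  case (Cons l w)
  let ?L = "\<lambda>l. if snd l then R (fst l) else S (fst l)"
  have l': "l \<in> {1..N} \<times> UNIV" and w: "w \<in> words N"
    using Cons.prems(1) by (simp_all only: Cons_in_lists_iff)
  have l: "fst l \<in> {1..N}" using l' by (simp only: mem_Times_iff)
  have L: "?L l \<in> B" "?L (fst l, \<not> snd l) \<in> B" using l by auto
  have last: "word_op [(fst l, \<not> snd l)] y = ?L (fst l, \<not> snd l) y"
    using Cons.prems by (simp add: compose_eq)
  have "ip (word_op (l # w) x) y = ip (?L l (word_op w x)) y"
    using Cons.prems by (simp add: compose_eq)
  also have "\<dots> = ip (word_op w x) (?L (fst l, \<not> snd l) y)"
    using l w Cons.prems by (simp add: R_inner R_inner_left)
  also have "\<dots> = ip x (word_op (flip_word w) (?L (fst l, \<not> snd l) y))"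
    using Cons.IH[OF w Cons.prems(2) op_closed[OF L(2) Cons.prems(3)]] .
  also have "word_op (flip_word w) (?L (fst l, \<not> snd l) y) = word_op (flip_word (l # w)) y"
    using l w Cons.prems last by (simp add: word_op_append del: word_op.simps)
  finally show ?case .
qed simp

lemma free_carrierD: "a \<in> carrier (\<F> N) \<Longrightarrow> finite (supp a)" "a \<in> carrier (\<F> N) \<Longrightarrow> supp a \<subseteq> words N"
  by (simp_all add: free_sel(1))

lemma free_rep_closed [simp]: 
  assumes "a \<in> carrier (\<F> N)" shows "free_rep a \<in> B"
  unfolding free_rep_def
proof (rule finsum_op)
  fix w assume "w \<in> supp a"
  then show "a w \<odot>\<^bsub>A\<^esub> word_op w \<in> B"
    unfolding op_algebra_sel using free_carrierD(2)[OF assms] by (intro scale_op word_op_closed) blast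
qed (use free_carrierD assms in simp)

text \<open>The index set may be any finite superset of the support, so that several elements can be
  evaluated over a common one.\<close>

lemma free_rep_inner:
  assumes a: "a \<in> carrier (\<F> N)" and D: "finite D" "supp a \<subseteq> D" and xy: "x \<in> V" "y \<in> V"
  shows "ip (free_rep a x) y = (\<Sum>w\<in>D. a w * ip (word_op w x) y)"
proof -
  have mem: "word_op w \<in> B" if "w \<in> supp a" for w
    using free_carrierD(2)[OF a] that by (intro word_op_closed) blast
  have "ip (free_rep a x) y = (\<Sum>w\<in>supp a. ip ((a w \<odot>\<^bsub>A\<^esub> word_op w) x) y)"
    unfolding free_rep_def
    by (rule finsum_inner) (use free_carrierD(1)[OF a] mem scale_op xy in \<open>simp_all only: op_algebra_sel\<close>)
  also have "\<dots> = (\<Sum>w\<in>supp a. a w * ip (word_op w x) y)"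
    using mem xy by (intro sum.cong) auto
  also have "\<dots> = (\<Sum>w\<in>D. a w * ip (word_op w x) y)"
    using D by (intro sum.mono_neutral_left) (auto simp: supp_def)
  finally show ?thesis .
qed

lemma free_rep_monomial:
  assumes "w \<in> words N"
  shows "free_rep (monomial w) = word_op w"
proof (rule op_eqI)
  fix x y assume "x \<in> V" "y \<in> V"
  then show "ip (free_rep (monomial w) x) y = ip (word_op w x) y"
    using assms monomial_closed[OF assms]
    by (subst free_rep_inner[where D = "{w}"]) (simp_all add: supp_def, simp_all add: monomial_def)
qed (use assms in auto)

lemma free_rep_lin:
  assumes a: "a \<in> carrier (\<F> N)" and b: "b \<in> carrier (\<F> N)" and xy: "x \<in> V" "y \<in> V"
  shows "ip (free_rep (a \<oplus>\<^bsub>\<F> N\<^esub> b) x) y = ip (free_rep a x) y + ip (free_rep b x) y"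
    and "ip (free_rep (c \<odot>\<^bsub>\<F> N\<^esub> a) x) y = c * ip (free_rep a x) y"
    and "ip (free_rep (a \<ominus>\<^bsub>\<F> N\<^esub> b) x) y = ip (free_rep a x) y - ip (free_rep b x) y"
proof -
  let ?D = "supp a \<union> supp b"
  have D: "finite ?D" using free_carrierD a b by blast
  note eval = free_rep_inner[OF _ D _ xy]
  show "ip (free_rep (a \<oplus>\<^bsub>\<F> N\<^esub> b) x) y = ip (free_rep a x) y + ip (free_rep b x) y"
    using a b supp_free(1)[of N a b]
    by (simp add: eval) (simp add: free_sel(5) distrib_right sum.distrib)
  show "ip (free_rep (c \<odot>\<^bsub>\<F> N\<^esub> a) x) y = c * ip (free_rep a x) y"
    using a supp_free(2)[of N c a]
    by (simp add: eval le_supI1) (simp add: free_sel(6) sum_distrib_left mult.assoc)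
  have "supp (a \<ominus>\<^bsub>\<F> N\<^esub> b) \<subseteq> ?D" using a b by (auto simp: free_minus supp_def)
  then show "ip (free_rep (a \<ominus>\<^bsub>\<F> N\<^esub> b) x) y = ip (free_rep a x) y - ip (free_rep b x) y"
    using a b by (simp add: eval) (simp add: free_minus left_diff_distrib sum_subtractf)
qed

lemma free_rep_finsum:
  assumes "finite I" "\<And>i. i \<in> I \<Longrightarrow> f i \<in> carrier (\<F> N)" "x \<in> V" "y \<in> V"
  shows "ip (free_rep (finsum (\<F> N) f I) x) y = (\<Sum>i\<in>I. ip (free_rep (f i) x) y)"
  using assms(1,2)
proof (induction I)
  case empty
  interpret G: abelian_group "\<F> N" by (rule free_abelian_group)
  show ?case
    using assms(3,4) zero_free_closed[of N] by (subst free_rep_inner[where D = "{}"]) (auto simp: free_sel(4) supp_def)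
next
  case (insert i I)
  interpret G: abelian_group "\<F> N" by (rule free_abelian_group)
  have "finsum (\<F> N) f (insert i I) = f i \<oplus>\<^bsub>\<F> N\<^esub> finsum (\<F> N) f I"
    using insert by (intro G.finsum_insert) auto
  moreover have "f i \<in> carrier (\<F> N)" "finsum (\<F> N) f I \<in> carrier (\<F> N)"
    using insert free_finsum[of I f N] by blast+
  ultimately show ?case
    using insert assms(3,4) by (simp add: free_rep_lin)
qed

text \<open>The coefficient of \<open>w\<close> in a product sums over the splittings of \<open>w\<close>, and \<open>(u, v) \<mapsto> (u @ v, length u)\<close>
  is a bijection from pairs of words to split words.\<close>

lemma free_rep_mult:
  assumes a: "a \<in> carrier (\<F> N)" and b: "b \<in> carrier (\<F> N)" and xy: "x \<in> V"
  shows "free_rep (a \<otimes>\<^bsub>\<F> N\<^esub> b) x = free_rep a (free_rep b x)"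
proof (rule inner_ext)
  fix y assume y: "y \<in> V"
  define P where "P = supp a \<times> supp b"
  define D where "D = (\<lambda>(u, v). u @ v) ` P"
  define g where "g = (\<lambda>w. ip (word_op w x) y)"
  have fin: "finite P" "finite D"
    using free_carrierD a b by (auto simp: P_def D_def)
  have wd: "u \<in> words N" "v \<in> words N" if "(u, v) \<in> P" for u v
    using that free_carrierD(2)[OF a] free_carrierD(2)[OF b] by (auto simp: P_def)
  have "ip (free_rep (a \<otimes>\<^bsub>\<F> N\<^esub> b) x) y = (\<Sum>w\<in>D. (\<Sum>k\<le>length w. a (take k w) * b (drop k w)) * g w)"
  proof -
    have "ip (free_rep (a \<otimes>\<^bsub>\<F> N\<^esub> b) x) y = (\<Sum>w\<in>D. (a \<otimes>\<^bsub>\<F> N\<^esub> b) w * g w)"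
      unfolding g_def using a b xy y fin(2) supp_free(4)[of N a b]
      by (intro free_rep_inner) (simp_all add: P_def D_def)
    then show ?thesis by (simp only: free_sel(2))
  qed
  also have "\<dots> = (\<Sum>w\<in>D. \<Sum>k\<le>length w. a (take k w) * b (drop k w) * g w)"
    by (simp add: sum_distrib_right)
  also have "\<dots> = (\<Sum>(w, k)\<in>Sigma D (\<lambda>w. {..length w}). a (take k w) * b (drop k w) * g w)"
    using fin by (intro sum.Sigma) auto
  also have "\<dots> = (\<Sum>(u, v)\<in>P. a u * b v * g (u @ v))"
  proof -
    (* only splittings into words of the two supports contribute *)
    define Q where "Q = {(w, k) \<in> Sigma D (\<lambda>w. {..length w}). (take k w, drop k w) \<in> P}"
    have "(\<Sum>(w, k)\<in>Sigma D (\<lambda>w. {..length w}). a (take k w) * b (drop k w) * g w) =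
        (\<Sum>(w, k)\<in>Q. a (take k w) * b (drop k w) * g w)"
      using fin by (intro sum.mono_neutral_right) (auto simp: Q_def P_def supp_def)
    also have "\<dots> = (\<Sum>(u, v)\<in>P. a u * b v * g (u @ v))"
    proof (rule sum.reindex_bij_witness[where i = "\<lambda>(u, v). (u @ v, length u)" and
          j = "\<lambda>(w, k). (take k w, drop k w)"])
      fix p assume "p \<in> P"
      then show "(case p of (u, v) \<Rightarrow> (u @ v, length u)) \<in> Q"
        unfolding Q_def D_def by (auto split: prod.splits intro: rev_image_eqI)
    qed (auto simp: Q_def)
    finally show ?thesis .
  qed
  also have "\<dots> = (\<Sum>u\<in>supp a. \<Sum>v\<in>supp b. a u * b v * g (u @ v))"
    by (simp add: P_def sum.cartesian_product)
  also have "\<dots> = (\<Sum>u\<in>supp a. a u * ip (free_rep b x) (word_op (flip_word u) y))"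
  proof (intro sum.cong refl)
    fix u assume u: "u \<in> supp a"
    have uw: "u \<in> words N" using u free_carrierD(2)[OF a] by blast
    have "ip (free_rep b x) (word_op (flip_word u) y) =
        (\<Sum>v\<in>supp b. b v * ip (word_op v x) (word_op (flip_word u) y))"
      using b xy y uw free_carrierD(1)[OF b] by (intro free_rep_inner) auto
    also have "\<dots> = (\<Sum>v\<in>supp b. b v * g (u @ v))"
    proof (intro sum.cong refl)
      fix v assume v: "v \<in> supp b"
      have vw: "v \<in> words N" using v free_carrierD(2)[OF b] by blast
      show "b v * ip (word_op v x) (word_op (flip_word u) y) = b v * g (u @ v)"
        using uw vw xy y word_op_flip[of u "word_op v x" y] by (simp add: g_def word_op_append)
    qed
    finally show "(\<Sum>v\<in>supp b. a u * b v * g (u @ v)) = a u * ip (free_rep b x) (word_op (flip_word u) y)"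
      by (simp add: sum_distrib_left mult.assoc)
  qed
  also have "\<dots> = (\<Sum>u\<in>supp a. a u * ip (word_op u (free_rep b x)) y)"
  proof (intro sum.cong refl)
    fix u assume u: "u \<in> supp a"
    have uw: "u \<in> words N" using u free_carrierD(2)[OF a] by blast
    show "a u * ip (free_rep b x) (word_op (flip_word u) y) = a u * ip (word_op u (free_rep b x)) y"
      using word_op_flip[OF uw, of "free_rep b x" y] b xy y by simp
  qed
  also have "\<dots> = ip (free_rep a (free_rep b x)) y"
    using a b xy y free_carrierD(1)[OF a] by (intro free_rep_inner[symmetric]) auto
  finally show "ip (free_rep (a \<otimes>\<^bsub>\<F> N\<^esub> b) x) y = ip (free_rep a (free_rep b x)) y" .
qed (use a b xy in auto)

lemma free_rep_star:
  assumes a: "a \<in> carrier (\<F> N)"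
  shows "free_rep (star (\<F> N) a) = adjoint_op H (free_rep a)"
proof (rule adjoint_eqI[symmetric])
  fix x y assume x: "x \<in> V" and y: "y \<in> V"
  have "ip (free_rep (star (\<F> N) a) y) x =
      (\<Sum>w\<in>flip_word ` supp a. star (\<F> N) a w * ip (word_op w y) x)"
    using a x y free_carrierD(1)[OF a] by (intro free_rep_inner) (auto simp: supp_free(3))
  also have "\<dots> = (\<Sum>v\<in>supp a. cnj (a v) * ip (word_op (flip_word v) y) x)"
    by (subst sum.reindex) (auto simp: free_sel(7) inj_on_def flip_word_eq_iff)
  also have "\<dots> = (\<Sum>v\<in>supp a. cnj (a v * ip (word_op v x) y))"
  proof (intro sum.cong refl)
    fix v assume "v \<in> supp a"
    then have v: "v \<in> words N" using free_carrierD(2)[OF a] by blast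
    then show "cnj (a v) * ip (word_op (flip_word v) y) x = cnj (a v * ip (word_op v x) y)"
      using word_op_flip[OF v x y] inner_commute[of "word_op (flip_word v) y" x] x y by simp
  qed
  also have "\<dots> = cnj (ip (free_rep a x) y)"
    using a x y free_carrierD(1)[OF a] by (simp add: free_rep_inner[where D = "supp a"])
  finally show "ip (free_rep a x) y = ip x (free_rep (star (\<F> N) a) y)"
    using inner_commute[of x "free_rep (star (\<F> N) a) y"] a x y by simp
qed (use a in auto)

lemma free_rep_gen: "i \<in> {1..N} \<Longrightarrow> free_rep (free_gen i) = S i"
  by (rule op_eqI) (auto simp: free_sel(8) free_rep_monomial compose_eq)

lemma free_rep_one: "x \<in> V \<Longrightarrow> free_rep \<one>\<^bsub>\<F> N\<^esub> x = x"
  by (simp add: free_sel(3) free_rep_monomial)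

text \<open>The representation of the free algebra satisfies the Cuntz relations, so its operator norm
  takes part in the supremum that defines the universal seminorm.\<close>

lemma free_rep_seminorm: "(\<lambda>a. opnorm (free_rep a)) \<in> cuntz_seminorms N"
proof -
  have hom: "free_rep (star (\<F> N) a \<otimes>\<^bsub>\<F> N\<^esub> a) = star A (free_rep a) \<otimes>\<^bsub>A\<^esub> free_rep a"
      "free_rep (a \<otimes>\<^bsub>\<F> N\<^esub> b) = free_rep a \<otimes>\<^bsub>A\<^esub> free_rep b"
      "free_rep (a \<oplus>\<^bsub>\<F> N\<^esub> b) = free_rep a \<oplus>\<^bsub>A\<^esub> free_rep b"
      "free_rep (c \<odot>\<^bsub>\<F> N\<^esub> a) = c \<odot>\<^bsub>A\<^esub> free_rep a"
    if "a \<in> carrier (\<F> N)" "b \<in> carrier (\<F> N)" for a b c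
    using that unfolding op_algebra_sel
    by (auto intro!: op_eqI[OF free_rep_closed add_op] op_eqI[OF free_rep_closed scale_op]
        op_eqI[OF free_rep_closed compose_op] simp: free_rep_mult free_rep_lin free_rep_star compose_eq)
  have cs: "cstar_seminorm (\<F> N) (\<lambda>a. opnorm (free_rep a))"
    unfolding cstar_seminorm_def
    using hom opnorm_scale opnorm_cstar opnorm_nonneg opnorm_add opnorm_mult
    by (simp del: op_algebra_sel free_closed_simps add: hom(1)[OF _ zero_free_closed] hom(4)[OF _ zero_free_closed])
  have zero: "opnorm (free_rep r) = 0" if "r \<in> carrier (\<F> N)" "\<And>x y. x \<in> V \<Longrightarrow> y \<in> V \<Longrightarrow> ip (free_rep r x) y = 0" for r
  proof -
    have "free_rep r x = hzero H" if "x \<in> V" for x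
      by (rule inner_ext) (use that \<open>r \<in> carrier (\<F> N)\<close> \<open>\<And>x y. x \<in> V \<Longrightarrow> y \<in> V \<Longrightarrow> ip (free_rep r x) y = 0\<close> in auto)
    then have "opnorm (free_rep r) \<le> 0" by (intro opnorm_least) auto
    then show ?thesis using opnorm_nonneg[OF free_rep_closed[OF that(1)]] by simp
  qed
  have "opnorm (free_rep r) = 0" if r: "r \<in> cuntz_relations N" for r
  proof -
    consider i j where "i \<in> {1..N}" "j \<in> {1..N}"
        "r = star (\<F> N) (free_gen i) \<otimes>\<^bsub>\<F> N\<^esub> free_gen j \<ominus>\<^bsub>\<F> N\<^esub> (if i = j then \<one>\<^bsub>\<F> N\<^esub> else \<zero>\<^bsub>\<F> N\<^esub>)"
      | "r = (\<Oplus>\<^bsub>\<F> N\<^esub>i\<in>{1..N}. free_gen i \<otimes>\<^bsub>\<F> N\<^esub> star (\<F> N) (free_gen i)) \<ominus>\<^bsub>\<F> N\<^esub> \<one>\<^bsub>\<F> N\<^esub>"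
      using r unfolding cuntz_relations_def Let_def by blast
    then show ?thesis
    proof cases
      case 1
      have z: "ip (free_rep \<zero>\<^bsub>\<F> N\<^esub> x) y = 0" if "x \<in> V" "y \<in> V" for x y
        using free_rep_finsum[of "{}" "\<lambda>_. \<zero>\<^bsub>\<F> N\<^esub>" x y] that free_abelian_group[of N]
        by (simp add: abelian_monoid.finsum_empty[OF abelian_group.axioms(1)])
      show ?thesis
      proof (rule zero)
        show "r \<in> carrier (\<F> N)" using 1 by (simp split: if_splits)
        fix x y assume xy: "x \<in> V" "y \<in> V"
        have mem: "(if i = j then \<one>\<^bsub>\<F> N\<^esub> else \<zero>\<^bsub>\<F> N\<^esub>) \<in> carrier (\<F> N)" by simp
        show "ip (free_rep r x) y = 0"
          unfolding 1(3) using 1(1,2) xy mem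
          by (subst free_rep_lin(3)) (auto simp: free_rep_mult free_rep_star free_rep_gen R_S free_rep_one z)
      qed
    next
      case 2
      have mem: "free_gen i \<otimes>\<^bsub>\<F> N\<^esub> star (\<F> N) (free_gen i) \<in> carrier (\<F> N)" if "i \<in> {1..N}" for i
        using that by simp
      have sum: "(\<Oplus>\<^bsub>\<F> N\<^esub>i\<in>{1..N}. free_gen i \<otimes>\<^bsub>\<F> N\<^esub> star (\<F> N) (free_gen i)) \<in> carrier (\<F> N)"
        using free_finsum[of "{1..N}" "\<lambda>i. free_gen i \<otimes>\<^bsub>\<F> N\<^esub> star (\<F> N) (free_gen i)" N] mem by blast
      show ?thesis
      proof (rule zero)
        show "r \<in> carrier (\<F> N)" unfolding 2 using sum by simp
        fix x y assume xy: "x \<in> V" "y \<in> V"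
        have "ip (free_rep (\<Oplus>\<^bsub>\<F> N\<^esub>i\<in>{1..N}. free_gen i \<otimes>\<^bsub>\<F> N\<^esub> star (\<F> N) (free_gen i)) x) y =
            (\<Sum>i\<in>{1..N}. ip (R i x) (R i y))"
          by (subst free_rep_finsum[OF _ mem xy])
             (auto intro!: sum.cong simp: free_rep_mult free_rep_star free_rep_gen R_inner xy)
        then show "ip (free_rep r x) y = 0"
          unfolding 2 using xy sum by (simp add: free_rep_lin(3) free_rep_one sum_R_inner del: One_nat_def)
      qed
    qed
  qed
  then show ?thesis using cs by (simp add: cuntz_seminorms_def)
qed

lemma free_rep_bound:
  assumes a: "a \<in> carrier (\<F> N)" and x: "x \<in> V"
  shows "nrm (free_rep a x) \<le> qnorm N a * nrm x"
proof -
  have "nrm (free_rep a x) \<le> opnorm (free_rep a) * nrm x"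
    using a x by (intro opnorm_bound) auto
  also have "\<dots> \<le> qnorm N a * nrm x"
    using seminorm_le_qnorm[OF free_rep_seminorm a] x by (intro mult_right_mono) auto
  finally show ?thesis .
qed

lemma free_rep_dist:
  assumes a: "a \<in> carrier (\<F> N)" and b: "b \<in> carrier (\<F> N)" and x: "x \<in> V"
  shows "hdist H (free_rep a x) (free_rep b x) \<le> qnorm N (a \<ominus>\<^bsub>\<F> N\<^esub> b) * nrm x"
proof -
  have "free_rep a x \<boxminus> free_rep b x = free_rep (a \<ominus>\<^bsub>\<F> N\<^esub> b) x"
    by (rule inner_ext) (use a b x in \<open>auto simp: free_rep_lin(3)\<close>)
  then show ?thesis
    using free_rep_bound[of "a \<ominus>\<^bsub>\<F> N\<^esub> b" x] a b x by (simp add: dist_alt)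
qed

definition limit_op :: "(nat \<Rightarrow> (nat \<times> bool) list \<Rightarrow> complex) \<Rightarrow> 'a \<Rightarrow> 'a" where
  "limit_op a = (SOME T. strongly_converges (\<lambda>n. free_rep (a n)) T)"

lemma limit_op_converges:
  assumes a: "a \<in> cauchy N"
  shows "strongly_converges (\<lambda>n. free_rep (a n)) (limit_op a)"
  unfolding limit_op_def
proof (rule someI_ex[where P = "strongly_converges (\<lambda>n. free_rep (a n))"], rule strong_limit_exists)
  show "free_rep (a n) \<in> B" for n using a by simp
  fix e :: real assume "e > 0"
  then obtain n0 where n0: "\<And>m n. m \<ge> n0 \<Longrightarrow> n \<ge> n0 \<Longrightarrow> qnorm N (a m \<ominus>\<^bsub>\<F> N\<^esub> a n) < e"
    using cauchyD[OF a] by blast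
  show "\<exists>n0. \<forall>m\<ge>n0. \<forall>n\<ge>n0. \<forall>x\<in>V. hdist H (free_rep (a m) x) (free_rep (a n) x) \<le> e * nrm x"
  proof (intro exI allI impI ballI)
    fix m n x assume "m \<ge> n0" "n \<ge> n0" and x: "x \<in> V"
    then have "qnorm N (a m \<ominus>\<^bsub>\<F> N\<^esub> a n) * nrm x \<le> e * nrm x"
      using n0[of m n] by (intro mult_right_mono) auto
    then show "hdist H (free_rep (a m) x) (free_rep (a n) x) \<le> e * nrm x"
      using free_rep_dist[of "a m" "a n" x] a x by simp
  qed
qed

lemma limit_op_closed [simp]: "a \<in> cauchy N \<Longrightarrow> limit_op a \<in> B"
  using strongly_convergesD(1)[OF limit_op_converges] .

lemma limit_op_weak:
  assumes "a \<in> cauchy N" "x \<in> V" "y \<in> V"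
  shows "(\<lambda>n. ip (free_rep (a n) x) y) \<longlonglongrightarrow> ip (limit_op a x) y"
  by (rule strong_imp_weak[OF limit_op_converges]) (use assms in auto)

lemma limit_op_eqI:
  assumes a: "a \<in> cauchy N" and "T \<in> B"
    and "\<And>x y. x \<in> V \<Longrightarrow> y \<in> V \<Longrightarrow> (\<lambda>n. ip (free_rep (a n) x) y) \<longlonglongrightarrow> ip (T x) y"
  shows "limit_op a = T"
  using weak_limit_eq[OF limit_op_converges[OF a] assms(2,3)] by simp

text \<open>Sequences in one class differ by a null sequence for the universal seminorm, hence by null
  sequences in all matrix coefficients.\<close>

lemma limit_op_rep:
  assumes a: "a \<in> cauchy N"
  shows "limit_op (rep (cl N a)) = limit_op a"
proof (rule limit_op_eqI)
  note r = rep_class[OF a]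
  show "rep (cl N a) \<in> cauchy N" "limit_op a \<in> B" using r a by auto
  fix x y assume x: "x \<in> V" and y: "y \<in> V"
  have "(\<lambda>n. ip (free_rep (rep (cl N a) n) x) y - ip (free_rep (a n) x) y) \<longlonglongrightarrow> 0"
  proof (rule Lim_null_comparison)
    show "(\<lambda>n. qnorm N (rep (cl N a) n \<ominus>\<^bsub>\<F> N\<^esub> a n) * (nrm x * nrm y)) \<longlonglongrightarrow> 0"
      using tendsto_mult_right[OF r(2), of "nrm x * nrm y"] by simp
    have "norm (ip (free_rep (rep (cl N a) n) x) y - ip (free_rep (a n) x) y)
        \<le> qnorm N (rep (cl N a) n \<ominus>\<^bsub>\<F> N\<^esub> a n) * (nrm x * nrm y)" for n
    proof -
      have "norm (ip (free_rep (rep (cl N a) n) x) y - ip (free_rep (a n) x) y)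
          \<le> hdist H (free_rep (rep (cl N a) n) x) (free_rep (a n) x) * nrm y"
        using r(1) a x y by (intro inner_dist_bound) auto
      also have "\<dots> \<le> (qnorm N (rep (cl N a) n \<ominus>\<^bsub>\<F> N\<^esub> a n) * nrm x) * nrm y"
        using r(1) a x y by (intro mult_right_mono free_rep_dist) auto
      finally show ?thesis by (simp only: mult_ac)
    qed
    then show "\<forall>\<^sub>F n in sequentially. norm (ip (free_rep (rep (cl N a) n) x) y - ip (free_rep (a n) x) y)
        \<le> qnorm N (rep (cl N a) n \<ominus>\<^bsub>\<F> N\<^esub> a n) * (nrm x * nrm y)" by simp
  qed
  from tendsto_add[OF this limit_op_weak[OF a x y]]
  show "(\<lambda>n. ip (free_rep (rep (cl N a) n) x) y) \<longlonglongrightarrow> ip (limit_op a x) y" by simp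
qed

text \<open>
  The representation of the free algebra is contractive for the universal seminorm, so it extends
  to the completion by limits. The algebraic operations pass to the limit: sums, multiples and
  adjoints through matrix coefficients, products because the factors converge strongly and are
  uniformly bounded.
\<close>

theorem cuntz_rep_exists: "\<exists>\<pi>. cuntz_rep N H S \<pi>"
proof -
  define \<pi> where "\<pi> = (\<lambda>x. limit_op (rep x))"
  have \<pi>_cl: "\<pi> (cl N a) = limit_op a" if "a \<in> cauchy N" for a
    using limit_op_rep[OF that] by (simp add: \<pi>_def)
  have \<pi>_closed [simp]: "\<pi> x \<in> B" if "x \<in> carrier (\<O> N)" for x
    using rep_cauchy[OF that] by (simp add: \<pi>_def)
  have mult: "\<pi> (x \<otimes>\<^bsub>\<O> N\<^esub> y) = compose V (\<pi> x) (\<pi> y)"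
    if x: "x \<in> carrier (\<O> N)" and y: "y \<in> carrier (\<O> N)" for x y
  proof -
    note a = rep_cauchy[OF x] and b = rep_cauchy[OF y]
    obtain C where C: "C > 0" "\<And>n. qnorm N (rep x n) \<le> C" using cauchy_bounded[OF a] by blast
    have bd: "nrm (free_rep (rep x n) u) \<le> C * nrm u" if "u \<in> V" for n u
    proof -
      have "nrm (free_rep (rep x n) u) \<le> qnorm N (rep x n) * nrm u"
        using a that by (intro free_rep_bound) auto
      also have "\<dots> \<le> C * nrm u" using C that by (intro mult_right_mono) auto
      finally show ?thesis .
    qed
    have lim: "strongly_converges (\<lambda>n. compose V (free_rep (rep x n)) (free_rep (rep y n)))
        (compose V (limit_op (rep x)) (limit_op (rep y)))"
      using C bd by (intro strong_limit_compose[OF limit_op_converges[OF a] limit_op_converges[OF b], of C]) auto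
    have "limit_op (\<lambda>n. rep x n \<otimes>\<^bsub>\<F> N\<^esub> rep y n) = compose V (limit_op (rep x)) (limit_op (rep y))"
    proof (rule limit_op_eqI[OF cauchy_mult[OF a b]])
      fix u v assume uv: "u \<in> V" "v \<in> V"
      show "(\<lambda>n. ip (free_rep (rep x n \<otimes>\<^bsub>\<F> N\<^esub> rep y n) u) v) \<longlonglongrightarrow>
          ip (compose V (limit_op (rep x)) (limit_op (rep y)) u) v"
        using strong_imp_weak[OF lim uv] a b uv by (simp add: free_rep_mult compose_eq)
    qed (use a b in simp)
    then show ?thesis
      using \<pi>_cl[OF cauchy_mult[OF a b]] by (simp add: cuntz_algebra_sel(2) \<pi>_def)
  qed
  have add: "\<pi> (x \<oplus>\<^bsub>\<O> N\<^esub> y) = (\<lambda>u\<in>V. \<pi> x u \<boxplus> \<pi> y u)"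
    if x: "x \<in> carrier (\<O> N)" and y: "y \<in> carrier (\<O> N)" for x y
  proof -
    note a = rep_cauchy[OF x] and b = rep_cauchy[OF y]
    have "limit_op (\<lambda>n. rep x n \<oplus>\<^bsub>\<F> N\<^esub> rep y n) = (\<lambda>u\<in>V. \<pi> x u \<boxplus> \<pi> y u)"
    proof (rule limit_op_eqI[OF cauchy_add[OF a b] add_op])
      fix u v assume uv: "u \<in> V" "v \<in> V"
      show "(\<lambda>n. ip (free_rep (rep x n \<oplus>\<^bsub>\<F> N\<^esub> rep y n) u) v) \<longlonglongrightarrow> ip ((\<lambda>u\<in>V. \<pi> x u \<boxplus> \<pi> y u) u) v"
        using tendsto_add[OF limit_op_weak[OF a uv] limit_op_weak[OF b uv]] a b uv x y
        by (simp add: free_rep_lin) (simp add: \<pi>_def)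
    qed (use x y in simp_all)
    then show ?thesis
      using \<pi>_cl[OF cauchy_add[OF a b]] by (simp add: cuntz_algebra_sel(4))
  qed
  have scale: "\<pi> (c \<odot>\<^bsub>\<O> N\<^esub> x) = (\<lambda>u\<in>V. c \<boxdot> \<pi> x u)" if x: "x \<in> carrier (\<O> N)" for c x
  proof -
    note a = rep_cauchy[OF x]
    have "limit_op (\<lambda>n. c \<odot>\<^bsub>\<F> N\<^esub> rep x n) = (\<lambda>u\<in>V. c \<boxdot> \<pi> x u)"
    proof (rule limit_op_eqI[OF cauchy_scale[OF a] scale_op])
      fix u v assume uv: "u \<in> V" "v \<in> V"
      show "(\<lambda>n. ip (free_rep (c \<odot>\<^bsub>\<F> N\<^esub> rep x n) u) v) \<longlonglongrightarrow> ip ((\<lambda>u\<in>V. c \<boxdot> \<pi> x u) u) v"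
        using tendsto_mult_left[OF limit_op_weak[OF a uv], of c] a uv x
        by (simp add: free_rep_lin(2)[OF _ zero_free_closed]) (simp add: \<pi>_def)
    qed (use x in simp)
    then show ?thesis
      using \<pi>_cl[OF cauchy_scale[OF a]] by (simp add: cuntz_algebra_sel(5))
  qed
  have star: "\<pi> (star (\<O> N) x) = adjoint_op H (\<pi> x)" if x: "x \<in> carrier (\<O> N)" for x
  proof -
    note a = rep_cauchy[OF x]
    have "limit_op (\<lambda>n. star (\<F> N) (rep x n)) = adjoint_op H (\<pi> x)"
    proof (rule limit_op_eqI[OF cauchy_star[OF a]])
      fix u v assume u: "u \<in> V" and v: "v \<in> V"
      have "(\<lambda>n. cnj (ip (free_rep (rep x n) v) u)) \<longlonglongrightarrow> cnj (ip (limit_op (rep x) v) u)"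
        by (intro tendsto_cnj limit_op_weak a u v)
      moreover have "cnj (ip (free_rep (rep x n) v) u) = ip (free_rep (star (\<F> N) (rep x n)) u) v" for n
        using a u v inner_commute[of u "free_rep (rep x n) v"] by (simp add: free_rep_star adjoint_inner_left)
      moreover have "cnj (ip (limit_op (rep x) v) u) = ip (adjoint_op H (\<pi> x) u) v"
        using x a u v inner_commute[of u "limit_op (rep x) v"] by (simp add: adjoint_inner_left) (simp add: \<pi>_def)
      ultimately show "(\<lambda>n. ip (free_rep (star (\<F> N) (rep x n)) u) v) \<longlonglongrightarrow> ip (adjoint_op H (\<pi> x) u) v"
        by simp
    qed (use x in simp)
    then show ?thesis
      using \<pi>_cl[OF cauchy_star[OF a]] by (simp add: cuntz_algebra_sel(6))
  qed
  have const: "\<pi> (cl N (\<lambda>n. a)) = free_rep a" if "a \<in> carrier (\<F> N)" for a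
    using that \<pi>_cl[of "\<lambda>n. a"] limit_op_eqI[of "\<lambda>n. a" "free_rep a"] by simp
  have "free_rep \<one>\<^bsub>\<F> N\<^esub> = (\<lambda>u\<in>V. u)"
    by (rule op_eqI) (auto simp: free_rep_one)
  then have one: "\<pi> \<one>\<^bsub>\<O> N\<^esub> = (\<lambda>u\<in>V. u)"
    using const[of "\<one>\<^bsub>\<F> N\<^esub>"] by (simp add: cuntz_algebra_sel(3))
  have "\<pi> (cuntz_gen N i) = S i" if "i \<in> {1..N}" for i
    using const[of "free_gen i"] that by (simp add: cuntz_gen_def free_rep_gen)
  then have "cuntz_rep N H S \<pi>"
    unfolding cuntz_rep_def star_hom_def ring_hom_def
    using mult add scale star one by (simp add: Pi_iff)
  then show ?thesis by blast
qed

theorem cuntz_rep_irreducible: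
  assumes erg: "ergodic_endo A \<alpha>" and nz: "V \<noteq> {hzero H}" and rep: "cuntz_rep N H S \<pi>"
  shows "irreducible_rep (cuntz_algebra N) H \<pi>"
  unfolding irreducible_rep_def
proof (intro conjI nz allI impI)
  fix K assume "closed_subspace H K \<and> (\<forall>a\<in>carrier (cuntz_algebra N). \<pi> a ` K \<subseteq> K)"
  then have K: "closed_subspace H K" and inv: "\<And>a x. a \<in> carrier (\<O> N) \<Longrightarrow> x \<in> K \<Longrightarrow> \<pi> a x \<in> K"
    by blast+
  have gen: "\<pi> (cuntz_gen N i) = S i" if "i \<in> {1..N}" for i
    using rep that by (simp add: cuntz_rep_def)
  have gen_star: "\<pi> (star (\<O> N) (cuntz_gen N i)) = R i" if "i \<in> {1..N}" for i
    using rep that cuntz_gen_closed[OF that] gen[OF that] by (simp add: cuntz_rep_def star_hom_def)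
  show "K = {hzero H} \<or> K = V"
    using inv[OF cuntz_gen_closed] inv[OF cuntz_star_closed[OF cuntz_gen_closed]]
    by (intro ergodic_imp_irreducible[OF erg K]) (simp_all add: gen gen_star)
qed

end

section \<open>Completeness of the space of square integrable functions\<close>

lemma L2_class_self: "f \<in> L2_fun M \<Longrightarrow> f \<in> L2_class M f"
  by (simp add: L2_class_def)

lemma rep_L2:
  assumes "f \<in> L2_fun M"
  shows "rep (L2_class M f) \<in> L2_fun M" "AE x in M. rep (L2_class M f) x = f x"
proof -
  have "rep (L2_class M f) \<in> L2_class M f"
    unfolding rep_def using L2_class_self[OF assms] by (rule someI[where P = "\<lambda>g. g \<in> L2_class M f"])
  then show "rep (L2_class M f) \<in> L2_fun M" "AE x in M. rep (L2_class M f) x = f x"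
    by (auto simp: L2_class_def)
qed

lemma L2_class_cong:
  assumes "AE x in M. f x = g x"
  shows "L2_class M f = L2_class M g"
proof -
  have "(AE x in M. h x = f x) \<longleftrightarrow> (AE x in M. h x = g x)" for h :: "'a \<Rightarrow> complex"
    using assms by (auto elim: eventually_elim2)
  then show ?thesis by (simp add: L2_class_def)
qed

lemma L2_class_eqD:
  assumes "L2_class M f = L2_class M g" "f \<in> L2_fun M"
  shows "AE x in M. f x = g x"
  using L2_class_self[OF assms(2)] assms(1) by (auto simp: L2_class_def)

lemma L2_measurable [measurable_dest]: "f \<in> L2_fun M \<Longrightarrow> f \<in> borel_measurable M"
  by (simp add: L2_fun_def)

lemma L2_integrable: "f \<in> L2_fun M \<Longrightarrow> integrable M (\<lambda>x. (cmod (f x))\<^sup>2)"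
  by (simp add: L2_fun_def)

lemma L2_funI_bound:
  assumes [measurable]: "f \<in> borel_measurable M" and "integrable M h" "AE x in M. (cmod (f x))\<^sup>2 \<le> h x"
  shows "f \<in> L2_fun M"
  unfolding L2_fun_def
proof (intro CollectI conjI)
  show "integrable M (\<lambda>x. (cmod (f x))\<^sup>2)"
    by (rule Bochner_Integration.integrable_bound[OF assms(2)])
       (use assms(3) in \<open>auto elim!: eventually_mono\<close>)
qed simp

lemma cmod_add_sq: "(cmod (a + b))\<^sup>2 \<le> 2 * (cmod a)\<^sup>2 + 2 * (cmod b)\<^sup>2"
proof -
  have "(cmod (a + b))\<^sup>2 \<le> (cmod a + cmod b)\<^sup>2"
    by (intro power_mono norm_triangle_ineq) simp
  also have "\<dots> \<le> 2 * (cmod a)\<^sup>2 + 2 * (cmod b)\<^sup>2"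
    using sum_squares_bound[of "cmod a" "cmod b"] by (simp add: power2_sum)
  finally show ?thesis .
qed

lemma L2_add [simp]: "f \<in> L2_fun M \<Longrightarrow> g \<in> L2_fun M \<Longrightarrow> (\<lambda>x. f x + g x) \<in> L2_fun M"
  by (rule L2_funI_bound[where h = "\<lambda>x. 2 * (cmod (f x))\<^sup>2 + 2 * (cmod (g x))\<^sup>2"])
     (auto simp: L2_fun_def cmod_add_sq)

lemma L2_mult_bounded:
  assumes f: "f \<in> L2_fun M" and [measurable]: "h \<in> borel_measurable M" and b: "AE x in M. cmod (h x) \<le> C"
  shows "(\<lambda>x. h x * f x) \<in> L2_fun M"
proof (rule L2_funI_bound[where h = "\<lambda>x. C\<^sup>2 * (cmod (f x))\<^sup>2"])
  note L2_measurable[OF f, measurable]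
  show "(\<lambda>x. h x * f x) \<in> borel_measurable M" by measurable
  show "AE x in M. (cmod (h x * f x))\<^sup>2 \<le> C\<^sup>2 * (cmod (f x))\<^sup>2"
    using b by (auto elim!: eventually_mono simp: norm_mult power_mult_distrib intro!: mult_right_mono power_mono)
qed (use L2_integrable[OF f] in simp)

lemma L2_scale [simp]: "f \<in> L2_fun M \<Longrightarrow> (\<lambda>x. c * f x) \<in> L2_fun M"
  by (rule L2_mult_bounded[where C = "cmod c"]) auto

lemma L2_diff [simp]: "f \<in> L2_fun M \<Longrightarrow> g \<in> L2_fun M \<Longrightarrow> (\<lambda>x. f x - g x) \<in> L2_fun M"
  using L2_add[of f M "\<lambda>x. (-1) * g x"] L2_scale[of g M "-1"] by simp

lemma L2_zero [simp]: "(\<lambda>x. 0) \<in> L2_fun M"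
  by (simp add: L2_fun_def)

lemma cnj_measurable [measurable]: "cnj \<in> borel_measurable borel"
  by (intro borel_measurable_continuous_onI continuous_intros)

lemma L2_integrable_mult:
  assumes f: "f \<in> L2_fun M" and g: "g \<in> L2_fun M"
  shows "integrable M (\<lambda>x. f x * cnj (g x))"
proof (rule Bochner_Integration.integrable_bound)
  show "integrable M (\<lambda>x. (cmod (f x))\<^sup>2 + (cmod (g x))\<^sup>2)"
    using f g by (simp add: L2_integrable)
  show "(\<lambda>x. f x * cnj (g x)) \<in> borel_measurable M"
    using L2_measurable[OF f, measurable] L2_measurable[OF g, measurable] by measurable
  have "cmod a * cmod b \<le> (cmod a)\<^sup>2 + (cmod b)\<^sup>2" for a b
  proof -
    have "0 \<le> cmod a * cmod b" by simp
    moreover have "2 * (cmod a * cmod b) \<le> (cmod a)\<^sup>2 + (cmod b)\<^sup>2"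
      using sum_squares_bound[of "cmod a" "cmod b"] by (simp add: mult.assoc)
    ultimately show ?thesis by linarith
  qed
  then show "AE x in M. norm (f x * cnj (g x)) \<le> norm ((cmod (f x))\<^sup>2 + (cmod (g x))\<^sup>2)"
    by (simp add: norm_mult)
qed

lemma L2_carrier: "hcarrier (L2 M) = L2_class M ` L2_fun M"
  by (simp add: L2_def)

lemma L2_class_closed [simp]: "f \<in> L2_fun M \<Longrightarrow> L2_class M f \<in> hcarrier (L2 M)"
  by (simp add: L2_carrier)

lemma L2_cases:
  assumes "x \<in> hcarrier (L2 M)"
  obtains f where "f \<in> L2_fun M" "x = L2_class M f"
  using assms by (auto simp: L2_carrier)

lemma rep_carrier:
  assumes "x \<in> hcarrier (L2 M)"
  shows "rep x \<in> L2_fun M" "L2_class M (rep x) = x"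
  using assms by (auto elim!: L2_cases intro!: rep_L2 L2_class_cong)

lemma L2_hadd: 
  assumes "f \<in> L2_fun M" "g \<in> L2_fun M"
  shows "hadd (L2 M) (L2_class M f) (L2_class M g) = L2_class M (\<lambda>x. f x + g x)"
  using rep_L2(2)[OF assms(1)] rep_L2(2)[OF assms(2)]
  by (auto simp: L2_def intro!: L2_class_cong elim: eventually_elim2)

lemma L2_hscale:
  assumes "f \<in> L2_fun M"
  shows "hscale (L2 M) c (L2_class M f) = L2_class M (\<lambda>x. c * f x)"
  using rep_L2(2)[OF assms]
  by (auto simp: L2_def intro!: L2_class_cong elim: eventually_mono)

lemma L2_hzero: "hzero (L2 M) = L2_class M (\<lambda>x. 0)"
  by (simp add: L2_def)

lemma L2_hinner:
  assumes f: "f \<in> L2_fun M" and g: "g \<in> L2_fun M"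
  shows "hinner (L2 M) (L2_class M f) (L2_class M g) = (\<integral>x. f x * cnj (g x) \<partial>M)"
proof -
  note [measurable] = L2_measurable[OF f] L2_measurable[OF g]
    L2_measurable[OF rep_L2(1)[OF f]] L2_measurable[OF rep_L2(1)[OF g]]
  have "(\<integral>x. rep (L2_class M f) x * cnj (rep (L2_class M g) x) \<partial>M) = (\<integral>x. f x * cnj (g x) \<partial>M)"
  proof (rule integral_cong_AE)
    show "AE x in M. rep (L2_class M f) x * cnj (rep (L2_class M g) x) = f x * cnj (g x)"
      using rep_L2(2)[OF f] rep_L2(2)[OF g] by eventually_elim simp
  qed (use L2_integrable_mult f g rep_L2(1) in \<open>blast intro: borel_measurable_integrable\<close>)+
  then show ?thesis by (simp add: L2_def)
qed

lemma L2_hnorm: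
  assumes f: "f \<in> L2_fun M"
  shows "hnorm (L2 M) (L2_class M f) = sqrt (\<integral>x. (cmod (f x))\<^sup>2 \<partial>M)"
proof -
  have "(\<integral>x. f x * cnj (f x) \<partial>M) = (\<integral>x. complex_of_real ((cmod (f x))\<^sup>2) \<partial>M)"
    by (simp only: complex_norm_square)
  also have "\<dots> = complex_of_real (\<integral>x. (cmod (f x))\<^sup>2 \<partial>M)"
    by (rule integral_complex_of_real)
  finally show ?thesis
    using f by (simp add: hnorm_def L2_hinner)
qed

lemma L2_hdist:
  assumes f: "f \<in> L2_fun M" and g: "g \<in> L2_fun M"
  shows "hdist (L2 M) (L2_class M f) (L2_class M g) = sqrt (\<integral>x. (cmod (f x - g x))\<^sup>2 \<partial>M)"
  using f g L2_hnorm[of "\<lambda>x. f x - g x" M] L2_scale[OF g, of "-1"]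
  by (simp add: hdist_def L2_hscale L2_hadd)

context prob_space
begin

lemma L2_const [simp]: "(\<lambda>x. c) \<in> L2_fun M"
  by (simp add: L2_fun_def)

lemma L2_imp_integrable: 
  assumes "f \<in> L2_fun M" shows "integrable M f"
  using L2_integrable_mult[OF assms L2_const[of 1]] by simp

text \<open>
  A sequence that is Cauchy in \<open>L\<^sup>2\<close> is Cauchy in \<open>L\<^sup>1\<close>, so a subsequence converges almost
  everywhere; by Fatou's lemma its pointwise limit is also the limit in \<open>L\<^sup>2\<close>.
\<close>

lemma L2_complete:
  assumes s: "\<And>n. s n \<in> hcarrier (L2 M)"
    and cauchy: "\<forall>e>0. \<exists>n0. \<forall>m\<ge>n0. \<forall>n\<ge>n0. hdist (L2 M) (s m) (s n) < e"
  shows "\<exists>x\<in>hcarrier (L2 M). (\<lambda>n. hdist (L2 M) (s n) x) \<longlonglongrightarrow> 0"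
proof -
  define f where "f = (\<lambda>n. rep (s n))"
  have f: "f n \<in> L2_fun M" "s n = L2_class M (f n)" for n
    using rep_carrier[OF s] by (simp_all add: f_def)
  note [measurable] = L2_measurable[OF f(1)]
  let ?d = "\<lambda>m n. \<integral>x. (cmod (f m x - f n x))\<^sup>2 \<partial>M"
  have cauchy2: "\<exists>n0. \<forall>m\<ge>n0. \<forall>n\<ge>n0. ?d m n < e\<^sup>2" if "e > 0" for e
  proof -
    obtain n0 where n0: "\<forall>m\<ge>n0. \<forall>n\<ge>n0. hdist (L2 M) (s m) (s n) < e"
      using cauchy \<open>e > 0\<close> by blast
    have "?d m n < e\<^sup>2" if "m \<ge> n0" "n \<ge> n0" for m n
    proof -
      have "sqrt (?d m n) < sqrt (e\<^sup>2)"
        using n0 that \<open>e > 0\<close> f by (simp add: L2_hdist)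
      then show ?thesis by (simp only: real_sqrt_less_iff)
    qed
    then show ?thesis by blast
  qed
  obtain r where r: "strict_mono r" and ae: "AE x in M. Cauchy (\<lambda>i. f (r i) x)"
  proof (rule cauchy_L1_AE_cauchy_subseq)
    show "integrable M (f n)" for n using f L2_imp_integrable by blast
    fix e :: real assume e: "e > 0"
    obtain n0 where n0: "\<forall>m\<ge>n0. \<forall>n\<ge>n0. ?d m n < (e / 2)\<^sup>2"
      using cauchy2[of "e / 2"] e by auto
    have "(LINT x|M. norm (f m x - f n x)) < e" if "m \<ge> n0" "n \<ge> n0" for m n
    proof -
      (* the integral of the square is below (e / 2)^2, so both terms contribute at most e / 4 *)
      have am: "z \<le> z\<^sup>2 / e + e / 4" for z
      proof -
        have "0 \<le> (z - e / 2)\<^sup>2" by simp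
        then show ?thesis using e by (simp add: field_simps power2_eq_square)
      qed
      have int: "integrable M (\<lambda>x. (cmod (f m x - f n x))\<^sup>2)"
        using f by (intro L2_integrable L2_diff)
      have "(LINT x|M. norm (f m x - f n x)) \<le> (LINT x|M. (cmod (f m x - f n x))\<^sup>2 / e + e / 4)"
        using f int am by (intro integral_mono integrable_norm L2_imp_integrable L2_diff) auto
      also have "\<dots> = (LINT x|M. (cmod (f m x - f n x))\<^sup>2) / e + e / 4"
        using int by (simp add: prob_space)
      also have "\<dots> < (e / 2)\<^sup>2 / e + e / 4"
        using n0 that e by (simp add: divide_strict_right_mono)
      also have "\<dots> \<le> e" using e by (simp add: field_simps power2_eq_square)
      finally show ?thesis .
    qed
    then show "\<exists>N. \<forall>i\<ge>N. \<forall>j\<ge>N. (LINT x|M. norm (f i x - f j x)) < e" by blast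
  qed
  define g where "g = (\<lambda>x. lim (\<lambda>i. f (r i) x))"
  have g_meas [measurable]: "g \<in> borel_measurable M"
    unfolding g_def by measurable
  have lim: "AE x in M. (\<lambda>i. f (r i) x) \<longlonglongrightarrow> g x"
    using ae by eventually_elim (simp add: g_def Cauchy_convergent_iff convergent_LIMSEQ_iff)
  let ?e = "\<lambda>n. \<integral>x. (cmod (f n x - g x))\<^sup>2 \<partial>M"
  let ?n = "\<lambda>n. \<integral>\<^sup>+x. ennreal ((cmod (f n x - g x))\<^sup>2) \<partial>M"
  have fatou: "?n n \<le> ennreal (e\<^sup>2)"
    if n0: "\<forall>m\<ge>n0. \<forall>n\<ge>n0. ?d m n < e\<^sup>2" and n: "n \<ge> n0" for n n0 e
  proof -
    have "?n n
        = (\<integral>\<^sup>+x. liminf (\<lambda>i. ennreal ((cmod (f n x - f (r i) x))\<^sup>2)) \<partial>M)"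
    proof (rule nn_integral_cong_AE)
      show "AE x in M. ennreal ((cmod (f n x - g x))\<^sup>2) = liminf (\<lambda>i. ennreal ((cmod (f n x - f (r i) x))\<^sup>2))"
        using lim
      proof eventually_elim
        case (elim x)
        have "(\<lambda>i. ennreal ((cmod (f n x - f (r i) x))\<^sup>2)) \<longlonglongrightarrow> ennreal ((cmod (f n x - g x))\<^sup>2)"
          by (intro tendsto_intros elim)
        from lim_imp_Liminf[OF _ this] show ?case by simp
      qed
    qed
    also have "\<dots> \<le> liminf (\<lambda>i. \<integral>\<^sup>+x. ennreal ((cmod (f n x - f (r i) x))\<^sup>2) \<partial>M)"
      by (rule nn_integral_liminf) measurable
    also have "\<dots> \<le> ennreal (e\<^sup>2)"
    proof (rule Liminf_le)
      show "\<forall>\<^sub>F i in sequentially. (\<integral>\<^sup>+x. ennreal ((cmod (f n x - f (r i) x))\<^sup>2) \<partial>M) \<le> ennreal (e\<^sup>2)"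
        unfolding eventually_sequentially
      proof (intro exI allI impI)
        fix i assume "i \<ge> n0"
        then have "r i \<ge> n0" using seq_suble[OF r, of i] by linarith
        then have "(\<integral>x. (cmod (f n x - f (r i) x))\<^sup>2 \<partial>M) < e\<^sup>2" using n0 n by blast
        then show "(\<integral>\<^sup>+x. ennreal ((cmod (f n x - f (r i) x))\<^sup>2) \<partial>M) \<le> ennreal (e\<^sup>2)"
          using f by (subst nn_integral_eq_integral) (auto intro!: L2_integrable L2_diff ennreal_leI)
      qed
    qed simp
    finally show ?thesis .
  qed
  have L2_close: "(\<lambda>x. f n x - g x) \<in> L2_fun M \<and> ?e n \<le> e\<^sup>2"
    if n0: "\<forall>m\<ge>n0. \<forall>n\<ge>n0. ?d m n < e\<^sup>2" and n: "n \<ge> n0" for n n0 e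
  proof -
    note le = fatou[OF that]
    have fin: "?n n < \<infinity>"
      using le ennreal_less_top[of "e\<^sup>2"] unfolding infinity_ennreal_def by (rule le_less_trans)
    then have int: "integrable M (\<lambda>x. (cmod (f n x - g x))\<^sup>2)"
      by (intro integrableI_nonneg) auto
    have "ennreal (?e n) \<le> ennreal (e\<^sup>2)"
      using le int by (subst (asm) nn_integral_eq_integral) auto
    then show ?thesis using int by (simp add: L2_fun_def)
  qed
  have gL2: "g \<in> L2_fun M"
  proof -
    obtain n0 where "\<forall>m\<ge>n0. \<forall>n\<ge>n0. ?d m n < 1\<^sup>2"
      using cauchy2[of 1] by auto
    from L2_close[OF this, of n0] have "(\<lambda>x. f n0 x - g x) \<in> L2_fun M" by simp
    from L2_diff[OF f(1)[of n0] this] show ?thesis by simp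
  qed
  show ?thesis
  proof (intro bexI LIMSEQ_I)
    fix e :: real assume e: "e > 0"
    obtain n0 where n0: "\<forall>m\<ge>n0. \<forall>n\<ge>n0. ?d m n < (e / 2)\<^sup>2"
      using cauchy2[of "e / 2"] e by auto
    have "hdist (L2 M) (s n) (L2_class M g) < e" if "n \<ge> n0" for n
    proof -
      have "sqrt (?e n) \<le> sqrt ((e / 2)\<^sup>2)"
        using L2_close[OF n0 that] by (intro real_sqrt_le_mono) blast
      then show ?thesis using e f gL2 by (simp add: L2_hdist)
    qed
    moreover have "0 \<le> hdist (L2 M) (s n) (L2_class M g)" for n
      using f gL2 by (simp add: L2_hdist)
    ultimately show "\<exists>n0. \<forall>n\<ge>n0. norm (hdist (L2 M) (s n) (L2_class M g) - 0) < e" by auto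
  qed (use gL2 in simp)
qed

lemma L2_hilbert_space: "hilbert_space (L2 M)"
proof
  fix x y z c
  assume x: "x \<in> hcarrier (L2 M)" and y: "y \<in> hcarrier (L2 M)" and z: "z \<in> hcarrier (L2 M)"
  obtain f where f: "f \<in> L2_fun M" "x = L2_class M f" using L2_cases[OF x] .
  obtain g where g: "g \<in> L2_fun M" "y = L2_class M g" using L2_cases[OF y] .
  obtain h where h: "h \<in> L2_fun M" "z = L2_class M h" using L2_cases[OF z] .
  show "hadd (L2 M) x y \<in> hcarrier (L2 M)" using f g by (simp add: L2_hadd)
  show "hinner (L2 M) (hadd (L2 M) x y) z = hinner (L2 M) x z + hinner (L2 M) y z"
    using f g h Bochner_Integration.integral_add[OF L2_integrable_mult L2_integrable_mult, of f M h g h]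
    by (simp add: L2_hadd L2_hinner distrib_right)
  show "hinner (L2 M) x y = cnj (hinner (L2 M) y x)"
  proof -
    have "cnj (\<integral>x. g x * cnj (f x) \<partial>M) = (\<integral>x. cnj (g x * cnj (f x)) \<partial>M)"
      by (rule Bochner_Integration.integral_cnj[symmetric])
    also have "\<dots> = (\<integral>x. f x * cnj (g x) \<partial>M)"
      by (simp only: complex_cnj_mult complex_cnj_cnj mult.commute)
    finally show ?thesis using f g by (simp add: L2_hinner)
  qed
  show "x = y" if eq: "\<And>z. z \<in> hcarrier (L2 M) \<Longrightarrow> hinner (L2 M) x z = hinner (L2 M) y z"
  proof -
    let ?d = "\<lambda>x. f x - g x"
    have d: "?d \<in> L2_fun M" using f g by simp
    have "(\<integral>x. ?d x * cnj (?d x) \<partial>M) = 0"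
      using eq[of "L2_class M ?d"] f g d L2_integrable_mult[OF f(1) d] L2_integrable_mult[OF g(1) d]
      by (simp add: L2_hinner left_diff_distrib)
    then have "(\<integral>x. complex_of_real ((cmod (?d x))\<^sup>2) \<partial>M) = 0"
      by (simp only: complex_norm_square)
    then have "complex_of_real (\<integral>x. (cmod (?d x))\<^sup>2 \<partial>M) = 0"
      by (simp only: integral_complex_of_real)
    then have "(\<integral>x. (cmod (?d x))\<^sup>2 \<partial>M) = 0" by (simp only: of_real_eq_0_iff)
    then have "AE x in M. (cmod (?d x))\<^sup>2 = 0"
      using L2_integrable[OF d] by (subst (asm) integral_nonneg_eq_0_iff_AE) auto
    then show ?thesis unfolding f g by (intro L2_class_cong) auto
  qed
next
  fix x c assume x: "x \<in> hcarrier (L2 M)"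
  obtain f where f: "f \<in> L2_fun M" "x = L2_class M f" using L2_cases[OF x] .
  show "hscale (L2 M) c x \<in> hcarrier (L2 M)" using f by (simp add: L2_hscale)
  show "hinner (L2 M) (hzero (L2 M)) x = 0" using f by (simp add: L2_hzero L2_hinner)
  have "(\<integral>x. f x * cnj (f x) \<partial>M) = (\<integral>x. complex_of_real ((cmod (f x))\<^sup>2) \<partial>M)"
    by (simp only: complex_norm_square)
  also have "\<dots> = complex_of_real (\<integral>x. (cmod (f x))\<^sup>2 \<partial>M)"
    by (rule integral_complex_of_real)
  finally show "0 \<le> Re (hinner (L2 M) x x)" using f by (simp add: L2_hinner)
next
  fix x y c assume x: "x \<in> hcarrier (L2 M)" and y: "y \<in> hcarrier (L2 M)"
  obtain f where f: "f \<in> L2_fun M" "x = L2_class M f" using L2_cases[OF x] .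
  obtain g where g: "g \<in> L2_fun M" "y = L2_class M g" using L2_cases[OF y] .
  show "hinner (L2 M) (hscale (L2 M) c x) y = c * hinner (L2 M) x y"
    using f g L2_integrable_mult[of f M g] by (simp add: L2_hscale L2_hinner mult.assoc)
next
  show "hzero (L2 M) \<in> hcarrier (L2 M)" by (simp add: L2_hzero)
qed (rule L2_complete)

text \<open>Operators on \<open>L\<^sup>2\<close> are given by maps of functions that respect equality almost everywhere.\<close>

lemma
  fixes t :: "('a \<Rightarrow> complex) \<Rightarrow> 'a \<Rightarrow> complex"
  assumes t: "\<And>f. f \<in> L2_fun M \<Longrightarrow> t f \<in> L2_fun M"
    and cong: "\<And>f g. AE x in M. f x = g x \<Longrightarrow> AE x in M. t f x = t g x"
    and add: "\<And>f g. t (\<lambda>x. f x + g x) = (\<lambda>x. t f x + t g x)"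
    and scale: "\<And>c f. t (\<lambda>x. c * f x) = (\<lambda>x. c * t f x)"
    and bound: "\<And>f. f \<in> L2_fun M \<Longrightarrow>
      (\<integral>x. (cmod (t f x))\<^sup>2 \<partial>M) \<le> C\<^sup>2 * (\<integral>x. (cmod (f x))\<^sup>2 \<partial>M)"
  defines "T \<equiv> \<lambda>\<xi>\<in>hcarrier (L2 M). L2_class M (t (rep \<xi>))"
  shows L2_op_class: "f \<in> L2_fun M \<Longrightarrow> T (L2_class M f) = L2_class M (t f)"
    and L2_op_bounded: "T \<in> bounded_ops (L2 M)"
proof -
  interpret H: hilbert_space "L2 M" by (rule L2_hilbert_space)
  have T: "T (L2_class M f) = L2_class M (t f)" if "f \<in> L2_fun M" for f
    using that by (simp add: T_def L2_class_cong[OF cong[OF rep_L2(2)]])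
  then show "f \<in> L2_fun M \<Longrightarrow> T (L2_class M f) = L2_class M (t f)" .
  show "T \<in> bounded_ops (L2 M)"
  proof (rule H.op_weakI[where C = "\<bar>C\<bar>"])
    fix x y z c assume x: "x \<in> H.V" and y: "y \<in> H.V" and z: "z \<in> H.V"
    obtain f where f: "f \<in> L2_fun M" "x = L2_class M f" using L2_cases[OF x] .
    obtain g where g: "g \<in> L2_fun M" "y = L2_class M g" using L2_cases[OF y] .
    have "T (hadd (L2 M) x y) = hadd (L2 M) (T x) (T y)"
      using f g t by (simp add: L2_hadd T add)
    then show "H.ip (T (hadd (L2 M) x y)) z = H.ip (T x) z + H.ip (T y) z"
      using f g t z by (simp add: T)
  next
    fix c x z assume x: "x \<in> H.V" and z: "z \<in> H.V"
    obtain f where f: "f \<in> L2_fun M" "x = L2_class M f" using L2_cases[OF x] .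
    have "T (hscale (L2 M) c x) = hscale (L2 M) c (T x)"
      using f t by (simp add: L2_hscale T scale)
    then show "H.ip (T (hscale (L2 M) c x)) z = c * H.ip (T x) z"
      using f t z by (simp add: T)
  next
    fix x assume x: "x \<in> H.V"
    obtain f where f: "f \<in> L2_fun M" "x = L2_class M f" using L2_cases[OF x] .
    show "T x \<in> H.V" using f t by (simp add: T)
    show "H.nrm (T x) \<le> \<bar>C\<bar> * H.nrm x"
      using f t real_sqrt_le_mono[OF bound[OF f(1)]] by (simp add: T L2_hnorm real_sqrt_mult)
  qed (simp add: T_def)
qed

lemma L2_nontrivial: "hcarrier (L2 M) \<noteq> {hzero (L2 M)}"
proof
  assume "hcarrier (L2 M) = {hzero (L2 M)}"
  then have "L2_class M (\<lambda>x. 1) = L2_class M (\<lambda>x. 0)"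
    using L2_class_closed[OF L2_const[of 1]] by (simp add: L2_hzero)
  then have "AE x in M. (1::complex) = 0" by (rule L2_class_eqD) simp
  then show False by simp
qed

end

section \<open>The Cuntz family of a system of inverse branches\<close>

text \<open>The measure-theoretic content of the topological hypotheses: \<open>\<psi> i\<close> is the inverse of \<open>\<phi>\<close> on the
  branch \<open>U i\<close>, and \<open>J i\<close> is the density of the image under \<open>\<phi>\<close> of the measure restricted to \<open>U i\<close>.\<close>

locale branch_system = prob_space M for M :: "'a measure" +
  fixes \<phi> :: "'a \<Rightarrow> 'a" and N :: nat and U :: "nat \<Rightarrow> 'a set"
    and \<psi> :: "nat \<Rightarrow> 'a \<Rightarrow> 'a" and J :: "nat \<Rightarrow> 'a \<Rightarrow> real"
  assumes phi_measurable [measurable]: "\<phi> \<in> measurable M M"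
    and phi_distr: "distr M M \<phi> = M"
    and U_sets [measurable]: "i \<in> {1..N} \<Longrightarrow> U i \<in> sets M"
    and U_disjoint: "disjoint_family_on U {1..N}"
    and U_cover: "AE x in M. \<exists>i\<in>{1..N}. x \<in> U i"
    and psi_measurable [measurable]: "i \<in> {1..N} \<Longrightarrow> \<psi> i \<in> measurable M M"
    and psi_phi: "i \<in> {1..N} \<Longrightarrow> x \<in> U i \<Longrightarrow> \<psi> i (\<phi> x) = x"
    and phi_psi: "i \<in> {1..N} \<Longrightarrow> AE x in M. \<phi> (\<psi> i x) = x"
    and J_measurable [measurable]: "i \<in> {1..N} \<Longrightarrow> J i \<in> borel_measurable M"
    and J_pos: "0 < J i x"
    and J_density: "i \<in> {1..N} \<Longrightarrow>
      distr (density M (indicator (U i))) M \<phi> = density M (\<lambda>x. ennreal (J i x))"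
begin

sublocale H: hilbert_space "L2 M"
  by (rule L2_hilbert_space)

abbreviation "cls \<equiv> L2_class M"

lemma AE_phi: "AE x in M. P x \<Longrightarrow> AE x in M. P (\<phi> x)"
  using AE_distrD[OF phi_measurable, of P] unfolding phi_distr .

text \<open>Change of variables along the branch \<open>U i\<close>; the norms and inner products of branches are
  computed with it.\<close>

lemma branch_integral:
  fixes h :: "'a \<Rightarrow> 'b::{banach, second_countable_topology}"
  assumes i: "i \<in> {1..N}" and [measurable]: "h \<in> borel_measurable M"
  shows "integrable M (\<lambda>x. indicator (U i) x *\<^sub>R h (\<phi> x)) \<longleftrightarrow> integrable M (\<lambda>x. J i x *\<^sub>R h x)"
    and "(\<integral>x. indicator (U i) x *\<^sub>R h (\<phi> x) \<partial>M) = (\<integral>x. J i x *\<^sub>R h x \<partial>M)"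
proof -
  note [measurable] = U_sets[OF i] J_measurable[OF i]
  let ?D = "density M (\<lambda>x. ennreal (indicator (U i) x))"
  have dist: "distr ?D M \<phi> = density M (\<lambda>x. ennreal (J i x))"
    using J_density[OF i] by (simp add: ennreal_indicator)
  have [measurable]: "\<phi> \<in> measurable ?D M" by simp
  have "integrable M (\<lambda>x. indicator (U i) x *\<^sub>R h (\<phi> x)) \<longleftrightarrow> integrable ?D (\<lambda>x. h (\<phi> x))"
    by (intro integrable_density[symmetric]) auto
  also have "\<dots> \<longleftrightarrow> integrable (distr ?D M \<phi>) h"
    by (intro integrable_distr_eq[symmetric]) auto
  also have "\<dots> \<longleftrightarrow> integrable M (\<lambda>x. J i x *\<^sub>R h x)"
    unfolding dist using J_pos by (intro integrable_density) (auto intro: less_imp_le)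
  finally show "integrable M (\<lambda>x. indicator (U i) x *\<^sub>R h (\<phi> x)) \<longleftrightarrow> integrable M (\<lambda>x. J i x *\<^sub>R h x)" .
  have "(\<integral>x. indicator (U i) x *\<^sub>R h (\<phi> x) \<partial>M) = (\<integral>x. h (\<phi> x) \<partial>?D)"
    by (intro integral_density[symmetric]) auto
  also have "\<dots> = (\<integral>x. h x \<partial>distr ?D M \<phi>)"
    by (intro integral_distr[symmetric]) auto
  also have "\<dots> = (\<integral>x. J i x *\<^sub>R h x \<partial>M)"
    unfolding dist using J_pos by (intro integral_density) (auto intro: less_imp_le)
  finally show "(\<integral>x. indicator (U i) x *\<^sub>R h (\<phi> x) \<partial>M) = (\<integral>x. J i x *\<^sub>R h x \<partial>M)" .
qed

text \<open>The weight \<open>1 / \<surd> J\<close> compensates the Jacobian \<open>J\<close> of the change of variables, which makes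
  \<open>branch i\<close> isometric, with adjoint \<open>cobranch i\<close>.\<close>

definition branch :: "nat \<Rightarrow> ('a \<Rightarrow> complex) \<Rightarrow> 'a \<Rightarrow> complex" where
  "branch i f x = (if x \<in> U i then f (\<phi> x) / of_real (sqrt (J i (\<phi> x))) else 0)"

definition cobranch :: "nat \<Rightarrow> ('a \<Rightarrow> complex) \<Rightarrow> 'a \<Rightarrow> complex" where
  "cobranch i f x = of_real (sqrt (J i x)) * f (\<psi> i x)"

definition mask :: "'a set \<Rightarrow> ('a \<Rightarrow> complex) \<Rightarrow> 'a \<Rightarrow> complex" where
  "mask E f x = (if x \<in> E then f x else 0)"

lemma branch_L2 [simp]:
  assumes i: "i \<in> {1..N}" and f: "f \<in> L2_fun M"
  shows "branch i f \<in> L2_fun M"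
proof -
  note [measurable] = U_sets[OF i] J_measurable[OF i] L2_measurable[OF f]
  have "integrable M (\<lambda>x. J i x *\<^sub>R ((cmod (f x))\<^sup>2 / J i x))"
    using L2_integrable[OF f] J_pos[of i] by (simp add: less_imp_neq[symmetric])
  then have "integrable M (\<lambda>x. indicator (U i) x *\<^sub>R ((cmod (f (\<phi> x)))\<^sup>2 / J i (\<phi> x)))"
    using branch_integral(1)[OF i, of "\<lambda>x. (cmod (f x))\<^sup>2 / J i x"] by simp
  moreover have "(cmod (branch i f x))\<^sup>2 = indicator (U i) x *\<^sub>R ((cmod (f (\<phi> x)))\<^sup>2 / J i (\<phi> x))" for x
    using J_pos[of i "\<phi> x"] by (simp add: branch_def norm_divide power_divide)
  moreover have "branch i f \<in> borel_measurable M"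
    unfolding branch_def[abs_def] by measurable
  ultimately show ?thesis by (simp add: L2_fun_def)
qed

lemma branch_inner:
  assumes i: "i \<in> {1..N}" and f: "f \<in> L2_fun M" and g: "g \<in> L2_fun M"
  shows "(\<integral>x. branch i f x * cnj (branch i g x) \<partial>M) = (\<integral>x. f x * cnj (g x) \<partial>M)"
proof -
  note [measurable] = U_sets[OF i] J_measurable[OF i] L2_measurable[OF f] L2_measurable[OF g]
  have "branch i f x * cnj (branch i g x) =
      indicator (U i) x *\<^sub>R (f (\<phi> x) * cnj (g (\<phi> x)) / of_real (J i (\<phi> x)))" for x
    using J_pos[of i "\<phi> x"] by (simp add: branch_def flip: of_real_mult)
  then have "(\<integral>x. branch i f x * cnj (branch i g x) \<partial>M) =
      (\<integral>x. indicator (U i) x *\<^sub>R (f (\<phi> x) * cnj (g (\<phi> x)) / of_real (J i (\<phi> x))) \<partial>M)"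
    by simp
  also have "\<dots> = (\<integral>x. J i x *\<^sub>R (f x * cnj (g x) / of_real (J i x)) \<partial>M)"
    by (rule branch_integral(2)[OF i, of "\<lambda>x. f x * cnj (g x) / of_real (J i x)"]) measurable
  also have "\<dots> = (\<integral>x. f x * cnj (g x) \<partial>M)"
    using J_pos[of i] by (simp add: scaleR_conv_of_real less_imp_neq[symmetric])
  finally show ?thesis .
qed

lemma cobranch_L2 [simp]:
  assumes i: "i \<in> {1..N}" and f: "f \<in> L2_fun M"
  shows "cobranch i f \<in> L2_fun M"
proof -
  note [measurable] = U_sets[OF i] J_measurable[OF i] L2_measurable[OF f] psi_measurable[OF i]
  have "integrable M (\<lambda>x. indicator (U i) x *\<^sub>R (cmod (f (\<psi> i (\<phi> x))))\<^sup>2)"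
  proof (rule Bochner_Integration.integrable_bound[OF L2_integrable[OF f]])
    show "AE x in M. norm (indicator (U i) x *\<^sub>R (cmod (f (\<psi> i (\<phi> x))))\<^sup>2) \<le> norm ((cmod (f x))\<^sup>2)"
      using psi_phi[OF i] by (auto simp: indicator_def)
  qed measurable
  then have "integrable M (\<lambda>x. J i x *\<^sub>R (cmod (f (\<psi> i x)))\<^sup>2)"
    using branch_integral(1)[OF i, of "\<lambda>x. (cmod (f (\<psi> i x)))\<^sup>2"] by simp
  moreover have "(cmod (cobranch i f x))\<^sup>2 = J i x *\<^sub>R (cmod (f (\<psi> i x)))\<^sup>2" for x
    using J_pos[of i x] by (simp add: cobranch_def norm_mult power_mult_distrib)
  moreover have "cobranch i f \<in> borel_measurable M"
    unfolding cobranch_def[abs_def] by measurable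
  ultimately show ?thesis by (simp add: L2_fun_def)
qed

lemma branch_cobranch: "i \<in> {1..N} \<Longrightarrow> branch i (cobranch i f) = mask (U i) f"
  using J_pos psi_phi by (auto simp: branch_def cobranch_def mask_def less_imp_neq[symmetric])

lemma mask_L2 [simp]:
  assumes [measurable]: "E \<in> sets M" and f: "f \<in> L2_fun M"
  shows "mask E f \<in> L2_fun M"
proof (rule L2_funI_bound[OF _ L2_integrable[OF f]])
  note [measurable] = L2_measurable[OF f]
  show "mask E f \<in> borel_measurable M" unfolding mask_def[abs_def] by measurable
qed (simp add: mask_def)

definition branch_op :: "nat \<Rightarrow> ('a \<Rightarrow> complex) set \<Rightarrow> ('a \<Rightarrow> complex) set" where
  "branch_op i = (\<lambda>\<xi>\<in>hcarrier (L2 M). cls (branch i (rep \<xi>)))"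

lemma
  assumes i: "i \<in> {1..N}"
  shows branch_op_cls: "f \<in> L2_fun M \<Longrightarrow> branch_op i (cls f) = cls (branch i f)"
    and branch_op_closed: "branch_op i \<in> H.B"
proof -
  have cong: "AE x in M. branch i f x = branch i g x" if "AE x in M. f x = g x" for f g
    using AE_phi[OF that] by eventually_elim (simp add: branch_def)
  have add: "branch i (\<lambda>x. f x + g x) = (\<lambda>x. branch i f x + branch i g x)"
    and scale: "branch i (\<lambda>x. c * f x) = (\<lambda>x. c * branch i f x)" for f g c
    by (auto simp: branch_def add_divide_distrib)
  have bound: "(\<integral>x. (cmod (branch i f x))\<^sup>2 \<partial>M) \<le> 1\<^sup>2 * (\<integral>x. (cmod (f x))\<^sup>2 \<partial>M)" if f: "f \<in> L2_fun M" for f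
  proof -
    have "H.nrm (cls (branch i f)) = H.nrm (cls f)"
      using i f branch_inner[OF i f f] by (simp add: hnorm_def L2_hinner)
    then show ?thesis using i f by (simp add: L2_hnorm)
  qed
  note * = branch_L2[OF i] cong add scale bound
  show "f \<in> L2_fun M \<Longrightarrow> branch_op i (cls f) = cls (branch i f)"
    unfolding branch_op_def by (rule L2_op_class[OF *])
  show "branch_op i \<in> H.B"
    unfolding branch_op_def by (rule L2_op_bounded[OF *])
qed

lemma branch_op_inner:
  assumes "i \<in> {1..N}" "j \<in> {1..N}" "x \<in> H.V" "y \<in> H.V"
  shows "H.ip (branch_op i x) (branch_op j y) = (if i = j then H.ip x y else 0)"
proof -
  obtain f where f: "f \<in> L2_fun M" "x = cls f" using L2_cases[OF assms(3)] .
  obtain g where g: "g \<in> L2_fun M" "y = cls g" using L2_cases[OF assms(4)] .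
  show ?thesis
  proof (cases "i = j")
    case True
    then show ?thesis using assms f g by (simp add: branch_op_cls L2_hinner branch_inner)
  next
    case False
    have "(\<lambda>z. branch i f z * cnj (branch j g z)) = (\<lambda>z. 0)"
      using disjoint_family_onD[OF U_disjoint assms(1,2) False]
      by (auto simp: branch_def fun_eq_iff)
    then have "(\<integral>z. branch i f z * cnj (branch j g z) \<partial>M) = 0" by simp
    then show ?thesis using assms f g False by (simp add: branch_op_cls L2_hinner)
  qed
qed

lemma sum_mask: "AE x in M. (\<Sum>i\<in>{1..N}. mask (U i) f x) = f x"
  using U_cover
proof eventually_elim
  case (elim x)
  then obtain j where j: "j \<in> {1..N}" "x \<in> U j" by blast
  have "mask (U i) f x = (if i = j then f x else 0)" if "i \<in> {1..N}" for i
    using disjoint_family_onD[OF U_disjoint that j(1)] j(2) by (auto simp: mask_def)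
  then have "(\<Sum>i\<in>{1..N}. mask (U i) f x) = (\<Sum>i\<in>{1..N}. if i = j then f x else 0)"
    by (intro sum.cong) auto
  then show ?case using j by simp
qed

text \<open>On \<open>U i\<close> the map \<open>branch i\<close> undoes \<open>cobranch i\<close>, so the part of \<open>f\<close> on \<open>U i\<close> lies in the range of
  the operator with index \<open>i\<close>, and these parts add up to \<open>f\<close>.\<close>

lemma branch_op_family: "cuntz_family (op_algebra (L2 M)) N branch_op"
proof (rule H.cuntz_familyI)
  fix x assume x: "x \<in> H.V"
  obtain f where f: "f \<in> L2_fun M" "x = cls f" using L2_cases[OF x] .
  (* vectors are needed at every index, also outside {1..N} *)
  define y where "y = (\<lambda>i. if i \<in> {1..N} then cls (cobranch i f) else hzero (L2 M))"
  have yV: "y i \<in> H.V" for i using f by (auto simp: y_def)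
  have iso_y: "branch_op i (y i) = cls (mask (U i) f)" if "i \<in> {1..N}" for i
    using that f by (simp add: y_def branch_op_cls branch_cobranch del: atLeastAtMost_iff)
  have "H.ip x z = (\<Sum>i\<in>{1..N}. H.ip (branch_op i (y i)) z)" if z: "z \<in> H.V" for z
  proof -
    obtain h where h: "h \<in> L2_fun M" "z = cls h" using L2_cases[OF z] .
    have L: "mask (U i) f \<in> L2_fun M" if "i \<in> {1..N}" for i using that f by simp
    have "(\<Sum>i\<in>{1..N}. H.ip (branch_op i (y i)) z) = (\<Sum>i\<in>{1..N}. (\<integral>x. mask (U i) f x * cnj (h x) \<partial>M))"
      using L h iso_y by (intro sum.cong) (auto simp: L2_hinner)
    also have "\<dots> = (\<integral>x. (\<Sum>i\<in>{1..N}. mask (U i) f x * cnj (h x)) \<partial>M)"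
      using L h by (intro Bochner_Integration.integral_sum[symmetric] L2_integrable_mult)
    also have "\<dots> = (\<integral>x. f x * cnj (h x) \<partial>M)"
    proof (rule integral_cong_AE)
      show "AE x in M. (\<Sum>i\<in>{1..N}. mask (U i) f x * cnj (h x)) = f x * cnj (h x)"
        using sum_mask[of f] by eventually_elim (simp flip: sum_distrib_right)
      show "(\<lambda>x. \<Sum>i\<in>{1..N}. mask (U i) f x * cnj (h x)) \<in> borel_measurable M"
        using L h by (intro borel_measurable_sum borel_measurable_integrable L2_integrable_mult)
      show "(\<lambda>x. f x * cnj (h x)) \<in> borel_measurable M"
        using f h by (intro borel_measurable_integrable L2_integrable_mult)
    qed
    finally show ?thesis using f h by (simp add: L2_hinner)
  qed
  then show "\<exists>y. (\<forall>i. y i \<in> H.V) \<and> (\<forall>z\<in>H.V. H.ip x z = (\<Sum>i\<in>{1..N}. H.ip (branch_op i (y i)) z))"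
    using yV by blast
qed (use branch_op_closed branch_op_inner in auto)

sublocale C: cuntz "L2 M" N branch_op
  by unfold_locales (rule branch_op_family)

text \<open>Pairing \<open>f\<close> with a vector in the range of the isometry involves only the part of \<open>f\<close> on \<open>U i\<close>,
  which is the image of \<open>cobranch i f\<close>.\<close>

lemma adjoint_cls:
  assumes i: "i \<in> {1..N}" and f: "f \<in> L2_fun M"
  shows "C.R i (cls f) = cls (cobranch i f)"
proof (rule H.inner_ext)
  fix z assume z: "z \<in> H.V"
  obtain g where g: "g \<in> L2_fun M" "z = cls g" using L2_cases[OF z] .
  have "H.ip (C.R i (cls f)) z = H.ip (cls f) (cls (branch i g))"
    using i f g by (simp add: C.R_inner_left branch_op_cls)
  also have "\<dots> = (\<integral>x. mask (U i) f x * cnj (branch i g x) \<partial>M)"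
    using i f g by (subst L2_hinner) (auto intro!: Bochner_Integration.integral_cong simp: mask_def branch_def)
  also have "\<dots> = H.ip (branch_op i (cls (cobranch i f))) (branch_op i z)"
    using i f g U_sets[OF i] by (simp add: branch_op_cls branch_cobranch L2_hinner del: atLeastAtMost_iff)
  also have "\<dots> = H.ip (cls (cobranch i f)) z"
    using i f z by (simp add: branch_op_inner)
  finally show "H.ip (C.R i (cls f)) z = H.ip (cls (cobranch i f)) z" .
qed (use i f branch_op_closed in auto)

lemma mult_op_cls:
  assumes "g \<in> L2_fun M"
  shows "mult_op M f (cls g) = cls (\<lambda>x. f x * g x)"
  using rep_L2(2)[OF assms] assms
  by (auto simp: mult_op_def intro!: L2_class_cong elim: eventually_mono)

lemma mult_op_closed:
  assumes f: "f \<in> L_infty_fun M"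
  shows "mult_op M f \<in> H.B"
proof -
  obtain C where C: "AE x in M. cmod (f x) \<le> C" and [measurable]: "f \<in> borel_measurable M"
    using f by (auto simp: L_infty_fun_def)
  have L2: "(\<lambda>x. f x * g x) \<in> L2_fun M" if "g \<in> L2_fun M" for g
    by (rule L2_mult_bounded[OF that _ C]) simp
  show ?thesis
    unfolding mult_op_def
  proof (rule L2_op_bounded[where C = C and t = "\<lambda>g x. f x * g x"])
    fix g assume g: "g \<in> L2_fun M"
    have "(\<integral>x. (cmod (f x * g x))\<^sup>2 \<partial>M) \<le> (\<integral>x. C\<^sup>2 * (cmod (g x))\<^sup>2 \<partial>M)"
    proof (rule integral_mono_AE)
      show "AE x in M. (cmod (f x * g x))\<^sup>2 \<le> C\<^sup>2 * (cmod (g x))\<^sup>2"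
        using C by (auto elim!: eventually_mono simp: norm_mult power_mult_distrib
            intro!: mult_right_mono power_mono)
    qed (use L2_integrable[OF L2[OF g]] L2_integrable[OF g] in auto)
    then show "(\<integral>x. (cmod (f x * g x))\<^sup>2 \<partial>M) \<le> C\<^sup>2 * (\<integral>x. (cmod (g x))\<^sup>2 \<partial>M)" by simp
  qed (use L2 in \<open>auto simp: distrib_left mult.left_commute elim!: eventually_mono\<close>)
qed

lemma L_infty_comp: 
  assumes "f \<in> L_infty_fun M" shows "f \<circ> \<phi> \<in> L_infty_fun M"
  using assms AE_phi[of "\<lambda>x. cmod (f x) \<le> _"]
  by (auto simp: L_infty_fun_def intro: measurable_comp[OF phi_measurable])

lemma L_infty_L2: 
  assumes "f \<in> L_infty_fun M" "g \<in> L2_fun M" shows "(\<lambda>x. f x * g x) \<in> L2_fun M"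
  using assms by (auto simp: L_infty_fun_def intro: L2_mult_bounded)

text \<open>Since \<open>\<phi> \<circ> \<psi>\<^sub>i\<close> is the identity almost everywhere, \<open>M\<^sub>f S\<^sub>i\<^sup>* = S\<^sub>i\<^sup>* M\<^bsub>f \<circ> \<phi>\<^esub>\<close>, and
  \<open>\<Sum>\<^sub>i S\<^sub>i S\<^sub>i\<^sup>* = 1\<close>.\<close>

lemma endo_mult_op:
  assumes f: "f \<in> L_infty_fun M"
  shows "C.\<alpha> (mult_op M f) = mult_op M (f \<circ> \<phi>)"
proof (rule H.op_eqI)
  note MB = mult_op_closed[OF f] mult_op_closed[OF L_infty_comp[OF f]]
  show "C.\<alpha> (mult_op M f) \<in> H.B" "mult_op M (f \<circ> \<phi>) \<in> H.B" using MB by auto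
  fix x y assume x: "x \<in> H.V" and y: "y \<in> H.V"
  obtain g where g: "g \<in> L2_fun M" "x = cls g" using L2_cases[OF x] .
  have "mult_op M f (C.R i x) = C.R i (mult_op M (f \<circ> \<phi>) x)" if i: "i \<in> {1..N}" for i
  proof -
    have "C.R i (mult_op M (f \<circ> \<phi>) x) = cls (cobranch i (\<lambda>x. (f \<circ> \<phi>) x * g x))"
      using g i L_infty_L2[OF L_infty_comp[OF f] g(1)] by (simp add: mult_op_cls adjoint_cls)
    also have "\<dots> = cls (\<lambda>x. f x * cobranch i g x)"
      using phi_psi[OF i]
      by (intro L2_class_cong) (auto elim!: eventually_mono simp: cobranch_def)
    also have "\<dots> = mult_op M f (C.R i x)"
      using g i by (simp add: mult_op_cls adjoint_cls)
    finally show ?thesis by simp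
  qed
  then have "H.ip (C.\<alpha> (mult_op M f) x) y = (\<Sum>i\<in>{1..N}. H.ip (C.R i (mult_op M (f \<circ> \<phi>) x)) (C.R i y))"
    using MB x y by (simp add: C.endo_inner)
  then show "H.ip (C.\<alpha> (mult_op M f) x) y = H.ip (mult_op M (f \<circ> \<phi>) x) y"
    using MB x y C.sum_R_inner[of "mult_op M (f \<circ> \<phi>) x" y] by simp
qed

end

section \<open>Fixed operators are scalars\<close>

locale ergodic_branch_system = branch_system +
  assumes space_UNIV: "space M = UNIV"
    and ergodic: "ergodic_map M \<phi>"
    and generating: "generates_mod_null M (word_set \<phi> U ` lists {1..N})"
begin

text \<open>The sublevel sets of an invariant function are invariant, so each has measure \<open>0\<close> or \<open>1\<close>; the
  function equals the threshold at which the measure jumps.\<close>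

lemma ergodic_imp_constant:
  fixes u :: "'a \<Rightarrow> real"
  assumes [measurable]: "u \<in> borel_measurable M" and inv: "AE x in M. u (\<phi> x) = u x"
  shows "\<exists>c. AE x in M. u x = c"
proof -
  define E where "E = (\<lambda>c. {x \<in> space M. u x \<le> c})"
  have E [measurable]: "E c \<in> sets M" for c unfolding E_def by measurable
  have E01: "prob (E c) = 0 \<or> prob (E c) = 1" for c
  proof -
    have "sym_diff (\<phi> -` E c \<inter> space M) (E c) \<in> null_sets M"
    proof (rule null_setsI)
      have "AE x in M. x \<notin> sym_diff (\<phi> -` E c \<inter> space M) (E c)"
        using inv by eventually_elim (auto simp: E_def space_UNIV)
      moreover show "sym_diff (\<phi> -` E c \<inter> space M) (E c) \<in> sets M" by measurable
      ultimately show "emeasure M (sym_diff (\<phi> -` E c \<inter> space M) (E c)) = 0"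
        by (simp add: AE_iff_null_sets null_setsD1)
    qed
    then show ?thesis
      using ergodic E unfolding ergodic_map_def by auto
  qed
  have E_AE: "(AE x in M. u x \<le> c) \<longleftrightarrow> prob (E c) = 1" "(AE x in M. c < u x) \<longleftrightarrow> prob (E c) = 0" for c
  proof -
    show "(AE x in M. u x \<le> c) \<longleftrightarrow> prob (E c) = 1"
      unfolding E_def by (rule prob_Collect_eq_1[symmetric]) measurable
    show "(AE x in M. c < u x) \<longleftrightarrow> prob (E c) = 0"
      unfolding E_def by (subst prob_Collect_eq_0) (auto simp: not_le)
  qed
  define K where "K = {c. prob (E c) = 1}"
  have up: "d \<in> K" if "c \<in> K" "c \<le> d" for c d
    using that unfolding K_def mem_Collect_eq E_AE(1)[symmetric] by (auto elim!: eventually_mono)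
  have "K \<noteq> {}"
  proof
    assume "K = {}"
    then have "AE x in M. \<forall>n::nat. real n < u x"
      using E01 unfolding AE_all_countable K_def E_AE(2) by blast
    then have "AE x in M. False"
    proof eventually_elim
      case (elim x)
      obtain n where "u x < real n" using reals_Archimedean2 by blast
      with elim[rule_format, of n] show ?case by simp
    qed
    then show False by simp
  qed
  have bdd: "bdd_below K"
  proof (rule ccontr)
    assume "\<not> bdd_below K"
    then have "- real n \<in> K" for n
      using up unfolding bdd_below_def by (meson linear)
    then have "AE x in M. \<forall>n::nat. u x \<le> - real n"
      unfolding AE_all_countable E_AE(1) K_def by blast
    then have "AE x in M. False"
    proof eventually_elim
      case (elim x)
      obtain n where "- u x < real n" using reals_Archimedean2 by blast
      with elim[rule_format, of n] show ?case by simp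
    qed
    then show False by simp
  qed
  have "AE x in M. \<forall>n::nat. u x \<le> Inf K + 1 / real (Suc n) \<and> Inf K - 1 / real (Suc n) < u x"
    unfolding AE_all_countable AE_conj_iff
  proof (intro allI conjI)
    fix n :: nat
    obtain c where "c \<in> K" "c < Inf K + 1 / real (Suc n)"
      using cInf_less_iff[OF \<open>K \<noteq> {}\<close> bdd, of "Inf K + 1 / real (Suc n)"] by auto
    then have "Inf K + 1 / real (Suc n) \<in> K" using up[of c] by auto
    then show "AE x in M. u x \<le> Inf K + 1 / real (Suc n)"
      unfolding K_def by (simp only: E_AE(1) mem_Collect_eq)
    have "Inf K - 1 / real (Suc n) \<notin> K"
    proof
      assume "Inf K - 1 / real (Suc n) \<in> K"
      from cInf_lower[OF this bdd] show False by simp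
    qed
    then show "AE x in M. Inf K - 1 / real (Suc n) < u x"
      unfolding E_AE(2) using E01 by (auto simp: K_def)
  qed
  then have "AE x in M. u x = Inf K"
  proof eventually_elim
    case (elim x)
    have "(\<lambda>n. 1 / real (Suc n)) \<longlonglongrightarrow> 0"
      using LIMSEQ_inverse_real_of_nat by (simp only: inverse_eq_divide)
    note lim = tendsto_add[OF tendsto_const this, of "Inf K"] tendsto_diff[OF tendsto_const this, of "Inf K"]
    have "u x \<le> Inf K + 0" by (rule LIMSEQ_le_const[OF lim(1)]) (use elim in auto)
    moreover have "Inf K - 0 \<le> u x"
      by (rule LIMSEQ_le_const2[OF lim(2)]) (use elim in \<open>auto intro: less_imp_le\<close>)
    ultimately show ?case by simp
  qed
  then show ?thesis by blast
qed

definition mask_op :: "'a set \<Rightarrow> ('a \<Rightarrow> complex) set \<Rightarrow> ('a \<Rightarrow> complex) set" where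
  "mask_op E = mult_op M (indicator E)"

lemma mask_op_cls: "f \<in> L2_fun M \<Longrightarrow> mask_op E (cls f) = cls (mask E f)"
proof -
  assume f: "f \<in> L2_fun M"
  have "(\<lambda>x. indicator E x * f x) = mask E f" by (auto simp: mask_def fun_eq_iff)
  then show ?thesis using f by (simp add: mask_op_def mult_op_cls)
qed

lemma mask_op_closed [simp]: "E \<in> sets M \<Longrightarrow> mask_op E \<in> H.B"
  unfolding mask_op_def by (rule mult_op_closed) (auto simp: L_infty_fun_def indicator_def intro!: exI[of _ 1])

lemma mask_op_eqI:
  assumes "\<And>f. f \<in> L2_fun M \<Longrightarrow> AE x in M. mask E f x = mask G f x" "x \<in> H.V"
  shows "mask_op E x = mask_op G x"
proof -
  obtain f where f: "f \<in> L2_fun M" "x = cls f" using L2_cases[OF assms(2)] .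
  show ?thesis using L2_class_cong[OF assms(1)[OF f(1)]] f by (simp add: mask_op_cls)
qed

context
  fixes T :: "('a \<Rightarrow> complex) set \<Rightarrow> ('a \<Rightarrow> complex) set"
  assumes T: "T \<in> H.B" and fixed: "C.\<alpha> T = T"
begin

lemma fixed_commutes:
  assumes "i \<in> {1..N}" "x \<in> H.V"
  shows "T (branch_op i x) = branch_op i (T x)" "T (C.R i x) = C.R i (T x)"
  using C.endo_S[OF assms(1) T assms(2)] C.R_endo[OF assms(1) T assms(2)] by (simp_all add: fixed)

definition commuting_sets :: "'a set set" where
  "commuting_sets = {E \<in> sets M. \<forall>x\<in>H.V. T (mask_op E x) = mask_op E (T x)}"

text \<open>Multiplication by the indicator of \<open>U i \<inter> \<phi>\<^sup>-\<^sup>1 E\<close> is \<open>S\<^sub>i M\<^sub>E S\<^sub>i\<^sup>*\<close>, a product of operators with which \<open>T\<close>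
  commutes.\<close>

lemma commuting_branch:
  assumes E: "E \<in> commuting_sets" and i: "i \<in> {1..N}"
  shows "U i \<inter> \<phi> -` E \<in> commuting_sets"
proof -
  have [measurable]: "E \<in> sets M" using E by (simp add: commuting_sets_def)
  have "U i \<inter> (\<phi> -` E \<inter> space M) \<in> sets M" using U_sets[OF i] by measurable
  then have meas: "U i \<inter> \<phi> -` E \<in> sets M" by (simp add: space_UNIV)
  have eq: "mask_op (U i \<inter> \<phi> -` E) x = branch_op i (mask_op E (C.R i x))" if x: "x \<in> H.V" for x
  proof -
    obtain f where f: "f \<in> L2_fun M" "x = cls f" using L2_cases[OF x] .
    have "branch i (mask E (cobranch i f)) = mask (U i \<inter> \<phi> -` E) f"
      using branch_cobranch[OF i, of f] by (auto simp: branch_def mask_def fun_eq_iff split: if_splits)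
    then show ?thesis
      using f i by (simp add: adjoint_cls mask_op_cls branch_op_cls del: atLeastAtMost_iff)
  qed
  have "T (mask_op (U i \<inter> \<phi> -` E) x) = mask_op (U i \<inter> \<phi> -` E) (T x)" if x: "x \<in> H.V" for x
  proof -
    have "mask_op E (C.R i x) \<in> H.V" using i x by simp
    then have "T (mask_op (U i \<inter> \<phi> -` E) x) = branch_op i (T (mask_op E (C.R i x)))"
      using eq[OF x] fixed_commutes[OF i] by simp
    also have "T (mask_op E (C.R i x)) = mask_op E (C.R i (T x))"
      using E i x fixed_commutes[OF i x] by (simp add: commuting_sets_def)
    also have "branch_op i (mask_op E (C.R i (T x))) = mask_op (U i \<inter> \<phi> -` E) (T x)"
      using eq[of "T x"] T x by simp
    finally show ?thesis .
  qed
  then show ?thesis using meas by (simp add: commuting_sets_def)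
qed

lemma commuting_words:
  assumes "w \<in> lists {1..N}"
  shows "word_set \<phi> U w \<in> commuting_sets"
  using assms
proof (induction w rule: list.induct)
  case Nil
  have "mask_op UNIV x = x" if x: "x \<in> H.V" for x
  proof -
    obtain f where f: "f \<in> L2_fun M" "x = cls f" using L2_cases[OF x] .
    have "mask UNIV f = f" by (simp add: mask_def fun_eq_iff)
    then show ?thesis using f by (simp add: mask_op_cls)
  qed
  then have "UNIV \<in> commuting_sets"
    using T sets.top[of M] by (simp add: commuting_sets_def space_UNIV)
  then show ?case by (simp add: word_set_def)
next
  case (Cons i w)
  have i: "i \<in> {1..N}" and w: "w \<in> lists {1..N}" using Cons.prems by (simp_all only: Cons_in_lists_iff)
  have "word_set \<phi> U (i # w) = U i \<inter> \<phi> -` word_set \<phi> U w"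
    by (auto simp: word_set_def less_Suc_eq_0_disj funpow_swap1 All_less_Suc2)
  then show ?case using commuting_branch[OF Cons.IH[OF w] i] by simp
qed

lemma commuting_Compl:
  assumes E: "E \<in> commuting_sets" shows "UNIV - E \<in> commuting_sets"
proof -
  have [measurable]: "E \<in> sets M" using E by (simp add: commuting_sets_def)
  have meas: "UNIV - E \<in> sets M" using sets.compl_sets[of E M] by (simp add: space_UNIV)
  have eq: "mask_op (UNIV - E) x = hadd (L2 M) x (hscale (L2 M) (-1) (mask_op E x))" if x: "x \<in> H.V" for x
  proof -
    obtain f where f: "f \<in> L2_fun M" "x = cls f" using L2_cases[OF x] .
    have "mask (UNIV - E) f = (\<lambda>x. f x + - mask E f x)" by (auto simp: mask_def)
    then show ?thesis using f L2_scale[of "mask E f" M "-1"] by (simp add: mask_op_cls L2_hscale L2_hadd)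
  qed
  have "T (mask_op (UNIV - E) x) = mask_op (UNIV - E) (T x)" if x: "x \<in> H.V" for x
    using E T x by (simp add: eq commuting_sets_def)
  then show ?thesis using meas by (simp add: commuting_sets_def)
qed

lemma commuting_Un:
  assumes E: "E \<in> commuting_sets" and G: "G \<in> commuting_sets" shows "E \<union> G \<in> commuting_sets"
proof -
  have Int: "E \<inter> G \<in> commuting_sets" if E: "E \<in> commuting_sets" and G: "G \<in> commuting_sets" for E G
  proof -
    have [measurable]: "E \<in> sets M" "G \<in> sets M" using E G by (simp_all add: commuting_sets_def)
    have eq: "mask_op (E \<inter> G) x = mask_op E (mask_op G x)" if x: "x \<in> H.V" for x
    proof -
      obtain f where f: "f \<in> L2_fun M" "x = cls f" using L2_cases[OF x] .
      have "mask (E \<inter> G) f = mask E (mask G f)" by (auto simp: mask_def)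
      then show ?thesis using f by (simp add: mask_op_cls)
    qed
    have "T (mask_op (E \<inter> G) x) = mask_op (E \<inter> G) (T x)" if x: "x \<in> H.V" for x
      using E G T x by (simp add: eq commuting_sets_def)
    then show ?thesis by (simp add: commuting_sets_def)
  qed
  have "E \<union> G = UNIV - ((UNIV - E) \<inter> (UNIV - G))" by blast
  then show ?thesis using commuting_Compl Int E G by simp
qed

text \<open>
  A countable union is an increasing union of finite ones, and multiplication by the indicators
  of an increasing sequence of sets converges weakly, by dominated convergence.
\<close>

lemma commuting_UN:
  assumes a: "\<And>n::nat. a n \<in> commuting_sets" shows "(\<Union>n. a n) \<in> commuting_sets"
proof -
  define b where "b = (\<lambda>n. \<Union>k\<le>n. a k)"
  have b: "b n \<in> commuting_sets" for n
  proof (induction n)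
    case (Suc n)
    have "b (Suc n) = b n \<union> a (Suc n)" by (auto simp: b_def atMost_Suc)
    then show ?case using commuting_Un[OF Suc a] by simp
  qed (use a in \<open>simp add: b_def\<close>)
  let ?A = "\<Union>n. a n"
  have [measurable]: "a n \<in> sets M" "b n \<in> sets M" for n 
    using a b by (simp_all add: commuting_sets_def)
  have A [measurable]: "?A \<in> sets M" by measurable
  have lim: "(\<lambda>n. H.ip (mask_op (b n) x) y) \<longlonglongrightarrow> H.ip (mask_op ?A x) y" if x: "x \<in> H.V" and y: "y \<in> H.V" for x y
  proof -
    obtain f where f: "f \<in> L2_fun M" "x = cls f" using L2_cases[OF x] .
    obtain g where g: "g \<in> L2_fun M" "y = cls g" using L2_cases[OF y] .
    have "(\<lambda>n. \<integral>z. mask (b n) f z * cnj (g z) \<partial>M) \<longlonglongrightarrow> (\<integral>z. mask ?A f z * cnj (g z) \<partial>M)"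
    proof (rule integral_dominated_convergence)
      show "integrable M (\<lambda>z. norm (f z * cnj (g z)))"
        using f g by (intro integrable_norm L2_integrable_mult)
      show "AE z in M. (\<lambda>n. mask (b n) f z * cnj (g z)) \<longlonglongrightarrow> mask ?A f z * cnj (g z)"
      proof (rule AE_I2)
        fix z
        have "\<forall>\<^sub>F n in sequentially. mask (b n) f z * cnj (g z) = mask ?A f z * cnj (g z)"
        proof (cases "z \<in> ?A")
          case True
          then obtain k where "z \<in> a k" by blast
          then have "z \<in> b n" if "n \<ge> k" for n using that by (auto simp: b_def)
          then show ?thesis
            using True by (auto simp: mask_def eventually_sequentially)
        next
          case False
          then show ?thesis by (auto simp: mask_def b_def)
        qed
        then show "(\<lambda>n. mask (b n) f z * cnj (g z)) \<longlonglongrightarrow> mask ?A f z * cnj (g z)"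
          by (rule tendsto_eventually)
      qed
      show "AE z in M. norm (mask (b n) f z * cnj (g z)) \<le> norm (f z * cnj (g z))" for n
        by (auto simp: mask_def)
    qed (use f g in \<open>auto intro!: borel_measurable_integrable L2_integrable_mult\<close>)
    then show ?thesis using f g by (simp add: mask_op_cls L2_hinner)
  qed
  have "T (mask_op ?A x) = mask_op ?A (T x)" if x: "x \<in> H.V" for x
  proof (rule H.inner_ext)
    fix y assume y: "y \<in> H.V"
    have "(\<lambda>n. H.ip (T (mask_op (b n) x)) y) \<longlonglongrightarrow> H.ip (T (mask_op ?A x)) y"
      using lim[of x "adjoint_op (L2 M) T y"] T x y by (simp add: H.adjoint_inner)
    moreover have "(\<lambda>n. H.ip (T (mask_op (b n) x)) y) \<longlonglongrightarrow> H.ip (mask_op ?A (T x)) y"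
      using lim[of "T x" y] b T x y by (simp add: commuting_sets_def)
    ultimately show "H.ip (T (mask_op ?A x)) y = H.ip (mask_op ?A (T x)) y"
      by (rule LIMSEQ_unique)
  qed (use T x in auto)
  then show ?thesis by (simp add: commuting_sets_def)
qed

lemma commuting_all:
  assumes E: "E \<in> sets M" and x: "x \<in> H.V"
  shows "T (mask_op E x) = mask_op E (T x)"
proof -
  obtain G where G: "G \<in> sigma_sets (space M) (word_set \<phi> U ` lists {1..N})" and null: "sym_diff E G \<in> null_sets M"
    using generating E unfolding generates_mod_null_def by blast
  from G have "G \<in> commuting_sets"
  proof (induction rule: sigma_sets.induct)
    case Empty
    have "UNIV \<in> commuting_sets" using commuting_words[of "[]"] by (simp add: word_set_def)
    from commuting_Compl[OF this] show ?case by simp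
  qed (use commuting_words commuting_Compl commuting_UN in \<open>auto simp: space_UNIV\<close>)
  moreover have eq: "mask_op E y = mask_op G y" if "y \<in> H.V" for y
  proof (rule mask_op_eqI[OF _ that])
    fix f
    show "AE x in M. mask E f x = mask G f x"
      using AE_not_in[OF null] by eventually_elim (auto simp: mask_def)
  qed
  ultimately show ?thesis using T x by (simp add: commuting_sets_def)
qed

text \<open>The only candidate for a function by which \<open>T\<close> multiplies.\<close>

definition symbol :: "'a \<Rightarrow> complex" where
  "symbol = rep (T (cls (\<lambda>x. 1)))"

lemma symbol_L2: "symbol \<in> L2_fun M" "T (cls (\<lambda>x. 1)) = cls symbol"
  using rep_carrier[of "T (cls (\<lambda>x. 1))" M] T by (simp_all add: symbol_def)

lemma fixed_simple:
  assumes s: "simple_function M (s :: 'a \<Rightarrow> complex)"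
  shows "s \<in> L2_fun M" "(\<lambda>x. s x * symbol x) \<in> L2_fun M" "T (cls s) = cls (\<lambda>x. s x * symbol x)"
proof -
  let ?s = "\<lambda>C x. if s x \<in> C then s x else 0"
  have main: "?s D \<in> L2_fun M \<and> (\<lambda>x. ?s D x * symbol x) \<in> L2_fun M \<and>
      T (cls (?s D)) = cls (\<lambda>x. ?s D x * symbol x)" if "finite D" for D
    using that
  proof (induction D)
    case empty
    have "T (hzero (L2 M)) = hzero (L2 M)"
      using H.op_scale[OF T H.zero_closed, of 0] T
      by (metis H.inner_ext H.inner_scale_left H.inner_zero_left mult_zero_left H.op_closed H.scale_closed H.zero_closed)
    then show ?case by (simp add: L2_hzero)
  next
    case (insert c D)
    define E where "E = s -` {c} \<inter> space M"
    have E [measurable]: "E \<in> sets M" unfolding E_def using s by (rule simple_functionD(2))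
    have s_eq: "?s (insert c D) = (\<lambda>x. ?s D x + c * mask E (\<lambda>x. 1) x)"
      using insert.hyps by (auto simp: E_def mask_def space_UNIV)
    have g_eq: "(\<lambda>x. ?s (insert c D) x * symbol x) = (\<lambda>x. ?s D x * symbol x + c * mask E symbol x)"
      using insert.hyps by (auto simp: E_def mask_def space_UNIV)
    have m: "mask E (\<lambda>x. 1) \<in> L2_fun M" "mask E symbol \<in> L2_fun M" using symbol_L2 by simp_all
    have TE: "T (cls (mask E (\<lambda>x. 1))) = cls (mask E symbol)"
      using commuting_all[OF E, of "cls (\<lambda>x. 1)"] symbol_L2 by (simp add: mask_op_cls)
    have "cls (?s (insert c D)) = hadd (L2 M) (cls (?s D)) (hscale (L2 M) c (cls (mask E (\<lambda>x. 1))))"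
      unfolding s_eq using insert.IH m by (simp add: L2_hadd L2_hscale)
    moreover have "T \<dots> = hadd (L2 M) (T (cls (?s D))) (hscale (L2 M) c (T (cls (mask E (\<lambda>x. 1)))))"
      using T insert.IH m by simp
    moreover have "\<dots> = cls (\<lambda>x. ?s (insert c D) x * symbol x)"
      unfolding g_eq using insert.IH m by (simp add: TE L2_hadd L2_hscale)
    ultimately have "T (cls (?s (insert c D))) = cls (\<lambda>x. ?s (insert c D) x * symbol x)" by simp
    moreover have "?s (insert c D) \<in> L2_fun M" "(\<lambda>x. ?s (insert c D) x * symbol x) \<in> L2_fun M"
      unfolding s_eq g_eq using insert.IH m by simp_all
    ultimately show ?case by blast
  qed
  have "finite (range s)" using simple_functionD(1)[OF s] by (simp add: space_UNIV)
  from main[OF this] show "s \<in> L2_fun M" "(\<lambda>x. s x * symbol x) \<in> L2_fun M"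
      "T (cls s) = cls (\<lambda>x. s x * symbol x)" by simp_all
qed

text \<open>
  An \<open>L\<^sup>2\<close> function is a pointwise and \<open>L\<^sup>2\<close> limit of simple functions, and an \<open>L\<^sup>2\<close>-convergent
  sequence has a subsequence converging almost everywhere; this identifies the operator with
  multiplication by its symbol.
\<close>

lemma fixed_is_multiplication:
  assumes f: "f \<in> L2_fun M"
  shows "AE x in M. rep (T (cls f)) x = f x * symbol x"
proof -
  note [measurable] = L2_measurable[OF f] L2_measurable[OF symbol_L2(1)]
  obtain s where s: "\<And>n. simple_function M (s n)" 
    and lim: "\<And>x. x \<in> space M \<Longrightarrow> (\<lambda>n. s n x) \<longlonglongrightarrow> f x"
    and bd: "\<And>n x. x \<in> space M \<Longrightarrow> dist (s n x) 0 \<le> 2 * dist (f x) 0"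
    using borel_measurable_implies_sequence_metric[OF L2_measurable[OF f], of 0] by metis
  note [measurable] = borel_measurable_simple_function[OF s]
  define k where "k = rep (T (cls f))"
  have k: "k \<in> L2_fun M" "T (cls f) = cls k"
    using rep_carrier[of "T (cls f)" M] T f by (simp_all add: k_def)
  note [measurable] = L2_measurable[OF k(1)]
  have "(\<lambda>n. \<integral>x. (cmod (s n x - f x))\<^sup>2 \<partial>M) \<longlonglongrightarrow> (\<integral>x. 0 \<partial>M)"
  proof (rule integral_dominated_convergence)
    show "integrable M (\<lambda>x. 9 * (cmod (f x))\<^sup>2)" using L2_integrable[OF f] by simp
    show "AE x in M. (\<lambda>n. (cmod (s n x - f x))\<^sup>2) \<longlonglongrightarrow> 0"
    proof (rule AE_I2)
      fix x assume "x \<in> space M"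
      from lim[OF this] have "(\<lambda>n. (cmod (s n x - f x))\<^sup>2) \<longlonglongrightarrow> (cmod (f x - f x))\<^sup>2"
        by (intro tendsto_intros)
      then show "(\<lambda>n. (cmod (s n x - f x))\<^sup>2) \<longlonglongrightarrow> 0" by simp
    qed
    show "AE x in M. norm ((cmod (s n x - f x))\<^sup>2) \<le> 9 * (cmod (f x))\<^sup>2" for n
    proof (rule AE_I2)
      fix x assume "x \<in> space M"
      then have "cmod (s n x - f x) \<le> 3 * cmod (f x)"
        using bd[of x n] norm_triangle_ineq4[of "s n x" "f x"] by simp
      then have "(cmod (s n x - f x))\<^sup>2 \<le> (3 * cmod (f x))\<^sup>2" by (intro power_mono) auto
      then show "norm ((cmod (s n x - f x))\<^sup>2) \<le> 9 * (cmod (f x))\<^sup>2" by (simp add: power_mult_distrib)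
    qed
  qed measurable
  then have "(\<lambda>n. hdist (L2 M) (cls (s n)) (cls f)) \<longlonglongrightarrow> 0"
    using fixed_simple(1)[OF s] f tendsto_real_sqrt[of _ 0] by (simp add: L2_hdist)
  then have "(\<lambda>n. hdist (L2 M) (T (cls (s n))) (T (cls f))) \<longlonglongrightarrow> 0"
    using fixed_simple(1)[OF s] f by (intro H.op_tendsto[OF T]) auto
  then have "(\<lambda>n. (hdist (L2 M) (T (cls (s n))) (T (cls f)))\<^sup>2) \<longlonglongrightarrow> 0\<^sup>2"
    by (intro tendsto_intros)
  then have conv: "(\<lambda>n. \<integral>x. norm ((cmod (s n x * symbol x - k x))\<^sup>2) \<partial>M) \<longlonglongrightarrow> 0"
    using fixed_simple(2,3)[OF s] k by (simp add: L2_hdist)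
  obtain r where r: "strict_mono r" and ae: "AE x in M. (\<lambda>n. (cmod (s (r n) x * symbol x - k x))\<^sup>2) \<longlonglongrightarrow> 0"
  proof -
    have "\<exists>r. strict_mono r \<and> (AE x in M. (\<lambda>n. (cmod (s (r n) x * symbol x - k x))\<^sup>2) \<longlonglongrightarrow> 0)"
      by (rule tendsto_L1_AE_subseq[OF _ conv])
         (use fixed_simple(2)[OF s] k in \<open>auto intro!: L2_integrable L2_diff\<close>)
    then show ?thesis using that by blast
  qed
  from ae show ?thesis
    unfolding k_def[symmetric]
  proof (rule AE_mp, intro AE_I2 impI)
    fix x assume x: "x \<in> space M" and 0: "(\<lambda>n. (cmod (s (r n) x * symbol x - k x))\<^sup>2) \<longlonglongrightarrow> 0"
    have "(\<lambda>n. s (r n) x) \<longlonglongrightarrow> f x"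
      using LIMSEQ_subseq_LIMSEQ[OF lim[OF x] r] by (simp add: o_def)
    then have "(\<lambda>n. (cmod (s (r n) x * symbol x - k x))\<^sup>2) \<longlonglongrightarrow> (cmod (f x * symbol x - k x))\<^sup>2"
      by (intro tendsto_intros)
    from LIMSEQ_unique[OF this 0] show "k x = f x * symbol x" by simp
  qed
qed

text \<open>Apply \<open>T\<close> and the isometry with index \<open>i\<close> to the constant function \<open>1\<close> in both orders and divide
  by the weight, which vanishes nowhere on \<open>U i\<close>.\<close>

lemma symbol_invariant: "AE x in M. symbol (\<phi> x) = symbol x"
proof -
  have "AE x in M. \<forall>i\<in>{1..N}. x \<in> U i \<longrightarrow> symbol (\<phi> x) = symbol x"
  proof (rule AE_finite_allI)
    fix i assume i: "i \<in> {1..N}"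
    have "T (cls (branch i (\<lambda>x. 1))) = cls (branch i symbol)"
      using fixed_commutes(1)[OF i, of "cls (\<lambda>x. 1)"] symbol_L2 by (simp add: branch_op_cls[OF i])
    then have "AE x in M. rep (T (cls (branch i (\<lambda>x. 1)))) x = branch i symbol x"
      using rep_L2(2)[OF branch_L2[OF i symbol_L2(1)]] by simp
    with fixed_is_multiplication[OF branch_L2[OF i L2_const[of 1]]]
    show "AE x in M. x \<in> U i \<longrightarrow> symbol (\<phi> x) = symbol x"
    proof eventually_elim
      case (elim x)
      then show ?case using J_pos[of i "\<phi> x"] by (simp add: branch_def split: if_splits)
    qed
  qed simp
  with U_cover show ?thesis by eventually_elim blast
qed

lemma fixed_scalar: "\<exists>c. T = (\<lambda>x\<in>H.V. hscale (L2 M) c x)"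
proof -
  note [measurable] = L2_measurable[OF symbol_L2(1)]
  have "\<exists>a. AE x in M. Re (symbol x) = a"
    using symbol_invariant by (intro ergodic_imp_constant) (auto elim: eventually_mono)
  moreover have "\<exists>b. AE x in M. Im (symbol x) = b"
    using symbol_invariant by (intro ergodic_imp_constant) (auto elim: eventually_mono)
  ultimately obtain a b where "AE x in M. Re (symbol x) = a" "AE x in M. Im (symbol x) = b" by blast
  then have c: "AE x in M. symbol x = Complex a b"
    by eventually_elim (simp add: complex_eq_iff)
  have "T x = (\<lambda>x\<in>H.V. hscale (L2 M) (Complex a b) x) x" if x: "x \<in> H.V" for x
  proof -
    obtain f where f: "f \<in> L2_fun M" "x = cls f" using L2_cases[OF x] .
    have "T x = cls (rep (T x))" using rep_carrier(2)[of "T x" M] T x by simp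
    also have "\<dots> = cls (\<lambda>z. Complex a b * f z)"
    proof (rule L2_class_cong)
      show "AE z in M. rep (T x) z = Complex a b * f z"
        using fixed_is_multiplication[OF f(1)] c unfolding f(2) by eventually_elim simp
    qed
    finally show ?thesis using f by (simp add: L2_hscale)
  qed
  then have "T = (\<lambda>x\<in>H.V. hscale (L2 M) (Complex a b) x)"
    using H.op_extensional[OF T] by (intro extensionalityI[of _ H.V]) auto
  then show ?thesis by blast
qed

end

lemma endo_ergodic: "ergodic_endo (op_algebra (L2 M)) C.\<alpha>"
proof -
  have one: "c \<odot>\<^bsub>H.A\<^esub> \<one>\<^bsub>H.A\<^esub> = (\<lambda>x\<in>H.V. hscale (L2 M) c x)" for c
    by (simp cong: restrict_cong)
  have "T \<in> range (\<lambda>c. c \<odot>\<^bsub>H.A\<^esub> \<one>\<^bsub>H.A\<^esub>)" if "T \<in> H.B" "C.\<alpha> T = T" for T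
    using fixed_scalar[OF that] unfolding one by blast
  moreover have "c \<odot>\<^bsub>H.A\<^esub> \<one>\<^bsub>H.A\<^esub> \<in> H.B" for c
    using H.scale_op[OF H.one_op] by simp
  ultimately show ?thesis
    unfolding ergodic_endo_def using C.scalars_fixed by (auto simp only: H.op_algebra_sel(1))
qed

end

section \<open>From the topological data to inverse branches\<close>

text \<open>The closure of \<open>V\<close> is compact, so its image is closed and contains the dense set \<open>\<phi> ` V\<close>. Hence
  every point outside \<open>\<phi> ` V\<close> is the image of a boundary point of \<open>V\<close>.\<close>

lemma compact_branch_conull:
  fixes \<phi> :: "'a::t2_space \<Rightarrow> 'a"
  assumes "compact (UNIV :: 'a set)" and sets: "sets M = sets borel"
    and homeo: "local_homeo \<phi>" and "open V"
    and dense: "(UNIV :: 'a set) = \<phi> ` V \<union> frontier (\<phi> ` V)"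
    and null: "frontier V \<in> null_sets M" and pres: "preserves_null_sets M \<phi>"
  shows "- (\<phi> ` V) \<in> null_sets M"
proof -
  have cont: "continuous_on UNIV \<phi>" and op: "open (\<phi> ` V)"
    using homeo \<open>open V\<close> by (auto simp: local_homeo_def)
  have "compact (UNIV \<inter> closure V)" by (intro compact_Int_closed assms) simp
  then have "compact (\<phi> ` closure V)"
    using cont by (intro compact_continuous_image) (auto intro: continuous_on_subset)
  then have "closed (\<phi> ` closure V)" by (rule compact_imp_closed)
  then have "closure (\<phi> ` V) \<subseteq> \<phi> ` closure V"
    by (intro closure_minimal image_mono closure_subset)
  moreover have "UNIV \<subseteq> closure (\<phi> ` V)"
    using dense closure_subset[of "\<phi> ` V"] by (auto simp: frontier_def)
  moreover have "closure V \<subseteq> V \<union> frontier V"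
    using \<open>open V\<close> by (auto simp: frontier_def interior_open)
  ultimately have sub: "- (\<phi> ` V) \<subseteq> \<phi> ` frontier V" by blast
  have "\<phi> ` frontier V \<in> null_sets M"
    using pres null by (simp add: preserves_null_sets_def)
  moreover have "- (\<phi> ` V) \<in> sets M" using op unfolding sets by simp
  ultimately show ?thesis using sub null_sets_subset by blast
qed

text \<open>Preimages of open sets under the inverse branch are images of open sets under \<open>\<phi>\<close>, hence open,
  up to the complement of \<open>\<phi> ` V\<close>, where the inverse takes a constant value.\<close>

lemma inverse_branch_measurable:
  fixes \<phi> :: "'a::t2_space \<Rightarrow> 'a"
  assumes sets: "sets M = sets borel" and homeo: "local_homeo \<phi>" and V: "open V" and inj: "inj_on \<phi> V"
  obtains \<psi> where "\<psi> \<in> measurable M M" "\<And>x. x \<in> V \<Longrightarrow> \<psi> (\<phi> x) = x" "\<And>x. x \<in> \<phi> ` V \<Longrightarrow> \<phi> (\<psi> x) = x"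
proof -
  have space: "space M = UNIV" using sets_eq_imp_space_eq[OF sets] by simp
  have op: "open (\<phi> ` W)" if "open W" for W using homeo that by (auto simp: local_homeo_def)
  define \<psi> where "\<psi> = (\<lambda>x. if x \<in> \<phi> ` V then the_inv_into V \<phi> x else undefined)"
  have inv: "\<psi> (\<phi> x) = x" if "x \<in> V" for x
    using that inj by (simp add: \<psi>_def the_inv_into_f_f)
  have "\<psi> \<in> measurable borel borel"
  proof (rule borel_measurableI)
    fix W :: "'a set" assume W: "open W"
    have "\<psi> -` W = \<phi> ` (V \<inter> W) \<union> (if undefined \<in> W then - (\<phi> ` V) else {})"
      using inv by (auto simp: \<psi>_def split: if_splits)
    moreover have "\<phi> ` (V \<inter> W) \<in> sets borel" "- (\<phi> ` V) \<in> sets borel"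
      using op[OF open_Int[OF V W]] op[OF V] by auto
    ultimately show "\<psi> -` W \<inter> space borel \<in> sets borel" by simp
  qed
  then have "\<psi> \<in> measurable M M" using measurable_cong_sets[OF sets sets] by blast
  moreover have "\<phi> (\<psi> x) = x" if "x \<in> \<phi> ` V" for x using that inv by auto
  ultimately show ?thesis using that inv by blast
qed

text \<open>
  The image of \<open>\<mu>\<close> restricted to a branch is dominated by \<open>\<mu>\<close> because \<open>\<phi>\<close> preserves \<open>\<mu>\<close>; it is
  equivalent to \<open>\<mu>\<close> because \<open>\<phi>\<close> maps null sets to null sets and the image of the
  branch has full measure. So its density can be chosen finite and strictly positive, with the value \<open>1\<close> on the null set where the Radon-Nikodym derivative is \<open>0\<close> or infinite.
\<close>

lemma branch_density:
  assumes "prob_space M" and space: "space M = UNIV"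
    and phi [measurable]: "\<phi> \<in> measurable M M" and distr: "distr M M \<phi> = M"
    and pres: "preserves_null_sets M \<phi>"
    and V [measurable]: "V \<in> sets M" and conull: "- (\<phi> ` V) \<in> null_sets M"
  obtains J :: "'a \<Rightarrow> real" where "J \<in> borel_measurable M" "\<And>x. 0 < J x"
    "distr (density M (indicator V)) M \<phi> = density M (\<lambda>x. ennreal (J x))"
proof -
  interpret prob_space M by fact
  define \<nu> where "\<nu> = distr (density M (indicator V)) M \<phi>"
  have \<nu>: "emeasure \<nu> E = emeasure M (V \<inter> \<phi> -` E)" if [measurable]: "E \<in> sets M" for E
  proof -
    have pre: "\<phi> -` E \<in> sets M" using measurable_sets[OF phi that] by (simp add: space)
    have "emeasure \<nu> E = emeasure (density M (indicator V)) (\<phi> -` E)"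
      unfolding \<nu>_def by (subst emeasure_distr) (auto simp: space)
    also have "\<dots> = (\<integral>\<^sup>+x. indicator V x * indicator (\<phi> -` E) x \<partial>M)"
      by (rule emeasure_density) (use pre in auto)
    also have "\<dots> = (\<integral>\<^sup>+x. indicator (V \<inter> \<phi> -` E) x \<partial>M)"
      by (simp only: indicator_inter_arith)
    also have "\<dots> = emeasure M (V \<inter> \<phi> -` E)" using pre by (intro nn_integral_indicator) auto
    finally show ?thesis .
  qed
  have sets_\<nu>: "sets \<nu> = sets M" and space_\<nu>: "space \<nu> = space M" by (simp_all add: \<nu>_def)
  have ac: "absolutely_continuous M \<nu>"
    unfolding absolutely_continuous_def
  proof
    fix E assume E: "E \<in> null_sets M"
    then have [measurable]: "E \<in> sets M" by auto
    have pre: "\<phi> -` E \<in> sets M" using measurable_sets[OF phi \<open>E \<in> sets M\<close>] by (simp add: space)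
    have "emeasure \<nu> E \<le> emeasure M (\<phi> -` E)"
      using pre by (simp add: \<nu> emeasure_mono)
    also have "\<dots> = emeasure (distr M M \<phi>) E" by (subst emeasure_distr) (auto simp: space)
    also have "\<dots> = 0" using E by (simp add: distr null_setsD1)
    finally show "E \<in> null_sets \<nu>" by (auto simp: sets_\<nu>)
  qed
  have "finite_measure \<nu>"
    by (rule finite_measureI) (use \<nu>[OF sets.top] emeasure_finite in \<open>auto simp: space_\<nu>\<close>)
  then interpret \<nu>: finite_measure \<nu> .
  define D where "D = RN_deriv M \<nu>"
  have D [measurable]: "D \<in> borel_measurable M" unfolding D_def by simp
  have dens: "density M D = \<nu>" unfolding D_def by (rule density_RN_deriv[OF ac sets_\<nu>])
  have fin: "AE x in M. D x \<noteq> \<infinity>"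
    unfolding D_def by (rule RN_deriv_finite[OF \<nu>.sigma_finite_measure_axioms ac sets_\<nu>])
  have "AE x in M. D x \<noteq> 0"
  proof -
    define E where "E = {x \<in> space M. D x = 0}"
    have E [measurable]: "E \<in> sets M" unfolding E_def by measurable
    have pre: "V \<inter> \<phi> -` E \<in> sets M"
      using measurable_sets[OF phi E] by (auto simp: space)
    have "emeasure \<nu> E = (\<integral>\<^sup>+x. D x * indicator E x \<partial>M)"
      unfolding dens[symmetric] by (rule emeasure_density) auto
    also have "\<dots> = (\<integral>\<^sup>+x. 0 \<partial>M)"
      by (intro nn_integral_cong) (auto simp: E_def indicator_def)
    finally have "V \<inter> \<phi> -` E \<in> null_sets M" using \<nu>[OF E] pre by auto
    then have "\<phi> ` (V \<inter> \<phi> -` E) \<in> null_sets M" using pres by (simp add: preserves_null_sets_def)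
    then have "\<phi> ` (V \<inter> \<phi> -` E) \<union> - (\<phi> ` V) \<in> null_sets M" using conull by (rule null_sets.Un)
    moreover have "E \<subseteq> \<phi> ` (V \<inter> \<phi> -` E) \<union> - (\<phi> ` V)" by blast
    ultimately have "E \<in> null_sets M" using E null_sets_subset by blast
    from AE_not_in[OF this] show ?thesis by eventually_elim (simp add: E_def space)
  qed
  with fin have pos: "AE x in M. 0 < D x \<and> D x < \<infinity>"
    by eventually_elim (auto simp: zero_less_iff_neq_zero less_top)
  define J where "J = (\<lambda>x. if 0 < D x \<and> D x < \<infinity> then enn2real (D x) else 1)"
  have J: "J \<in> borel_measurable M" unfolding J_def by measurable
  moreover have "0 < J x" for x by (auto simp: J_def enn2real_positive_iff)
  moreover have "density M (\<lambda>x. ennreal (J x)) = density M D"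
  proof (rule density_cong)
    show "AE x in M. ennreal (J x) = D x" using pos by eventually_elim (simp add: J_def)
  qed (use J in auto)
  ultimately show ?thesis using that[of J] dens \<nu>_def by simp
qed

theorem theorem3p2:
  fixes M :: "'a::t2_space measure"
    and \<phi> :: "'a \<Rightarrow> 'a"
    and N :: nat
    and U :: "nat \<Rightarrow> 'a set"
  assumes "compact (UNIV :: 'a set)"
    and "prob_space M"
    and "regular_borel_measure M"
    and "preserves_measure M \<phi>"
    and "local_homeo \<phi>"
    and "N > 1"
    and "\<And>x. card (\<phi> -` {x}) = N"
    and "\<And>i. i \<in> {1..N} \<Longrightarrow> open (U i)"
    and "disjoint_family_on U {1..N}"
    and "\<And>i. i \<in> {1..N} \<Longrightarrow> inj_on \<phi> (U i)"
    and "\<And>i j. i \<in> {1..N} \<Longrightarrow> j \<in> {1..N} \<Longrightarrow> \<phi> ` U i = \<phi> ` U j"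
    and "(UNIV :: 'a set) = (\<Union>i\<in>{1..N}. U i \<union> frontier (U i))"
    and "\<And>i. i \<in> {1..N} \<Longrightarrow> (UNIV :: 'a set) = \<phi> ` U i \<union> frontier (\<phi> ` U i)"
    and "\<And>i. i \<in> {1..N} \<Longrightarrow> frontier (U i) \<in> null_sets M"
    and "ergodic_map M \<phi>"
    and "preserves_null_sets M \<phi>"
    and "generates_mod_null M (word_set \<phi> U ` lists {1..N})"
  shows "\<exists>S. cuntz_family (op_algebra (L2 M)) N S
     \<and> cuntz_endo (op_algebra (L2 M)) N S \<in> star_hom (op_algebra (L2 M)) (op_algebra (L2 M))
     \<and> (\<forall>f\<in>L_infty_fun M.
          cuntz_endo (op_algebra (L2 M)) N S (mult_op M f) = mult_op M (f \<circ> \<phi>))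
     \<and> ergodic_endo (op_algebra (L2 M)) (cuntz_endo (op_algebra (L2 M)) N S)
     \<and> (\<exists>\<pi>. cuntz_rep N (L2 M) S \<pi>)
     \<and> (\<forall>\<pi>. cuntz_rep N (L2 M) S \<pi> \<longrightarrow> irreducible_rep (cuntz_algebra N) (L2 M) \<pi>)"
proof -
  have sets: "sets M = sets borel" using assms(3) by (simp add: regular_borel_measure_def)
  have space: "space M = UNIV" using sets_eq_imp_space_eq[OF sets] by simp
  have phi: "\<phi> \<in> measurable M M" "distr M M \<phi> = M"
    using assms(4) by (auto simp: preserves_measure_def)
  have U_sets: "U i \<in> sets M" if "i \<in> {1..N}" for i
    using assms(8)[OF that] unfolding sets by simp
  have conull: "- (\<phi> ` U i) \<in> null_sets M" if "i \<in> {1..N}" for i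
    by (rule compact_branch_conull[OF assms(1) sets assms(5) assms(8)[OF that] assms(13)[OF that]
          assms(14)[OF that] assms(16)])
  have "\<exists>\<psi>. \<psi> \<in> measurable M M \<and> (\<forall>x\<in>U i. \<psi> (\<phi> x) = x) \<and> (\<forall>x\<in>\<phi> ` U i. \<phi> (\<psi> x) = x)"
    if "i \<in> {1..N}" for i
    using inverse_branch_measurable[OF sets assms(5) assms(8)[OF that] assms(10)[OF that]] by metis
  then obtain \<psi> where \<psi>: "\<And>i. i \<in> {1..N} \<Longrightarrow> \<psi> i \<in> measurable M M"
      "\<And>i x. i \<in> {1..N} \<Longrightarrow> x \<in> U i \<Longrightarrow> \<psi> i (\<phi> x) = x"
      "\<And>i x. i \<in> {1..N} \<Longrightarrow> x \<in> \<phi> ` U i \<Longrightarrow> \<phi> (\<psi> i x) = x"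
    by metis
  have "\<exists>J :: 'a \<Rightarrow> real. i \<in> {1..N} \<longrightarrow> J \<in> borel_measurable M \<and> (\<forall>x. 0 < J x) \<and>
      distr (density M (indicator (U i))) M \<phi> = density M (\<lambda>x. ennreal (J x))" for i
    using branch_density[OF assms(2) space phi assms(16) U_sets conull] by metis
  then obtain J' :: "nat \<Rightarrow> 'a \<Rightarrow> real" where J': "\<And>i. i \<in> {1..N} \<Longrightarrow> J' i \<in> borel_measurable M \<and> (\<forall>x. 0 < J' i x) \<and>
      distr (density M (indicator (U i))) M \<phi> = density M (\<lambda>x. ennreal (J' i x))"
    by metis
  (* the densities must be positive at every index, also outside {1..N} *)
  define J where "J = (\<lambda>i. if i \<in> {1..N} then J' i else (\<lambda>x. 1))"
  have J: "J i \<in> borel_measurable M" "distr (density M (indicator (U i))) M \<phi> = density M (\<lambda>x. ennreal (J i x))"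
    if "i \<in> {1..N}" for i
    using J'[OF that] that by (simp_all add: J_def)
  have J_pos: "0 < J i x" for i x using J'[of i] by (auto simp: J_def)
  have cover: "AE x in M. \<exists>i\<in>{1..N}. x \<in> U i"
  proof -
    have "(\<Union>i\<in>{1..N}. frontier (U i)) \<in> null_sets M"
      using assms(14) by (intro null_sets.finite_UN) auto
    from AE_not_in[OF this] show ?thesis
    proof eventually_elim
      case (elim x)
      have "x \<in> (\<Union>i\<in>{1..N}. U i \<union> frontier (U i))" using assms(12) by blast
      then show ?case using elim by blast
    qed
  qed
  have phi_psi: "AE x in M. \<phi> (\<psi> i x) = x" if "i \<in> {1..N}" for i
    using AE_not_in[OF conull[OF that]] by eventually_elim (use \<psi>(3)[OF that] in blast)
  interpret E: ergodic_branch_system M \<phi> N U \<psi> J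
    using assms(2) phi U_sets assms(9) cover \<psi> phi_psi J J_pos space assms(15,17)
    unfolding ergodic_branch_system_def branch_system_def branch_system_axioms_def
      ergodic_branch_system_axioms_def by blast
  show ?thesis
  proof (intro exI[of _ E.branch_op] conjI allI impI ballI)
    show "cuntz_family (op_algebra (L2 M)) N E.branch_op" by (rule E.branch_op_family)
    show "cuntz_endo (op_algebra (L2 M)) N E.branch_op \<in> star_hom (op_algebra (L2 M)) (op_algebra (L2 M))"
      by (rule E.C.endo_star_hom)
    show "cuntz_endo (op_algebra (L2 M)) N E.branch_op (mult_op M f) = mult_op M (f \<circ> \<phi>)"
      if "f \<in> L_infty_fun M" for f
      by (rule E.endo_mult_op[OF that])
    show "ergodic_endo (op_algebra (L2 M)) (cuntz_endo (op_algebra (L2 M)) N E.branch_op)"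
      by (rule E.endo_ergodic)
    show "\<exists>\<pi>. cuntz_rep N (L2 M) E.branch_op \<pi>" by (rule E.C.cuntz_rep_exists)
    show "irreducible_rep (cuntz_algebra N) (L2 M) \<pi>" if "cuntz_rep N (L2 M) E.branch_op \<pi>" for \<pi>
      by (rule E.C.cuntz_rep_irreducible[OF E.endo_ergodic E.L2_nontrivial that])
  qed
qed

end
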